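(* Let $m,n,p,q\in\mathbb{N}_0$ with $0\le m\le q$, $0\le n\le p$, let $a_i,b_j\in\mathbb{R}$ and $\alpha_i,\beta_j\in(0,\infty)$, $i=1,\dots,p$, $j=1,\dots,q$, be such that $\Delta>0$ and $a^*>0$. Then the Fox-$H$ function $H^{m,n}_{p,q}(\cdot)$ defined on $\mathbb{C}\setminus\{0\}$ by choosing the contour $\mathcal{L}=\mathcal{L}_{-\infty}$ extends analytically the Fox-$H$ function $H^{m,n}_{p,q}(z)$ defined on $\{z\neq0:\ |\arg(z)|<a^*\pi/2\}$ by choosing the contour $\mathcal{L}=\mathcal{L}_{\mathrm{i}\gamma\infty}$. That is, the two functions coincide for all $z\ne0$ with $|\arg(z)|<a^*\pi/2$, and the function defined with $\mathcal{L}_{-\infty}$ is analytic on $\mathbb{C}\setminus\{0\}$, in the usual sense for functions with a possible branch point at $0$: it is holomorphic off the cut $(-\infty,0]$ of the principal argument and continues analytically along every path in $\mathbb{C}\setminus\{0\}$ when $\arg z$ is varied continuously.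
   Context: Fox-$H$ function: for integers $0\le m\le q$, $0\le n\le p$, parameters $a_i,b_j$ and $\alpha_i,\beta_j>0$, $$H^{m,n}_{p,q}(z)=\frac{1}{2\pi\mathrm{i}}\int_{\mathcal{L}}\mathcal{H}^{m,n}_{p,q}(s)z^{-s}\,\mathrm{d}s,\qquad \mathcal{H}^{m,n}_{p,q}(s)=\frac{\prod_{j=1}^{m}\Gamma(b_j+s\beta_j)\prod_{i=1}^{n}\Gamma(1-a_i-s\alpha_i)}{\prod_{i=n+1}^{p}\Gamma(a_i+s\alpha_i)\prod_{j=m+1}^{q}\Gamma(1-b_j-s\beta_j)},$$ with empty products equal to $1$ and $z^{-s}=\exp[-s(\mathrm{Log}(|z|)+\mathrm{i}\arg(z))]$, $\arg$ the principal value. The contour $\mathcal{L}$ separates all the poles $b_{jl}=-\frac{b_j+l}{\beta_j}$ ($j=1,\dots,m$, $l\in\mathbb{N}_0$), lying to its left, from all the poles $a_{ik}=\frac{1-a_i+k}{\alpha_i}$ ($i=1,\dots,n$, $k\in\mathbb{N}_0$), lying to its right; these two families are assumed disjoint, i.e. $\alpha_i(b_j+l)\ne\beta_j(a_i-k-1)$. $\mathcal{L}_{-\infty}$ is a left loop situated in a horizontal strip starting at $-\infty+\mathrm{i}\phi_1$ and terminating at $-\infty+\mathrm{i}\phi_2$, $-\infty<\phi_1<\phi_2<\infty$; $\mathcal{L}_{\mathrm{i}\gamma\infty}$ is a contour starting at $\gamma-\mathrm{i}\infty$ and terminating at $\gamma+\mathrm{i}\infty$, $\gamma\in\mathbb{R}$.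 Constants: $a^*=a_1^*+a_2^*$ and $\Delta=a_1^*-a_2^*$, where $a_1^*=\sum_{j=1}^m\beta_j-\sum_{i=n+1}^p\alpha_i$ and $a_2^*=\sum_{i=1}^n\alpha_i-\sum_{j=m+1}^q\beta_j$. *)

theory Defs
  imports "HOL-Complex_Analysis.Complex_Analysis"
begin

section \<open>Integrals along curves that are infinite in both directions\<close>

text \<open>
  A curve is a map \<open>L :: real \<Rightarrow> complex\<close>, traversed from \<open>-\<infinity>\<close> to \<open>\<infinity>\<close>. Its integral is
  improper: the contour integrals over \<open>L\<close> restricted to \<open>[A, B]\<close>, that is over the path
  \<open>L \<circ> linepath A B\<close>, have to converge as \<open>A \<rightarrow> -\<infinity>\<close> and \<open>B \<rightarrow> \<infinity>\<close> independently.
\<close>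

definition piecewise_C1_curve :: "(real \<Rightarrow> complex) \<Rightarrow> bool" where
  "piecewise_C1_curve L \<longleftrightarrow> (\<forall>A B. L piecewise_C1_differentiable_on {A..B})"

definition has_curve_integral ::
    "(complex \<Rightarrow> complex) \<Rightarrow> complex \<Rightarrow> (real \<Rightarrow> complex) \<Rightarrow> bool" where
  "has_curve_integral f I L \<longleftrightarrow>
     (\<forall>A B. f contour_integrable_on (L \<circ> linepath A B)) \<and>
     ((\<lambda>(A, B). contour_integral (L \<circ> linepath A B) f) \<longlongrightarrow> I) (at_bot \<times>\<^sub>F at_top)"

definition curve_integrable :: "(complex \<Rightarrow> complex) \<Rightarrow> (real \<Rightarrow> complex) \<Rightarrow> bool" where
  "curve_integrable f L \<longleftrightarrow> (\<exists>I. has_curve_integral f I L)"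

definition curve_integral :: "(complex \<Rightarrow> complex) \<Rightarrow> (real \<Rightarrow> complex) \<Rightarrow> complex" where
  "curve_integral f L = (THE I. has_curve_integral f I L)"


section \<open>The Fox H-function\<close>

text \<open>
  The parameters are \<open>a i, \<alpha> i\<close> for \<open>i = 1, \<dots>, p\<close> and \<open>b j, \<beta> j\<close> for \<open>j = 1, \<dots>, q\<close>.
  In the denominator of the kernel, \<^const>\<open>Gamma\<close> takes the value \<open>0\<close> at its poles and division
  by \<open>0\<close> yields \<open>0\<close>, which is the correct value of the entire function \<open>1/\<Gamma>\<close> there.
\<close>

definition fox_kernel ::
    "nat \<Rightarrow> nat \<Rightarrow> nat \<Rightarrow> nat \<Rightarrow> (nat \<Rightarrow> real) \<Rightarrow> (nat \<Rightarrow> real) \<Rightarrow> (nat \<Rightarrow> real) \<Rightarrow> (nat \<Rightarrow> real)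
      \<Rightarrow> complex \<Rightarrow> complex" where
  "fox_kernel m n p q a \<alpha> b \<beta> s =
     ((\<Prod>j=1..m. Gamma (of_real (b j) + s * of_real (\<beta> j))) *
      (\<Prod>i=1..n. Gamma (1 - of_real (a i) - s * of_real (\<alpha> i)))) /
     ((\<Prod>i=n+1..p. Gamma (of_real (a i) + s * of_real (\<alpha> i))) *
      (\<Prod>j=m+1..q. Gamma (1 - of_real (b j) - s * of_real (\<beta> j))))"

text \<open>
  The integrand \<open>\<H>(s) z\<^sup>-\<^sup>s\<close>, where \<open>z\<^sup>-\<^sup>s\<close> is formed with the value \<open>\<theta>\<close> of the argument of \<open>z\<close>.
  The principal value gives the H-function itself; the other ones give its branches.
\<close>

definition fox_integrand ::
    "nat \<Rightarrow> nat \<Rightarrow> nat \<Rightarrow> nat \<Rightarrow> (nat \<Rightarrow> real) \<Rightarrow> (nat \<Rightarrow> real) \<Rightarrow> (nat \<Rightarrow> real) \<Rightarrow> (nat \<Rightarrow> real)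
      \<Rightarrow> real \<Rightarrow> complex \<Rightarrow> complex \<Rightarrow> complex" where
  "fox_integrand m n p q a \<alpha> b \<beta> \<theta> z s =
     fox_kernel m n p q a \<alpha> b \<beta> s * exp (- s * (of_real (ln (cmod z)) + \<i> * of_real \<theta>))"

definition foxH_branch ::
    "nat \<Rightarrow> nat \<Rightarrow> nat \<Rightarrow> nat \<Rightarrow> (nat \<Rightarrow> real) \<Rightarrow> (nat \<Rightarrow> real) \<Rightarrow> (nat \<Rightarrow> real) \<Rightarrow> (nat \<Rightarrow> real)
      \<Rightarrow> (real \<Rightarrow> complex) \<Rightarrow> real \<Rightarrow> complex \<Rightarrow> complex" where
  "foxH_branch m n p q a \<alpha> b \<beta> L \<theta> z =
     1 / (2 * of_real pi * \<i>) * curve_integral (fox_integrand m n p q a \<alpha> b \<beta> \<theta> z) L"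

definition foxH ::
    "nat \<Rightarrow> nat \<Rightarrow> nat \<Rightarrow> nat \<Rightarrow> (nat \<Rightarrow> real) \<Rightarrow> (nat \<Rightarrow> real) \<Rightarrow> (nat \<Rightarrow> real) \<Rightarrow> (nat \<Rightarrow> real)
      \<Rightarrow> (real \<Rightarrow> complex) \<Rightarrow> complex \<Rightarrow> complex" where
  "foxH m n p q a \<alpha> b \<beta> L z = foxH_branch m n p q a \<alpha> b \<beta> L (Arg z) z"

definition fox_a1 :: "nat \<Rightarrow> nat \<Rightarrow> nat \<Rightarrow> (nat \<Rightarrow> real) \<Rightarrow> (nat \<Rightarrow> real) \<Rightarrow> real" where
  "fox_a1 m n p \<alpha> \<beta> = (\<Sum>j=1..m. \<beta> j) - (\<Sum>i=n+1..p. \<alpha> i)"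

definition fox_a2 :: "nat \<Rightarrow> nat \<Rightarrow> nat \<Rightarrow> (nat \<Rightarrow> real) \<Rightarrow> (nat \<Rightarrow> real) \<Rightarrow> real" where
  "fox_a2 m n q \<alpha> \<beta> = (\<Sum>i=1..n. \<alpha> i) - (\<Sum>j=m+1..q. \<beta> j)"

definition fox_astar ::
    "nat \<Rightarrow> nat \<Rightarrow> nat \<Rightarrow> nat \<Rightarrow> (nat \<Rightarrow> real) \<Rightarrow> (nat \<Rightarrow> real) \<Rightarrow> real" where
  "fox_astar m n p q \<alpha> \<beta> = fox_a1 m n p \<alpha> \<beta> + fox_a2 m n q \<alpha> \<beta>"

definition fox_Delta ::
    "nat \<Rightarrow> nat \<Rightarrow> nat \<Rightarrow> nat \<Rightarrow> (nat \<Rightarrow> real) \<Rightarrow> (nat \<Rightarrow> real) \<Rightarrow> real" where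
  "fox_Delta m n p q \<alpha> \<beta> = fox_a1 m n p \<alpha> \<beta> - fox_a2 m n q \<alpha> \<beta>"


section \<open>The contours\<close>

definition left_poles :: "nat \<Rightarrow> (nat \<Rightarrow> real) \<Rightarrow> (nat \<Rightarrow> real) \<Rightarrow> complex set" where
  "left_poles m b \<beta> = {of_real (- (b j + real l) / \<beta> j) | j l. j \<in> {1..m}}"

definition right_poles :: "nat \<Rightarrow> (nat \<Rightarrow> real) \<Rightarrow> (nat \<Rightarrow> real) \<Rightarrow> complex set" where
  "right_poles n a \<alpha> = {of_real ((1 - a i + real k) / \<alpha> i) | i k. i \<in> {1..n}}"

text \<open>
  The parts of the plane to the left and to the right of a curve are the components of its
  complement that contain the far negative and the far positive real numbers, respectively. This
  is the left and the right with respect to the orientation, for both kinds of contour below: for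
  the loop, the left is the inside, between its two ends.
\<close>

definition left_side :: "(real \<Rightarrow> complex) \<Rightarrow> complex set" where
  "left_side L =
     {s. \<forall>\<^sub>F x in at_bot. connected_component (- range L) s (complex_of_real x)}"

definition right_side :: "(real \<Rightarrow> complex) \<Rightarrow> complex set" where
  "right_side L =
     {s. \<forall>\<^sub>F x in at_top. connected_component (- range L) s (complex_of_real x)}"

definition separates_poles ::
    "nat \<Rightarrow> nat \<Rightarrow> (nat \<Rightarrow> real) \<Rightarrow> (nat \<Rightarrow> real) \<Rightarrow> (nat \<Rightarrow> real) \<Rightarrow> (nat \<Rightarrow> real)
      \<Rightarrow> (real \<Rightarrow> complex) \<Rightarrow> bool" where
  "separates_poles m n a \<alpha> b \<beta> L \<longleftrightarrow>
     left_poles m b \<beta> \<subseteq> left_side L \<and> right_poles n a \<alpha> \<subseteq> right_side L"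

text \<open>
  A left loop from \<open>-\<infinity> + \<i>\<phi>1\<close> to \<open>-\<infinity> + \<i>\<phi>2\<close>; the limits of the imaginary part make it lie in
  a horizontal strip. The poles to be encircled are real and run off to \<open>-\<infinity>\<close>, so of the pairs
  \<open>\<phi>1 < \<phi>2\<close> only those with \<open>\<phi>1 \<le> 0 \<le> \<phi>2\<close> can occur. The inequalities are strict because a
  curve that is merely asymptotic to its ends could, for \<open>\<phi>1 = 0\<close> or \<open>\<phi>2 = 0\<close>, come so close to
  the poles that the integral diverges.
\<close>

definition left_loop :: "real \<Rightarrow> real \<Rightarrow> (real \<Rightarrow> complex) \<Rightarrow> bool" where
  "left_loop \<phi>1 \<phi>2 L \<longleftrightarrow>
     \<phi>1 < 0 \<and> 0 < \<phi>2 \<and> piecewise_C1_curve L \<and>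
     filterlim (\<lambda>t. Re (L t)) at_bot at_bot \<and> ((\<lambda>t. Im (L t)) \<longlongrightarrow> \<phi>1) at_bot \<and>
     filterlim (\<lambda>t. Re (L t)) at_bot at_top \<and> ((\<lambda>t. Im (L t)) \<longlongrightarrow> \<phi>2) at_top"

definition vertical_contour :: "real \<Rightarrow> (real \<Rightarrow> complex) \<Rightarrow> bool" where
  "vertical_contour \<gamma> L \<longleftrightarrow>
     piecewise_C1_curve L \<and>
     ((\<lambda>t. Re (L t)) \<longlongrightarrow> \<gamma>) at_bot \<and> filterlim (\<lambda>t. Im (L t)) at_bot at_bot \<and>
     ((\<lambda>t. Re (L t)) \<longlongrightarrow> \<gamma>) at_top \<and> filterlim (\<lambda>t. Im (L t)) at_top at_top"


section \<open>Analytic continuation along a path\<close>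

text \<open>
  \<open>F t\<close> represents the germ at \<open>g t\<close>; germs at nearby parameters come from one holomorphic function.
\<close>

definition analytic_continuation_along ::
    "(real \<Rightarrow> complex) \<Rightarrow> (real \<Rightarrow> complex \<Rightarrow> complex) \<Rightarrow> bool" where
  "analytic_continuation_along g F \<longleftrightarrow>
     (\<forall>t\<in>{0..1}. \<exists>r>0. F t holomorphic_on ball (g t) r \<and>
        (\<forall>\<^sub>F u in at t within {0..1}.
           g u \<in> ball (g t) r \<and> (\<forall>\<^sub>F z in nhds (g u). F u z = F t z)))"

end

theory Submission
  imports Defs "HOL-Real_Asymp.Real_Asymp"
begin

text \<open>
  With \<open>\<zeta> = ln \<bar>z\<bar> + \<i>\<theta>\<close> the integrand is \<open>\<H>(s) e\<^sup>-\<^sup>s\<^sup>\<zeta>\<close>. Its integral over the loop is an entire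
  function \<open>G\<close> of \<open>\<zeta>\<close>. The H-function with the loop as contour is therefore \<open>G \<circ> Ln\<close>, up to the
  factor \<open>1/(2\<pi>\<i>)\<close>, and its continuation along a path \<open>g\<close> is \<open>G\<close> composed with a continuous logarithm
  along \<open>g\<close>: what is multivalued is only the logarithm (lemmas \<open>loop_integral\<close>,
  \<open>analytic_continuation_along_logarithm\<close>).

  Everything rests on one estimate, \<open>fox_kernel_decay\<close>. On \<open>Re s \<le> c\<close>, \<open>\<bar>Im s\<bar> \<ge> \<delta>\<close>, and for all
  \<open>R\<close> and \<open>\<epsilon> > 0\<close>,
  \<open>\<bar>\<H>(s)\<bar> \<le> C exp (-(a\<^sup>*\<pi>/2 - \<epsilon>) \<bar>Im s\<bar> + R Re s)\<close>.
  The factor \<open>exp (R Re s)\<close> with arbitrarily large \<open>R\<close> comes from \<open>\<Delta> > 0\<close>; it beats \<open>\<bar>z\<^sup>-\<^sup>s\<bar>\<close> on the two ends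
  of the loop, locally uniformly in \<open>\<zeta>\<close>. The other factor beats \<open>\<bar>z\<^sup>-\<^sup>s\<bar>\<close> on vertical lines precisely when
  \<open>\<bar>\<theta>\<bar> < a\<^sup>*\<pi>/2\<close>.

  The estimate is Stirling's formula for each Gamma factor. Let \<open>w = u + \<i>v\<close> with \<open>u \<ge> 1\<close>. From Gauss's product,
  \<open>ln \<Gamma>(u) - ln \<bar>\<Gamma>(w)\<bar>\<close> is the sum over \<open>k \<ge> 0\<close> of \<open>ln (\<bar>w + k\<bar> / (u + k))\<close>, whose terms decrease in
  \<open>k\<close>, so that comparison with an integral suffices: \<open>ln \<bar>\<Gamma>(w)\<bar> = Re (w Ln w) + O(u) + O(ln \<bar>w\<bar>)\<close>.
  Factors whose argument runs to the left are reflected, at the price of \<open>ln \<bar>sin\<bar> \<approx> \<pi> \<beta> \<bar>Im s\<bar>\<close>.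
  In the total, for \<open>\<H>(c - s)\<close> with \<open>Re s \<ge> 1\<close>, this gives
  \<open>-\<pi> a\<^sub>1\<^sup>* \<bar>Im s\<bar> - \<Delta> Re (s Ln s)\<close>, and \<open>Re (s Ln s) \<ge> Re s ln \<bar>s\<bar> - \<bar>Im s\<bar> \<pi>/2\<close> turns the first
  coefficient into \<open>-\<pi> a\<^sub>1\<^sup>* + \<Delta> \<pi>/2 = -\<pi> a\<^sup>*/2\<close>.

  For the equality of the two integrals, cut off the loop at \<open>Re s = -k\<close> and the vertical contour at
  \<open>Im s = \<plusminus>k\<close>, and join the ends by two straight segments. Along them the integrand is exponentially small in
  \<open>k\<close>, and Cauchy's theorem applies because the closed curve has winding number \<open>0\<close> about each pole:
  it is the difference of two closed curves, one for each contour, and either can be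
  closed far away on the side opposite to the pole, where it leaves the pole in its outside
  (\<open>winding_number_joined_left\<close>, \<open>winding_number_joined_right\<close>). This way the contours may be arbitrary
  piecewise smooth curves, with self-intersections and mutual intersections.
\<close>

section \<open>The modulus of Gamma in the right half-plane\<close>

text \<open>
  The antiderivative of \<open>ln (\<bar>y + \<i>v\<bar> / y)\<close> in \<open>y > 0\<close> that vanishes at infinity.
\<close>

definition stirling_defect :: "real \<Rightarrow> real \<Rightarrow> real" where
  "stirling_defect v y = Re (Complex y v * Ln (Complex y v)) - y * ln y"

lemma Re_Ln_Complex: "y > 0 \<Longrightarrow> Re (Ln (Complex y v)) = ln (cmod (Complex y v))"
  by (rule Re_Ln) (auto simp: complex_eq_iff)

lemma Re_times_Ln:
  assumes "s \<noteq> 0"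
  shows "Re (s * Ln s) = Re s * ln (cmod s) - Im s * Arg s"
  using assms by (simp add: Arg_eq_Im_Ln)

lemma stirling_defect_deriv:
  assumes "y > 0"
  shows "(stirling_defect v has_real_derivative ln (cmod (Complex y v)) - ln y) (at y)"
proof -
  have w: "Complex y v \<notin> \<real>\<^sub>\<le>\<^sub>0"
    using assms by (auto simp: complex_nonpos_Reals_iff)
  hence w0: "Complex y v \<noteq> 0" by auto
  have eq: "Complex x v = of_real x + \<i> * of_real v" for x by (simp add: complex_eq_iff)
  have 1: "((\<lambda>x. Complex x v * Ln (Complex x v)) has_vector_derivative (Ln (Complex y v) + 1)) (at y)"
  proof -
    have "((\<lambda>w. w * Ln w) has_field_derivative (Ln (Complex y v) + 1)) (at (Complex y v))"
      using w w0 by (auto intro!: derivative_eq_intros)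
    moreover have "((\<lambda>x. Complex x v) has_vector_derivative 1) (at y)"
      unfolding eq by (auto intro!: derivative_eq_intros)
    ultimately have "((\<lambda>w. w * Ln w) \<circ> (\<lambda>x. Complex x v) has_vector_derivative (1 * (Ln (Complex y v) + 1))) (at y)"
      by (intro field_vector_diff_chain_at)
    thus ?thesis by (simp add: o_def)
  qed
  have "((\<lambda>x. Re (Complex x v * Ln (Complex x v))) has_real_derivative Re (Ln (Complex y v) + 1)) (at y)"
    using bounded_linear.has_vector_derivative[OF bounded_linear_Re 1]
    by (simp add: has_real_derivative_iff_has_vector_derivative)
  moreover have "((\<lambda>x. x * ln x) has_real_derivative ln y + 1) (at y)"
    using assms by (auto intro!: derivative_eq_intros)
  ultimately show ?thesis
    using DERIV_diff assms unfolding stirling_defect_def by (fastforce simp: Re_Ln_Complex)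
qed

lemma stirling_defect_tendsto_0: "(stirling_defect v \<longlongrightarrow> 0) at_top"
proof -
  have "((\<lambda>y. y * ln (sqrt (y\<^sup>2 + v\<^sup>2)) - v * arctan (v / y) - y * ln y) \<longlongrightarrow> 0) at_top"
  proof (cases v "0 :: real" rule: linorder_cases)
    case less thus ?thesis by real_asymp
  next
    case equal thus ?thesis by (auto intro!: tendsto_eventually eventually_mono[OF eventually_gt_at_top[of 0]])
  next
    case greater thus ?thesis by real_asymp
  qed
  moreover have "\<forall>\<^sub>F y in at_top. stirling_defect v y = y * ln (sqrt (y\<^sup>2 + v\<^sup>2)) - v * arctan (v / y) - y * ln y"
    using eventually_gt_at_top[of 0]
  proof eventually_elim
    case (elim y)
    hence "Complex y v \<noteq> 0" by (auto simp: complex_eq_iff)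
    thus ?case using elim unfolding stirling_defect_def
      by (simp add: Re_times_Ln Arg_eq_Im_Ln Im_Ln_eq cmod_def)
  qed
  ultimately show ?thesis by (simp add: tendsto_cong)
qed

text \<open>
  Gauss's product for \<open>\<Gamma>\<close>, taken at \<open>u\<close> and at \<open>u + \<i>v\<close>: in the quotient the factors
  \<open>n! n\<^sup>u\<close> cancel, since \<open>\<bar>n\<^sup>w\<bar> = n\<^sup>u\<close>.
\<close>

lemma cmod_Gamma_quotient_LIMSEQ:
  fixes u v :: real
  assumes "u > 0"
  shows "(\<lambda>n. \<Sum>k\<le>n. ln (cmod (Complex (u + real k) v)) - ln (u + real k))
           \<longlonglongrightarrow> ln (Gamma u) - ln (cmod (Gamma (Complex u v)))"
proof -
  define w where "w = Complex u v"
  have w: "w \<notin> \<int>\<^sub>\<le>\<^sub>0" using assms by (auto simp: w_def elim!: nonpos_Ints_cases' simp: complex_eq_iff)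
  have u: "u \<notin> \<int>\<^sub>\<le>\<^sub>0" using assms by (auto elim!: nonpos_Ints_cases')
  have nz: "w + of_nat k \<noteq> 0" for k using assms by (auto simp: w_def complex_eq_iff)
  have "(\<lambda>n. ln (Gamma_series u n) - ln (cmod (Gamma_series w n)))
          \<longlonglongrightarrow> ln (Gamma u) - ln (cmod (Gamma w))"
    using w u by (intro tendsto_intros Gamma_series_LIMSEQ) (auto simp: Gamma_eq_zero_iff)
  moreover have "\<forall>\<^sub>F n in sequentially. ln (Gamma_series u n) - ln (cmod (Gamma_series w n)) =
      (\<Sum>k\<le>n. ln (cmod (Complex (u + real k) v)) - ln (u + real k))"
    using eventually_gt_at_top[of 0]
  proof eventually_elim
    case (elim n)
    have "ln (Gamma_series u n) = ln (fact n) + u * ln (real n) - ln (pochhammer u (n+1))"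
      using assms elim pochhammer_pos[of u "Suc n"] unfolding Gamma_series_def
      by (simp add: ln_div ln_mult)
    moreover have "ln (cmod (Gamma_series w n)) = ln (fact n) + u * ln (real n) - ln (cmod (pochhammer w (n+1)))"
    proof -
      have "pochhammer w (n+1) \<noteq> 0"
        using nz by (metis pochhammer_eq_0_iff add.commute add.right_inverse)
      thus ?thesis using elim unfolding Gamma_series_def
        by (simp add: norm_divide norm_mult ln_div ln_mult w_def)
    qed
    moreover have "ln (pochhammer u (n+1)) = (\<Sum>k\<le>n. ln (u + real k))"
      unfolding pochhammer_prod Suc_eq_plus1[symmetric] using assms
      by (subst ln_prod) (auto simp: lessThan_Suc_atMost atLeast0LessThan)
    moreover have "ln (cmod (pochhammer w (n+1))) = (\<Sum>k\<le>n. ln (cmod (w + of_nat k)))"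
      unfolding pochhammer_prod Suc_eq_plus1[symmetric] prod_norm[symmetric] using nz
      by (subst ln_prod) (auto simp: lessThan_Suc_atMost atLeast0LessThan)
    moreover have "w + of_nat k = Complex (u + real k) v" for k
      by (simp add: w_def complex_eq_iff)
    ultimately show ?case by (simp add: sum_subtractf)
  qed
  ultimately show ?thesis unfolding w_def by (simp add: tendsto_cong)
qed

lemma ln_cmod_Complex_defect_antimono:
  assumes "0 < x" "x \<le> y"
  shows "ln (cmod (Complex y v)) - ln y \<le> ln (cmod (Complex x v)) - ln x"
proof -
  have *: "ln (cmod (Complex t v)) - ln t = ln (sqrt (1 + (v / t)\<^sup>2))" if "t > 0" for t
  proof -
    have "cmod (Complex t v) / t = sqrt (1 + (v / t)\<^sup>2)"
    proof -
      have "1 + (v / t)\<^sup>2 = (t\<^sup>2 + v\<^sup>2) / t\<^sup>2"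
        using that by (simp add: power_divide add_divide_distrib)
      thus ?thesis using that by (simp add: cmod_def real_sqrt_divide)
    qed
    moreover have "cmod (Complex t v) > 0" using that by (auto simp: complex_eq_iff)
    ultimately show ?thesis using that ln_div[of "cmod (Complex t v)" t] by simp
  qed
  have "(v / y)\<^sup>2 \<le> (v / x)\<^sup>2"
    using assms by (simp add: power_divide frac_le power_mono)
  moreover have "0 < sqrt (1 + (v / t)\<^sup>2)" for t by (simp add: add_pos_nonneg)
  ultimately show ?thesis using assms * by (simp add: ln_mono)
qed

text \<open>
  The terms \<open>h(u + k)\<close> of the sum in the previous limit decrease in \<open>k\<close>, so the sum lies between
  \<open>\<integral>\<^sub>u h = - stirling_defect v u\<close> (with infinity as the upper limit) and that integral plus the first term \<open>h(u)\<close>.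
\<close>

theorem ln_cmod_Gamma_bounds:
  fixes u v :: real
  assumes "u > 0"
  shows "ln (cmod (Gamma (Complex u v))) \<le> ln (Gamma u) + stirling_defect v u"
    and "ln (cmod (Gamma (Complex u v))) \<ge> ln (Gamma u) + stirling_defect v u
           - (ln (cmod (Complex u v)) - ln u)"
proof -
  define h where "h = (\<lambda>y. ln (cmod (Complex y v)) - ln y)"
  define E where "E = stirling_defect v"
  have step: "h (y + 1) \<le> E (y + 1) - E y \<and> E (y + 1) - E y \<le> h y" if "y > 0" for y
  proof -
    have "\<exists>z. y < z \<and> z < y + 1 \<and> E (y + 1) - E y = (y + 1 - y) * h z"
      unfolding E_def h_def using that by (intro MVT2 stirling_defect_deriv) auto
    then obtain z where z: "y < z" "z < y + 1" "E (y + 1) - E y = h z" by auto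
    thus ?thesis using that ln_cmod_Complex_defect_antimono[of y z v]
        ln_cmod_Complex_defect_antimono[of z "y+1" v] by (simp add: h_def)
  qed
  have lower: "E (u + real n + 1) - E u \<le> (\<Sum>k\<le>n. h (u + real k))" for n
  proof (induction n)
    case 0 thus ?case using step[of u] assms by simp
  next
    case (Suc n)
    thus ?case using step[of "u + real n + 1"] assms by (simp add: algebra_simps)
  qed
  have upper: "(\<Sum>k\<le>n. h (u + real k)) \<le> h u + E (u + real n) - E u" for n
  proof (induction n)
    case 0 thus ?case by simp
  next
    case (Suc n)
    thus ?case using step[of "u + real n"] assms by (simp add: algebra_simps)
  qed
  have lim: "(\<lambda>n. \<Sum>k\<le>n. h (u + real k)) \<longlonglongrightarrow> ln (Gamma u) - ln (cmod (Gamma (Complex u v)))"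
    unfolding h_def by (rule cmod_Gamma_quotient_LIMSEQ[OF assms])
  have E1: "(\<lambda>n. E (u + real n)) \<longlonglongrightarrow> 0" unfolding E_def
    by (rule filterlim_compose[OF stirling_defect_tendsto_0]) real_asymp
  have E2: "(\<lambda>n. E (u + real n + 1)) \<longlonglongrightarrow> 0" unfolding E_def
    by (rule filterlim_compose[OF stirling_defect_tendsto_0]) real_asymp
  have "0 - E u \<le> ln (Gamma u) - ln (cmod (Gamma (Complex u v)))"
    using lower by (intro LIMSEQ_le[OF tendsto_diff[OF E2 tendsto_const] lim]) auto
  moreover have "ln (Gamma u) - ln (cmod (Gamma (Complex u v))) \<le> h u + 0 - E u"
    using upper by (intro LIMSEQ_le[OF lim tendsto_diff[OF tendsto_add[OF tendsto_const E1] tendsto_const]]) auto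
  ultimately show "ln (cmod (Gamma (Complex u v))) \<le> ln (Gamma u) + stirling_defect v u"
    and "ln (cmod (Gamma (Complex u v))) \<ge> ln (Gamma u) + stirling_defect v u
           - (ln (cmod (Complex u v)) - ln u)"
    by (simp_all add: E_def h_def)
qed

text \<open>
  On \<open>[1, 2]\<close> this is compactness. The step from \<open>t\<close> to \<open>t + 1\<close> adds an error of at most \<open>2\<close>, because
  \<open>(t + 1) (ln (t + 1) - ln t) \<le> (t + 1) / t\<close>; an error linear in \<open>u\<close> can absorb that.
\<close>

lemma ln_Gamma_real_growth:
  obtains K :: real where "K \<ge> 0" "\<And>u::real. u \<ge> 1 \<Longrightarrow> \<bar>ln (Gamma u) - u * ln u\<bar> \<le> K * u"
proof -
  have "continuous_on {1..2::real} (\<lambda>u. ln (Gamma u) - u * ln u)"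
    by (intro continuous_intros) (auto elim!: nonpos_Ints_cases' simp: Gamma_eq_zero_iff)
  hence "bounded ((\<lambda>u. ln (Gamma u) - u * ln u) ` {1..2::real})"
    by (intro compact_imp_bounded compact_continuous_image) auto
  then obtain M where "\<forall>x\<in>((\<lambda>u. ln (Gamma u) - u * ln u) ` {1..2::real}). norm x \<le> M"
    unfolding bounded_iff by blast
  hence M: "\<And>u::real. u \<in> {1..2} \<Longrightarrow> \<bar>ln (Gamma u) - u * ln u\<bar> \<le> M" by auto
  have M0: "M \<ge> 0" using M[of 1] by (simp add: order_trans[OF abs_ge_zero])
  define K where "K = M + 2"
  have "\<bar>ln (Gamma u) - u * ln u\<bar> \<le> K * u" if "u \<ge> 1" "u \<le> 1 + real n" for n and u :: real
    using that
  proof (induction n arbitrary: u)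
    case 0
    hence "u = 1" by simp
    thus ?case using M[of 1] M0 by (simp add: K_def)
  next
    case (Suc n)
    show ?case
    proof (cases "u \<le> 2")
      case True
      have "M * 1 \<le> K * u" unfolding K_def using Suc.prems M0 by (intro mult_mono) auto
      thus ?thesis using M[of u] True Suc.prems by simp
    next
      case False
      define t where "t = u - 1"
      have t: "t \<ge> 1" "u = t + 1" "t \<le> 1 + real n" using False Suc.prems by (auto simp: t_def)
      have "t \<notin> \<int>\<^sub>\<le>\<^sub>0" using t by (auto elim!: nonpos_Ints_cases')
      hence "Gamma u = t * Gamma t" unfolding t(2) using Gamma_plus1[of t] by simp
      moreover have "Gamma t \<noteq> 0" using Gamma_real_pos[of t] t by linarith
      ultimately have "ln (Gamma u) = ln t + ln (Gamma t)" using t by (simp add: ln_mult)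
      moreover have "\<bar>ln t + t * ln t - u * ln u\<bar> \<le> 2"
      proof -
        have "1 + 1 / t = u / t" using t by (simp add: field_simps)
        hence "ln u - ln t = ln (1 + 1 / t)" using t by (simp add: ln_div)
        moreover have "0 \<le> ln (1 + 1 / t)" using t by simp
        moreover have "ln (1 + 1 / t) \<le> 1 / t" using t by (intro ln_add_one_self_le_self) auto
        ultimately have d: "0 \<le> ln u - ln t" "ln u - ln t \<le> 1 / t" by auto
        have "ln t + t * ln t - u * ln u = - (u * (ln u - ln t))" by (simp add: t(2) algebra_simps)
        moreover have "0 \<le> u * (ln u - ln t)" using d t by simp
        moreover have "u * (ln u - ln t) \<le> u * (1 / t)" using d t by (intro mult_left_mono) auto
        moreover have "u * (1 / t) \<le> 2" using t by (simp add: field_simps)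
        ultimately show ?thesis by linarith
      qed
      moreover have "\<bar>ln (Gamma t) - t * ln t\<bar> \<le> K * t" by (rule Suc.IH) (use t in auto)
      moreover have "2 \<le> K" using M0 by (simp add: K_def)
      moreover have "K * u = K * t + K" by (simp add: t(2) algebra_simps)
      ultimately show ?thesis by linarith
    qed
  qed
  moreover have "u \<le> 1 + real (nat \<lceil>u\<rceil>)" for u :: real by linarith
  ultimately show ?thesis using that[of K] M0 unfolding K_def by (metis add_nonneg_nonneg zero_le_numeral)
qed

section \<open>Gamma factors up to negligible errors\<close>

text \<open>
  The leading terms of the asymptotics below are multiples of \<open>\<bar>Im s\<bar>\<close>, whose coefficients matter, and of
  \<open>Re (s Ln s)\<close>, which grows faster than \<open>Re s\<close> as \<open>Re s\<close> grows. Errors that change neither are \<open>O(Re s) + o(\<bar>Im s\<bar>)\<close>, and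
  this predicate collects them. It is closed under linear combinations, so that the estimates of the Gamma
  factors can simply be added up.
\<close>

definition negligible_error :: "real \<Rightarrow> (complex \<Rightarrow> real) \<Rightarrow> bool" where
  "negligible_error \<delta> g \<longleftrightarrow>
     (\<forall>\<epsilon>>0. \<exists>K. \<forall>s. Re s \<ge> 1 \<longrightarrow> \<bar>Im s\<bar> \<ge> \<delta> \<longrightarrow> \<bar>g s\<bar> \<le> K * Re s + \<epsilon> * \<bar>Im s\<bar>)"

lemma negligible_errorE:
  assumes "negligible_error \<delta> g" "\<epsilon> > 0"
  obtains K where "\<And>s. Re s \<ge> 1 \<Longrightarrow> \<bar>Im s\<bar> \<ge> \<delta> \<Longrightarrow> \<bar>g s\<bar> \<le> K * Re s + \<epsilon> * \<bar>Im s\<bar>"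
  using assms unfolding negligible_error_def by blast

lemma negligible_error_bound:
  assumes "\<And>s. Re s \<ge> 1 \<Longrightarrow> \<bar>Im s\<bar> \<ge> \<delta> \<Longrightarrow> \<bar>f s\<bar> \<le> \<bar>g s\<bar>" "negligible_error \<delta> g"
  shows "negligible_error \<delta> f"
  using assms unfolding negligible_error_def by (meson order_trans)

lemma negligible_error_Re: "negligible_error \<delta> Re"
  unfolding negligible_error_def
proof (intro allI impI)
  fix \<epsilon> :: real assume "\<epsilon> > 0"
  thus "\<exists>K. \<forall>s. Re s \<ge> 1 \<longrightarrow> \<bar>Im s\<bar> \<ge> \<delta> \<longrightarrow> \<bar>Re s\<bar> \<le> K * Re s + \<epsilon> * \<bar>Im s\<bar>"
    by (intro exI[of _ 1]) auto
qed

lemma negligible_error_const: "negligible_error \<delta> (\<lambda>s. c)"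
  unfolding negligible_error_def
proof (intro allI impI)
  fix \<epsilon> :: real assume \<epsilon>: "\<epsilon> > 0"
  have "\<bar>c\<bar> \<le> \<bar>c\<bar> * Re s + \<epsilon> * \<bar>Im s\<bar>" if "Re s \<ge> 1" for s
    using mult_left_mono[of 1 "Re s" "\<bar>c\<bar>"] that \<epsilon> by (simp add: add_increasing2)
  thus "\<exists>K. \<forall>s. Re s \<ge> 1 \<longrightarrow> \<bar>Im s\<bar> \<ge> \<delta> \<longrightarrow> \<bar>c\<bar> \<le> K * Re s + \<epsilon> * \<bar>Im s\<bar>"
    by blast
qed

lemma negligible_error_add:
  assumes "negligible_error \<delta> f" "negligible_error \<delta> g"
  shows "negligible_error \<delta> (\<lambda>s. f s + g s)"
  unfolding negligible_error_def
proof (intro allI impI)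
  fix \<epsilon> :: real assume \<epsilon>: "\<epsilon> > 0"
  obtain K where K: "\<And>s. Re s \<ge> 1 \<Longrightarrow> \<bar>Im s\<bar> \<ge> \<delta> \<Longrightarrow> \<bar>f s\<bar> \<le> K * Re s + \<epsilon>/2 * \<bar>Im s\<bar>"
    using negligible_errorE[OF assms(1), of "\<epsilon>/2"] \<epsilon> by auto
  obtain K' where K': "\<And>s. Re s \<ge> 1 \<Longrightarrow> \<bar>Im s\<bar> \<ge> \<delta> \<Longrightarrow> \<bar>g s\<bar> \<le> K' * Re s + \<epsilon>/2 * \<bar>Im s\<bar>"
    using negligible_errorE[OF assms(2), of "\<epsilon>/2"] \<epsilon> by auto
  have "\<bar>f s + g s\<bar> \<le> (K + K') * Re s + \<epsilon> * \<bar>Im s\<bar>" if "Re s \<ge> 1" "\<bar>Im s\<bar> \<ge> \<delta>" for s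
    using K[OF that] K'[OF that] abs_triangle_ineq[of "f s" "g s"] by (simp add: algebra_simps)
  thus "\<exists>K. \<forall>s. Re s \<ge> 1 \<longrightarrow> \<bar>Im s\<bar> \<ge> \<delta> \<longrightarrow> \<bar>f s + g s\<bar> \<le> K * Re s + \<epsilon> * \<bar>Im s\<bar>"
    by blast
qed

lemma negligible_error_cmult:
  assumes "negligible_error \<delta> f"
  shows "negligible_error \<delta> (\<lambda>s. c * f s)"
  unfolding negligible_error_def
proof (intro allI impI)
  fix \<epsilon> :: real assume \<epsilon>: "\<epsilon> > 0"
  obtain K where K: "\<And>s. Re s \<ge> 1 \<Longrightarrow> \<bar>Im s\<bar> \<ge> \<delta> \<Longrightarrow> \<bar>f s\<bar> \<le> K * Re s + \<epsilon>/(\<bar>c\<bar> + 1) * \<bar>Im s\<bar>"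
    using negligible_errorE[OF assms(1), of "\<epsilon>/(\<bar>c\<bar> + 1)"] \<epsilon> by auto
  have "\<bar>c * f s\<bar> \<le> (\<bar>c\<bar> * K) * Re s + \<epsilon> * \<bar>Im s\<bar>" if "Re s \<ge> 1" "\<bar>Im s\<bar> \<ge> \<delta>" for s
  proof -
    have "\<bar>c * f s\<bar> \<le> \<bar>c\<bar> * (K * Re s + \<epsilon>/(\<bar>c\<bar> + 1) * \<bar>Im s\<bar>)"
      unfolding abs_mult using K[OF that] by (intro mult_left_mono) auto
    also have "\<dots> = (\<bar>c\<bar> * K) * Re s + (\<bar>c\<bar> / (\<bar>c\<bar> + 1)) * (\<epsilon> * \<bar>Im s\<bar>)"
      by (simp add: algebra_simps)
    also have "(\<bar>c\<bar> / (\<bar>c\<bar> + 1)) * (\<epsilon> * \<bar>Im s\<bar>) \<le> 1 * (\<epsilon> * \<bar>Im s\<bar>)"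
      using \<epsilon> by (intro mult_right_mono) auto
    finally show ?thesis by simp
  qed
  thus "\<exists>K. \<forall>s. Re s \<ge> 1 \<longrightarrow> \<bar>Im s\<bar> \<ge> \<delta> \<longrightarrow> \<bar>c * f s\<bar> \<le> K * Re s + \<epsilon> * \<bar>Im s\<bar>"
    by blast
qed

lemma negligible_error_diff:
  assumes "negligible_error \<delta> f" "negligible_error \<delta> g"
  shows "negligible_error \<delta> (\<lambda>s. f s - g s)"
  using negligible_error_add[OF assms(1) negligible_error_cmult[OF assms(2), of "-1"]] by simp

lemma negligible_error_sum:
  assumes "\<And>i. i \<in> I \<Longrightarrow> negligible_error \<delta> (f i)"
  shows "negligible_error \<delta> (\<lambda>s. \<Sum>i\<in>I. f i s)"
  using assms
  by (induction I rule: infinite_finite_induct)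
     (auto intro: negligible_error_const[of _ 0] negligible_error_add)

text \<open>
  \<open>ln x \<le> \<eta> x - ln \<eta>\<close> for every \<open>\<eta> > 0\<close>, so a logarithm costs an arbitrarily small multiple of \<open>\<bar>s\<bar>\<close>.
\<close>

lemma negligible_error_ln:
  assumes "A \<ge> 1" "B \<ge> 0"
  shows "negligible_error \<delta> (\<lambda>s. ln (A + B * cmod s))"
  unfolding negligible_error_def
proof (intro allI impI)
  fix \<epsilon> :: real assume \<epsilon>: "\<epsilon> > 0"
  define \<eta> where "\<eta> = \<epsilon> / (B + 1)"
  have \<eta>: "\<eta> > 0" "\<eta> * B \<le> \<epsilon>" using \<epsilon> assms by (auto simp: \<eta>_def field_simps)
  define K where "K = \<eta> * A + \<bar>ln \<eta>\<bar> + \<eta> * B"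
  have "\<bar>ln (A + B * cmod s)\<bar> \<le> K * Re s + \<epsilon> * \<bar>Im s\<bar>" if s: "Re s \<ge> 1" for s
  proof -
    define x where "x = A + B * cmod s"
    have x: "x \<ge> 1" using assms by (simp add: x_def add_increasing2)
    have "ln x = ln (\<eta> * x) - ln \<eta>" using \<eta> x by (simp add: ln_mult)
    also have "ln (\<eta> * x) \<le> \<eta> * x" using \<eta> x ln_le_minus_one[of "\<eta> * x"] by simp
    finally have "ln x \<le> \<eta> * x + \<bar>ln \<eta>\<bar>" by linarith
    also have "\<eta> * x \<le> \<eta> * (A + B * (Re s + \<bar>Im s\<bar>))"
      unfolding x_def using \<eta> assms cmod_le[of s] s by (intro mult_left_mono add_left_mono) auto
    also have "\<eta> * (A + B * (Re s + \<bar>Im s\<bar>)) = \<eta> * A + \<eta> * B * Re s + \<eta> * B * \<bar>Im s\<bar>"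
      by (simp add: algebra_simps)
    also have "\<eta> * B * \<bar>Im s\<bar> \<le> \<epsilon> * \<bar>Im s\<bar>" using \<eta> by (intro mult_right_mono) auto
    finally have "ln x \<le> (\<eta> * A + \<bar>ln \<eta>\<bar>) + \<eta> * B * Re s + \<epsilon> * \<bar>Im s\<bar>" by simp
    moreover have "(\<eta> * A + \<bar>ln \<eta>\<bar>) * 1 \<le> (\<eta> * A + \<bar>ln \<eta>\<bar>) * Re s"
      using s \<eta> assms by (intro mult_left_mono) auto
    ultimately have "ln x \<le> K * Re s + \<epsilon> * \<bar>Im s\<bar>" by (simp add: K_def algebra_simps)
    moreover have "ln x \<ge> 0" using x by simp
    ultimately show ?thesis by (simp add: x_def)
  qed
  thus "\<exists>K. \<forall>s. Re s \<ge> 1 \<longrightarrow> \<bar>Im s\<bar> \<ge> \<delta> \<longrightarrow> \<bar>ln (A + B * cmod s)\<bar> \<le> K * Re s + \<epsilon> * \<bar>Im s\<bar>"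
    by blast
qed

lemma ln_cmod_Gamma_right_half_plane:
  obtains K where "K \<ge> 0"
    "\<And>w. Re w \<ge> 1 \<Longrightarrow> \<bar>ln (cmod (Gamma w)) - Re (w * Ln w)\<bar> \<le> K * Re w + ln (cmod w)"
proof -
  obtain K where K: "K \<ge> 0" "\<And>u::real. u \<ge> 1 \<Longrightarrow> \<bar>ln (Gamma u) - u * ln u\<bar> \<le> K * u"
    using ln_Gamma_real_growth by blast
  have "\<bar>ln (cmod (Gamma w)) - Re (w * Ln w)\<bar> \<le> K * Re w + ln (cmod w)" if w: "Re w \<ge> 1" for w
  proof -
    have eq: "Complex (Re w) (Im w) = w" by simp
    have "cmod w \<ge> Re w" using complex_Re_le_cmod by simp
    hence "ln (cmod w) \<ge> ln (Re w)" using w by (intro ln_mono) auto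
    moreover have "ln (Re w) \<ge> 0" using w by simp
    ultimately show ?thesis
      using ln_cmod_Gamma_bounds[of "Re w" "Im w"] K(2)[of "Re w"] w
      unfolding stirling_defect_def eq by linarith
  qed
  thus ?thesis using that K(1) by blast
qed

text \<open>
  The mean value theorem: the derivative of \<open>Re (z Ln z)\<close> in the real direction is \<open>ln \<bar>z\<bar> + 1\<close>.
\<close>

lemma Re_times_Ln_shift:
  assumes r: "0 < r" "r \<le> Re z" and c: "0 \<le> c"
  shows "\<bar>Re ((z + of_real c) * Ln (z + of_real c)) - Re (z * Ln z)\<bar>
           \<le> c * (1 + \<bar>ln r\<bar> + ln (1 + cmod z + c))"
proof (cases "c = 0")
  case False
  define v where "v = Im z"
  define J where "J = (\<lambda>y. stirling_defect v y + y * ln y)"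
  have J: "J y = Re (Complex y v * Ln (Complex y v))" for y by (simp add: J_def stirling_defect_def)
  have der: "(J has_real_derivative ln (cmod (Complex y v)) + 1) (at y)" if "y > 0" for y
    unfolding J_def using that by (auto intro!: derivative_eq_intros stirling_defect_deriv)
  have "\<exists>y. Re z < y \<and> y < Re z + c \<and> J (Re z + c) - J (Re z) = (Re z + c - Re z) * (ln (cmod (Complex y v)) + 1)"
    using r c False by (intro MVT2 der) auto
  then obtain y where y: "Re z < y" "y < Re z + c" "J (Re z + c) - J (Re z) = c * (ln (cmod (Complex y v)) + 1)"
    by auto
  have "z + of_real c = Complex (Re z + c) v" "z = Complex (Re z) v" by (simp_all add: v_def complex_eq_iff)
  hence "Re ((z + of_real c) * Ln (z + of_real c)) - Re (z * Ln z) = c * (ln (cmod (Complex y v)) + 1)"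
    using y(3) J by metis
  moreover have "\<bar>ln (cmod (Complex y v)) + 1\<bar> \<le> 1 + \<bar>ln r\<bar> + ln (1 + cmod z + c)"
  proof -
    have "r \<le> y" using y r by simp
    also have "y \<le> cmod (Complex y v)" using complex_Re_le_cmod[of "Complex y v"] by simp
    finally have 1: "r \<le> cmod (Complex y v)" .
    have "Complex y v = z + of_real (y - Re z)" by (simp add: v_def complex_eq_iff)
    hence "cmod (Complex y v) \<le> cmod z + \<bar>y - Re z\<bar>"
      by (metis norm_of_real norm_triangle_ineq)
    hence "cmod (Complex y v) \<le> 1 + cmod z + c" using y by simp
    hence "ln (cmod (Complex y v)) \<le> ln (1 + cmod z + c)" using 1 r by (intro ln_mono) auto
    moreover have "ln r \<le> ln (cmod (Complex y v))" using 1 r by (intro ln_mono) auto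
    moreover have "0 \<le> ln (1 + cmod z + c)" using c by (intro ln_ge_zero) simp
    ultimately show ?thesis by linarith
  qed
  ultimately show ?thesis using c by (simp add: abs_mult mult_left_mono)
qed simp

lemma Re_times_Ln_scale:
  assumes "\<beta> > 0" "s \<noteq> 0"
  shows "Re (of_real \<beta> * s * Ln (of_real \<beta> * s)) = \<beta> * Re (s * Ln s) + \<beta> * ln \<beta> * Re s"
proof -
  have "Ln (of_real \<beta> * s) = of_real (ln \<beta>) + Ln s" using assms by (simp add: Ln_times_of_real Ln_of_real)
  thus ?thesis by (simp only:) (simp add: algebra_simps)
qed

lemma ln_cmod_pochhammer_bound:
  assumes "0 < \<eta>" "\<eta> \<le> \<bar>Im w\<bar>"
  shows "\<bar>ln (cmod (pochhammer w N))\<bar> \<le> real N * (\<bar>ln \<eta>\<bar> + ln (1 + cmod w + real N))"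
proof -
  have nz: "w + of_nat k \<noteq> 0" for k using assms by (auto simp: complex_eq_iff)
  have "\<bar>ln (cmod (w + of_nat k))\<bar> \<le> \<bar>ln \<eta>\<bar> + ln (1 + cmod w + real N)" if "k < N" for k
  proof -
    have "\<eta> \<le> cmod (w + of_nat k)"
      using abs_Im_le_cmod[of "w + of_nat k"] assms by simp
    hence "ln \<eta> \<le> ln (cmod (w + of_nat k))" using assms by (intro ln_mono) auto
    moreover have "cmod (w + of_nat k) \<le> 1 + cmod w + real N"
      using norm_triangle_ineq[of w "of_nat k"] that by simp
    hence "ln (cmod (w + of_nat k)) \<le> ln (1 + cmod w + real N)" using nz by (intro ln_mono) auto
    moreover have "0 \<le> ln (1 + cmod w + real N)" by (intro ln_ge_zero) simp
    ultimately show ?thesis by linarith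
  qed
  hence "(\<Sum>k<N. \<bar>ln (cmod (w + of_nat k))\<bar>) \<le> (\<Sum>k<N. \<bar>ln \<eta>\<bar> + ln (1 + cmod w + real N))"
    by (intro sum_mono) auto
  moreover have "ln (cmod (pochhammer w N)) = (\<Sum>k<N. ln (cmod (w + of_nat k)))"
    unfolding pochhammer_prod prod_norm[symmetric] using nz
    by (subst ln_prod) (auto simp: atLeast0LessThan)
  ultimately show ?thesis
    using order_trans[OF sum_abs[of "\<lambda>k. ln (cmod (w + of_nat k))" "{..<N}"]] by simp
qed

lemma Gamma_nonzero_if_Im: "Im w \<noteq> 0 \<Longrightarrow> Gamma w \<noteq> (0 :: complex)"
  by (auto simp: Gamma_eq_zero_iff elim!: nonpos_Ints_cases')

text \<open>
  If \<open>c\<close> is very negative, the argument \<open>c + \<beta> s\<close> need not lie in the right half-plane, so it is first moved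
  there by a fixed integer. The shift, the constant \<open>c\<close> and the scaling by \<open>\<beta>\<close> all change
  the leading term by negligible errors only.
\<close>

theorem ln_cmod_Gamma_asymp:
  fixes c \<beta> \<delta> :: real
  assumes "\<beta> > 0" "\<delta> > 0"
  shows "negligible_error \<delta> (\<lambda>s. ln (cmod (Gamma (of_real c + of_real \<beta> * s))) - \<beta> * Re (s * Ln s))"
proof -
  obtain K where K: "K \<ge> 0"
    "\<And>w. Re w \<ge> 1 \<Longrightarrow> \<bar>ln (cmod (Gamma w)) - Re (w * Ln w)\<bar> \<le> K * Re w + ln (cmod w)"
    using ln_cmod_Gamma_right_half_plane by blast
  \<comment> \<open>the least shift with \<open>c + N \<ge> 1\<close>\<close>
  define N where "N = nat \<lceil>1 - c\<rceil>"
  define c' where "c' = c + real N"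
  have c': "c' \<ge> 1" unfolding c'_def N_def by linarith
  define l where "l = (\<lambda>s. ln (1 + \<bar>c\<bar> + c' + real N + \<beta> * cmod s))"
  \<comment> \<open>the sum of the errors of Stirling's formula, the shift, the scaling and the Pochhammer factor\<close>
  define G where "G = (\<lambda>s. K * (c' + \<beta> * Re s) + l s + c' * (1 + \<bar>ln \<beta>\<bar> + l s)
      + \<beta> * \<bar>ln \<beta>\<bar> * Re s + real N * (\<bar>ln (\<beta> * \<delta>)\<bar> + l s))"
  have l: "negligible_error \<delta> l"
    unfolding l_def using c' assms by (intro negligible_error_ln) auto
  have "negligible_error \<delta> G" unfolding G_def
    by (intro negligible_error_add negligible_error_cmult negligible_error_const negligible_error_Re l)
  moreover have "\<bar>ln (cmod (Gamma (of_real c + of_real \<beta> * s))) - \<beta> * Re (s * Ln s)\<bar> \<le> \<bar>G s\<bar>"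
    if s: "Re s \<ge> 1" "\<bar>Im s\<bar> \<ge> \<delta>" for s
  proof -
    define w where "w = of_real c + of_real \<beta> * s"
    define z where "z = of_real \<beta> * s"
    define W where "W = z + of_real c'"
    have Im: "Im w = \<beta> * Im s" by (simp add: w_def)
    have Imw: "\<beta> * \<delta> \<le> \<bar>Im w\<bar>" "0 < \<beta> * \<delta>" using assms s by (auto simp: Im abs_mult)
    have W: "W = w + of_nat N" by (simp add: W_def w_def z_def c'_def)
    have ReW: "Re W = c' + \<beta> * Re s" by (simp add: W_def z_def)
    have bs: "\<beta> * 1 \<le> \<beta> * Re s" using s assms by (intro mult_left_mono) auto
    have ReW1: "Re W \<ge> 1" using ReW bs assms c' by linarith
    have w0: "w \<notin> \<int>\<^sub>\<le>\<^sub>0" using Imw by (auto elim!: nonpos_Ints_cases')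
    have z: "cmod z = \<beta> * cmod s" using assms by (simp add: z_def norm_mult)
    have s0: "s \<noteq> 0" using s by auto
    have cW: "cmod W \<le> \<beta> * cmod s + c'" unfolding W_def using norm_triangle_ineq[of z "of_real c'"] c' z by simp
    have cw: "cmod w \<le> \<beta> * cmod s + \<bar>c\<bar>"
      using norm_triangle_ineq[of "of_real c" z] z by (simp add: w_def z_def)
    have pos: "\<beta> * cmod s \<ge> 0" using assms by simp
    have "cmod W > 0" using ReW1 complex_Re_le_cmod[of W] by linarith
    hence lW: "ln (cmod W) \<le> l s" unfolding l_def using cW pos c' by (intro ln_mono) auto
    have lw: "ln (1 + cmod w + real N) \<le> l s" unfolding l_def using cw c' norm_ge_zero[of w] by (intro ln_mono) linarith+
    have lz: "ln (1 + cmod z + c') \<le> l s" unfolding l_def z using c' pos by (intro ln_mono) auto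
    have poch: "pochhammer w N = Gamma W / Gamma w" unfolding W by (rule pochhammer_Gamma[OF w0])
    have nz: "Gamma w \<noteq> 0" "Gamma W \<noteq> 0"
      using Imw by (auto intro!: Gamma_nonzero_if_Im simp: W)
    have "ln (cmod (Gamma w)) = ln (cmod (Gamma W)) - ln (cmod (pochhammer w N))"
      unfolding poch norm_divide using nz by (simp add: ln_div)
    moreover have "\<bar>ln (cmod (Gamma W)) - Re (W * Ln W)\<bar> \<le> K * (c' + \<beta> * Re s) + l s"
      using K(2)[OF ReW1] lW unfolding ReW by linarith
    moreover have "\<bar>Re (W * Ln W) - Re (z * Ln z)\<bar> \<le> c' * (1 + \<bar>ln \<beta>\<bar> + l s)"
    proof -
      have "\<bar>Re (W * Ln W) - Re (z * Ln z)\<bar> \<le> c' * (1 + \<bar>ln \<beta>\<bar> + ln (1 + cmod z + c'))"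
        unfolding W_def by (rule Re_times_Ln_shift) (use assms bs c' in \<open>auto simp: z_def\<close>)
      also have "\<dots> \<le> c' * (1 + \<bar>ln \<beta>\<bar> + l s)" using lz c' by (intro mult_left_mono) auto
      finally show ?thesis .
    qed
    moreover have "\<bar>Re (z * Ln z) - \<beta> * Re (s * Ln s)\<bar> \<le> \<beta> * \<bar>ln \<beta>\<bar> * Re s"
      unfolding z_def Re_times_Ln_scale[OF assms(1) s0] using assms s by (simp add: abs_mult)
    moreover have "\<bar>ln (cmod (pochhammer w N))\<bar> \<le> real N * (\<bar>ln (\<beta> * \<delta>)\<bar> + l s)"
      using ln_cmod_pochhammer_bound[OF Imw(2,1), of N] lw
      by (smt (verit) mult_left_mono of_nat_0_le_iff)
    ultimately have "\<bar>ln (cmod (Gamma w)) - \<beta> * Re (s * Ln s)\<bar> \<le> G s"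
      unfolding G_def by linarith
    thus ?thesis by (simp add: w_def)
  qed
  ultimately show ?thesis by (rule negligible_error_bound[rotated])
qed

lemma ln_cmod_sin_bound:
  assumes "0 < \<eta>" "\<eta> \<le> \<bar>Im z\<bar>"
  shows "\<bar>ln (cmod (sin z)) - \<bar>Im z\<bar>\<bar> \<le> \<bar>ln ((1 - exp (- 2 * \<eta>)) / 2)\<bar>"
proof -
  define Y where "Y = \<bar>Im z\<bar>"
  have sq: "cmod (sin z) ^ 2 = (exp (2 * Y) + exp (- 2 * Y) - 2 * cos (2 * Re z)) / 4"
    unfolding norm_sin_squared Y_def by (auto simp: abs_if exp_minus)
  have e: "exp (2 * Y) = exp Y ^ 2" "exp (- 2 * Y) = exp (- Y) ^ 2" "exp Y * exp (- Y) = 1"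
    by (simp_all add: power2_eq_square exp_add[symmetric])
  have sq': "((exp Y - exp (- Y)) / 2) ^ 2 = (exp (2 * Y) + exp (- 2 * Y) - 2) / 4"
    "((exp Y + exp (- Y)) / 2) ^ 2 = (exp (2 * Y) + exp (- 2 * Y) + 2) / 4"
    using e(3) unfolding e(1,2) by (simp_all add: power2_sum power2_diff power_divide)
  have "cmod (sin z) ^ 2 \<ge> ((exp Y - exp (- Y)) / 2) ^ 2"
    unfolding sq sq' using cos_le_one[of "2 * Re z"] by simp
  hence 1: "cmod (sin z) \<ge> (exp Y - exp (- Y)) / 2"
    by (rule power2_le_imp_le) auto
  have "cmod (sin z) ^ 2 \<le> ((exp Y + exp (- Y)) / 2) ^ 2"
    unfolding sq sq' using cos_ge_minus_one[of "2 * Re z"] by (intro divide_right_mono) linarith+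
  hence "cmod (sin z) \<le> (exp Y + exp (- Y)) / 2"
    by (rule power2_le_imp_le) (auto intro!: add_nonneg_nonneg)
  moreover have "exp (- Y) \<le> exp Y" by (simp add: Y_def)
  moreover have "x \<le> u" if "x \<le> (u + v) / 2" "v \<le> u" for x u v :: real
    using that by (simp add: field_simps)
  ultimately have 2: "cmod (sin z) \<le> exp Y" by blast
  have 3: "exp Y * ((1 - exp (- 2 * \<eta>)) / 2) \<le> cmod (sin z)"
  proof -
    have "exp (- 2 * Y) \<le> exp (- 2 * \<eta>)" using assms by (simp add: Y_def)
    hence "exp Y * ((1 - exp (- 2 * \<eta>)) / 2) \<le> exp Y * ((1 - exp (- 2 * Y)) / 2)"
      by (intro mult_left_mono) auto
    also have "\<dots> = (exp Y - exp (- Y)) / 2" by (simp add: algebra_simps exp_add[symmetric] diff_divide_distrib)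
    finally show ?thesis using 1 by linarith
  qed
  have pos: "(1 - exp (- 2 * \<eta>)) / 2 > 0" using assms by simp
  have p: "0 < exp Y * ((1 - exp (- 2 * \<eta>)) / 2)" using pos by simp
  have "ln (exp Y * ((1 - exp (- 2 * \<eta>)) / 2)) \<le> ln (cmod (sin z))"
    using 3 p by (intro ln_mono) auto
  moreover have "ln (exp Y * ((1 - exp (- 2 * \<eta>)) / 2)) = Y + ln ((1 - exp (- 2 * \<eta>)) / 2)"
    using pos by (subst ln_mult) auto
  moreover have "ln (cmod (sin z)) \<le> ln (exp Y)"
    using 2 3 p by (intro ln_mono) linarith+
  hence "ln (cmod (sin z)) \<le> Y" by simp
  ultimately show ?thesis unfolding Y_def by linarith
qed

text \<open>
  By the reflection formula, \<open>ln \<bar>\<Gamma>(w)\<bar> = ln \<pi> - ln \<bar>sin (\<pi> w)\<bar> - ln \<bar>\<Gamma>(1 - w)\<bar>\<close>, and away from the real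
  axis \<open>ln \<bar>sin (\<pi> w)\<bar>\<close> differs from \<open>\<pi> \<bar>Im w\<bar>\<close> by a bounded amount.
\<close>

theorem ln_cmod_Gamma_asymp_reflected:
  fixes c \<beta> \<delta> :: real
  assumes "\<beta> > 0" "\<delta> > 0"
  shows "negligible_error \<delta> (\<lambda>s. ln (cmod (Gamma (of_real c - of_real \<beta> * s)))
           + pi * \<beta> * \<bar>Im s\<bar> + \<beta> * Re (s * Ln s))"
proof -
  define G where "G = (\<lambda>s. \<bar>ln (cmod (Gamma (of_real (1 - c) + of_real \<beta> * s))) - \<beta> * Re (s * Ln s)\<bar>
     + (ln pi + \<bar>ln ((1 - exp (- 2 * (pi * (\<beta> * \<delta>)))) / 2)\<bar>))"
  have "negligible_error \<delta> G" unfolding G_def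
    using ln_cmod_Gamma_asymp[OF assms, of "1 - c"]
    by (intro negligible_error_add negligible_error_const) (auto intro: negligible_error_bound)
  moreover have "\<bar>ln (cmod (Gamma (of_real c - of_real \<beta> * s))) + pi * \<beta> * \<bar>Im s\<bar> + \<beta> * Re (s * Ln s)\<bar>
      \<le> \<bar>G s\<bar>" if s: "Re s \<ge> 1" "\<bar>Im s\<bar> \<ge> \<delta>" for s
  proof -
    define w where "w = of_real c - of_real \<beta> * s"
    have 1: "1 - w = of_real (1 - c) + of_real \<beta> * s" by (simp add: w_def)
    have Im: "\<bar>Im w\<bar> = \<beta> * \<bar>Im s\<bar>" using assms by (simp add: w_def abs_mult)
    have "\<beta> * \<delta> \<le> \<bar>Im w\<bar>" "\<beta> * \<delta> > 0" unfolding Im using assms s by auto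
    hence Im': "pi * (\<beta> * \<delta>) \<le> \<bar>Im (of_real pi * w)\<bar>" "pi * (\<beta> * \<delta>) > 0" by (auto simp: abs_mult)
    have nz: "Gamma w \<noteq> 0" "Gamma (1 - w) \<noteq> 0" using Im' by (auto intro!: Gamma_nonzero_if_Im)
    have refl: "Gamma w * Gamma (1 - w) = of_real pi / sin (of_real pi * w)"
      by (rule Gamma_reflection_complex)
    hence snz: "sin (of_real pi * w) \<noteq> 0" using nz by auto
    have "cmod (Gamma w) * cmod (Gamma (1 - w)) = pi / cmod (sin (of_real pi * w))"
      using arg_cong[OF refl, of cmod] by (simp add: norm_mult norm_divide)
    hence "ln (cmod (Gamma w) * cmod (Gamma (1 - w))) = ln (pi / cmod (sin (of_real pi * w)))" by simp
    hence "ln (cmod (Gamma w)) + ln (cmod (Gamma (1 - w))) = ln pi - ln (cmod (sin (of_real pi * w)))"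
      using nz snz by (simp add: ln_mult ln_div)
    moreover have "\<bar>Im (of_real pi * w)\<bar> = pi * \<beta> * \<bar>Im s\<bar>" using Im by (simp add: abs_mult)
    hence "\<bar>ln (cmod (sin (of_real pi * w))) - pi * \<beta> * \<bar>Im s\<bar>\<bar>
        \<le> \<bar>ln ((1 - exp (- 2 * (pi * (\<beta> * \<delta>)))) / 2)\<bar>"
      using ln_cmod_sin_bound[OF Im'(2,1)] by simp
    moreover have "ln pi \<ge> 0" using pi_ge_two by (intro ln_ge_zero) simp
    moreover have "\<bar>x + t + j\<bar> \<le> \<bar>\<bar>y - j\<bar> + (l + d)\<bar>"
      if "x + y = l - S" "\<bar>S - t\<bar> \<le> d" "l \<ge> 0" for x y t j l d S :: real
      using that by linarith
    ultimately have "\<bar>ln (cmod (Gamma w)) + pi * \<beta> * \<bar>Im s\<bar> + \<beta> * Re (s * Ln s)\<bar>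
        \<le> \<bar>\<bar>ln (cmod (Gamma (1 - w))) - \<beta> * Re (s * Ln s)\<bar>
             + (ln pi + \<bar>ln ((1 - exp (- 2 * (pi * (\<beta> * \<delta>)))) / 2)\<bar>)\<bar>"
      by blast
    thus ?thesis unfolding G_def 1 unfolding w_def .
  qed
  ultimately show ?thesis by (rule negligible_error_bound[rotated])
qed

section \<open>Decay of the Fox kernel\<close>

locale fox_parameters =
  fixes m n p q :: nat and a \<alpha> b \<beta> :: "nat \<Rightarrow> real"
  assumes mn: "m \<le> q" "n \<le> p"
    and \<alpha>_pos: "\<And>i. i \<in> {1..p} \<Longrightarrow> \<alpha> i > 0"
    and \<beta>_pos: "\<And>j. j \<in> {1..q} \<Longrightarrow> \<beta> j > 0"
begin

abbreviation kernel :: "complex \<Rightarrow> complex" where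
  "kernel \<equiv> fox_kernel m n p q a \<alpha> b \<beta>"

abbreviation a1 :: real where "a1 \<equiv> fox_a1 m n p \<alpha> \<beta>"
abbreviation astar :: real where "astar \<equiv> fox_astar m n p q \<alpha> \<beta>"
abbreviation Delta :: real where "Delta \<equiv> fox_Delta m n p q \<alpha> \<beta>"

lemma ln_cmod_fox_kernel:
  assumes s: "Im s \<noteq> 0"
  shows "kernel s \<noteq> 0"
    and "ln (cmod (kernel s)) =
      (\<Sum>j=1..m. ln (cmod (Gamma (of_real (b j) + s * of_real (\<beta> j))))) +
      (\<Sum>i=1..n. ln (cmod (Gamma (1 - of_real (a i) - s * of_real (\<alpha> i))))) -
      (\<Sum>i=n+1..p. ln (cmod (Gamma (of_real (a i) + s * of_real (\<alpha> i))))) -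
      (\<Sum>j=m+1..q. ln (cmod (Gamma (1 - of_real (b j) - s * of_real (\<beta> j)))))"
proof -
  have \<alpha>': "\<alpha> i \<noteq> 0" if "i \<in> {1..n} \<union> {n+1..p}" for i using \<alpha>_pos[of i] that mn by force
  have \<beta>': "\<beta> j \<noteq> 0" if "j \<in> {1..m} \<union> {m+1..q}" for j using \<beta>_pos[of j] that mn by force
  have nz: "\<And>j. j \<in> {1..m} \<Longrightarrow> Gamma (of_real (b j) + s * of_real (\<beta> j)) \<noteq> 0"
    "\<And>i. i \<in> {1..n} \<Longrightarrow> Gamma (1 - of_real (a i) - s * of_real (\<alpha> i)) \<noteq> 0"
    "\<And>i. i \<in> {n+1..p} \<Longrightarrow> Gamma (of_real (a i) + s * of_real (\<alpha> i)) \<noteq> 0"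
    "\<And>j. j \<in> {m+1..q} \<Longrightarrow> Gamma (1 - of_real (b j) - s * of_real (\<beta> j)) \<noteq> 0"
    using s \<alpha>' \<beta>' by (auto intro!: Gamma_nonzero_if_Im)
  define A where "A = (\<Prod>j=1..m. Gamma (of_real (b j) + s * of_real (\<beta> j)))"
  define B where "B = (\<Prod>i=1..n. Gamma (1 - of_real (a i) - s * of_real (\<alpha> i)))"
  define C where "C = (\<Prod>i=n+1..p. Gamma (of_real (a i) + s * of_real (\<alpha> i)))"
  define D where "D = (\<Prod>j=m+1..q. Gamma (1 - of_real (b j) - s * of_real (\<beta> j)))"
  have z: "A \<noteq> 0" "B \<noteq> 0" "C \<noteq> 0" "D \<noteq> 0"
    unfolding A_def B_def C_def D_def by (simp_all only: prod_zero_iff finite_atLeastAtMost) (use nz in blast)+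
  have k: "kernel s = (A * B) / (C * D)"
    by (simp add: fox_kernel_def A_def B_def C_def D_def)
  show "kernel s \<noteq> 0" using k z by simp
  have l: "ln (cmod (prod f I)) = (\<Sum>i\<in>I. ln (cmod (f i)))"
    if "finite I" "\<And>i. i \<in> I \<Longrightarrow> f i \<noteq> 0" for f :: "nat \<Rightarrow> complex" and I
    unfolding prod_norm[symmetric] using that by (intro ln_prod) auto
  have "ln (cmod (kernel s)) =
      ln (cmod A) + ln (cmod B) - ln (cmod C) - ln (cmod D)"
    unfolding k using z by (simp add: norm_mult norm_divide ln_mult ln_div)
  also have "ln (cmod A) = (\<Sum>j=1..m. ln (cmod (Gamma (of_real (b j) + s * of_real (\<beta> j)))))"
    unfolding A_def by (intro l) (use nz in auto)
  also have "ln (cmod B) = (\<Sum>i=1..n. ln (cmod (Gamma (1 - of_real (a i) - s * of_real (\<alpha> i)))))"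
    unfolding B_def by (intro l) (use nz in auto)
  also have "ln (cmod C) = (\<Sum>i=n+1..p. ln (cmod (Gamma (of_real (a i) + s * of_real (\<alpha> i)))))"
    unfolding C_def by (intro l) (use nz in auto)
  also have "ln (cmod D) = (\<Sum>j=m+1..q. ln (cmod (Gamma (1 - of_real (b j) - s * of_real (\<beta> j)))))"
    unfolding D_def by (intro l) (use nz in auto)
  finally show "ln (cmod (kernel s)) =
      (\<Sum>j=1..m. ln (cmod (Gamma (of_real (b j) + s * of_real (\<beta> j))))) +
      (\<Sum>i=1..n. ln (cmod (Gamma (1 - of_real (a i) - s * of_real (\<alpha> i))))) -
      (\<Sum>i=n+1..p. ln (cmod (Gamma (of_real (a i) + s * of_real (\<alpha> i))))) -
      (\<Sum>j=m+1..q. ln (cmod (Gamma (1 - of_real (b j) - s * of_real (\<beta> j)))))" .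
qed

text \<open>
  To the left of a point \<open>c\<close> the arguments of the factors \<open>\<Gamma>(b\<^sub>j + \<beta>\<^sub>j s)\<close> and \<open>\<Gamma>(a\<^sub>i + \<alpha>\<^sub>i s)\<close> run to the
  left and need the reflected formula. Those are the factors that \<open>a\<^sub>1\<^sup>*\<close> counts, whence the term
  \<open>\<pi> a\<^sub>1\<^sup>* \<bar>Im s\<bar>\<close>; the terms \<open>Re (s Ln s)\<close> of all factors add up to the coefficient \<open>\<Delta>\<close>.
\<close>

theorem ln_cmod_fox_kernel_asymp:
  assumes \<delta>: "\<delta> > 0"
  shows "negligible_error \<delta> (\<lambda>s. ln (cmod (kernel (of_real c - s)))
    + pi * a1 * \<bar>Im s\<bar> + Delta * Re (s * Ln s))"
proof -
  define L where "L = (\<lambda>c \<beta> s. ln (cmod (Gamma (of_real c + of_real \<beta> * s))) - \<beta> * Re (s * Ln s))"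
  define R where "R = (\<lambda>c \<beta> s. ln (cmod (Gamma (of_real c - of_real \<beta> * s))) + pi * \<beta> * \<bar>Im s\<bar> + \<beta> * Re (s * Ln s))"
  define G where "G = (\<lambda>s. (\<Sum>j=1..m. R (b j + c * \<beta> j) (\<beta> j) s) + (\<Sum>i=1..n. L (1 - a i - c * \<alpha> i) (\<alpha> i) s)
    - (\<Sum>i=n+1..p. R (a i + c * \<alpha> i) (\<alpha> i) s) - (\<Sum>j=m+1..q. L (1 - b j - c * \<beta> j) (\<beta> j) s))"
  have L: "negligible_error \<delta> (L c \<beta>)" if "\<beta> > 0" for c \<beta>
    unfolding L_def using ln_cmod_Gamma_asymp[OF that \<delta>] by simp
  have R: "negligible_error \<delta> (R c \<beta>)" if "\<beta> > 0" for c \<beta>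
    unfolding R_def using ln_cmod_Gamma_asymp_reflected[OF that \<delta>] by simp
  have "negligible_error \<delta> G" unfolding G_def
    by (intro negligible_error_add negligible_error_diff negligible_error_sum L R)
       (use \<alpha>_pos \<beta>_pos mn in \<open>auto\<close>)
  moreover have "ln (cmod (kernel (of_real c - s)))
    + pi * a1 * \<bar>Im s\<bar> + Delta * Re (s * Ln s) = G s"
    if s: "Re s \<ge> 1" "\<bar>Im s\<bar> \<ge> \<delta>" for s
  proof -
    have e1: "of_real b + (of_real c - s) * of_real \<beta> = of_real (b + c * \<beta>) - of_real \<beta> * s" for b \<beta>
      by (simp add: algebra_simps)
    have e2: "1 - of_real b - (of_real c - s) * of_real \<beta> = of_real (1 - b - c * \<beta>) + of_real \<beta> * s" for b \<beta>
      by (simp add: algebra_simps)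
    have 0: "Im (of_real c - s) \<noteq> 0" using s \<delta> by auto
    have r: "ln (cmod (Gamma (of_real c - of_real \<beta> * s))) = R c \<beta> s - \<beta> * (pi * \<bar>Im s\<bar> + Re (s * Ln s))" for c \<beta>
      by (simp add: R_def algebra_simps)
    have l: "ln (cmod (Gamma (of_real c + of_real \<beta> * s))) = L c \<beta> s + \<beta> * Re (s * Ln s)" for c \<beta>
      by (simp add: L_def)
    show ?thesis
      unfolding ln_cmod_fox_kernel(2)[OF 0] e1 e2 r l sum.distrib sum_subtractf
        sum_distrib_right[symmetric] G_def fox_Delta_def fox_a1_def fox_a2_def
      by (simp add: algebra_simps)
  qed
  ultimately show ?thesis by (auto intro: negligible_error_bound)
qed

text \<open>
  Since \<open>\<bar>Arg s\<bar> \<le> \<pi>/2\<close> in the right half-plane, \<open>Re (s Ln s) = Re s ln \<bar>s\<bar> - Im s Arg s\<close> is at least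
  \<open>Re s ln (Re s) - \<bar>Im s\<bar> \<pi>/2\<close>. The second part combines with \<open>a\<^sub>1\<^sup>*\<close> to
  \<open>-\<pi> a\<^sub>1\<^sup>* + \<Delta> \<pi>/2 = -\<pi> a\<^sup>*/2\<close>; the first, multiplied by \<open>-\<Delta> < 0\<close>, dominates every linear function of \<open>Re s\<close>.
\<close>

theorem fox_kernel_decay:
  fixes c \<delta> \<epsilon> R :: real
  assumes \<Delta>: "Delta > 0" and \<delta>: "\<delta> > 0" and \<epsilon>: "\<epsilon> > 0"
  obtains C where "C > 0" "\<And>s. Re s \<le> c \<Longrightarrow> \<bar>Im s\<bar> \<ge> \<delta> \<Longrightarrow>
    cmod (kernel s)
      \<le> C * exp (- (astar * pi / 2 - \<epsilon>) * \<bar>Im s\<bar> + R * Re s)"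
proof -
  have A: "astar = 2 * a1 - Delta" by (simp add: fox_astar_def fox_Delta_def)
  define c0 where "c0 = c + 1"
  obtain K where K: "\<And>s. Re s \<ge> 1 \<Longrightarrow> \<bar>Im s\<bar> \<ge> \<delta> \<Longrightarrow>
      \<bar>ln (cmod (kernel (of_real c0 - s))) + pi * a1 * \<bar>Im s\<bar> + Delta * Re (s * Ln s)\<bar>
        \<le> K * Re s + \<epsilon> * \<bar>Im s\<bar>"
    using negligible_errorE[OF ln_cmod_fox_kernel_asymp[OF \<delta>] \<epsilon>] by blast
  \<comment> \<open>beyond \<open>ln (Re s) = M\<close> the term \<open>\<Delta> ln (Re s)\<close> exceeds \<open>K + R\<close>\<close>
  define M where "M = \<bar>K + R\<bar> / Delta"
  define C where "C = exp (\<bar>K + R\<bar> * exp M + R * - c0)"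
  have "cmod (kernel z) \<le> C * exp (- (astar * pi / 2 - \<epsilon>) * \<bar>Im z\<bar> + R * Re z)"
    if z: "Re z \<le> c" "\<bar>Im z\<bar> \<ge> \<delta>" for z
  proof -
    define s where "s = of_real c0 - z"
    have zs: "z = of_real c0 - s" "\<bar>Im z\<bar> = \<bar>Im s\<bar>" "Re z = c0 - Re s" by (auto simp: s_def)
    have s: "Re s \<ge> 1" "\<bar>Im s\<bar> \<ge> \<delta>" using z by (auto simp: s_def c0_def)
    have s0: "s \<noteq> 0" using s by auto
    have "ln (cmod (kernel z))
       \<le> - (pi * a1 * \<bar>Im s\<bar>) - Delta * Re (s * Ln s) + K * Re s + \<epsilon> * \<bar>Im s\<bar>"
      using K[OF s] unfolding zs(1) by linarith
    moreover have "Delta * (Re s * ln (Re s) - \<bar>Im s\<bar> * (pi / 2)) \<le> Delta * Re (s * Ln s)"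
    proof (intro mult_left_mono)
      have "\<bar>Arg s\<bar> \<le> pi / 2" using Re_Ln_pos_le[OF s0] s s0 by (simp add: Arg_eq_Im_Ln)
      hence "\<bar>Im s * Arg s\<bar> \<le> \<bar>Im s\<bar> * (pi / 2)" unfolding abs_mult by (intro mult_left_mono) auto
      moreover have "ln (Re s) \<le> ln (cmod s)" using s complex_Re_le_cmod[of s] by (intro ln_mono) auto
      hence "Re s * ln (Re s) \<le> Re s * ln (cmod s)" using s by (intro mult_left_mono) auto
      ultimately show "Re s * ln (Re s) - \<bar>Im s\<bar> * (pi / 2) \<le> Re (s * Ln s)"
        unfolding Re_times_Ln[OF s0] by linarith
    qed (use \<Delta> in simp)
    moreover have "- (pi * a1 * \<bar>Im s\<bar>) - Delta * (Re s * ln (Re s) - \<bar>Im s\<bar> * (pi / 2)) + K * Re s + \<epsilon> * \<bar>Im s\<bar>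
        = - (astar * pi / 2 - \<epsilon>) * \<bar>Im s\<bar> - R * Re s + Re s * (K + R - Delta * ln (Re s))"
      unfolding A by (simp add: field_simps)
    ultimately have 1: "ln (cmod (kernel z))
       \<le> - (astar * pi / 2 - \<epsilon>) * \<bar>Im s\<bar> - R * Re s + Re s * (K + R - Delta * ln (Re s))"
      by linarith
    have 2: "Re s * (K + R - Delta * ln (Re s)) \<le> \<bar>K + R\<bar> * exp M"
    proof (cases "ln (Re s) \<ge> M")
      case True
      have "\<bar>K + R\<bar> = Delta * M" using \<Delta> by (simp add: M_def)
      also have "Delta * M \<le> Delta * ln (Re s)" using True \<Delta> by (intro mult_left_mono) auto
      finally have "K + R - Delta * ln (Re s) \<le> 0" by linarith
      hence "Re s * (K + R - Delta * ln (Re s)) \<le> 0" using s by (intro mult_nonneg_nonpos) auto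
      also have "0 \<le> \<bar>K + R\<bar> * exp M" by simp
      finally show ?thesis .
    next
      case False
      have "Re s = exp (ln (Re s))" using s by simp
      also have "\<dots> \<le> exp M" using False by simp
      finally have e: "Re s \<le> exp M" .
      have "0 \<le> Delta * ln (Re s)" using \<Delta> s by simp
      hence "Re s * (K + R - Delta * ln (Re s)) \<le> Re s * \<bar>K + R\<bar>"
        using s by (intro mult_left_mono) auto
      also have "\<dots> \<le> exp M * \<bar>K + R\<bar>" using e by (intro mult_right_mono) auto
      finally show ?thesis by (simp add: mult.commute)
    qed
    have nz: "cmod (kernel z) > 0"
      using ln_cmod_fox_kernel(1)[of z] z \<delta> by auto
    have "cmod (kernel z) = exp (ln (cmod (kernel z)))"
      using nz by simp
    also have "\<dots> \<le> exp ((\<bar>K + R\<bar> * exp M + R * - c0) + (- (astar * pi / 2 - \<epsilon>) * \<bar>Im z\<bar> + R * Re z))"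
      using 1 2 unfolding zs(2,3) exp_le_cancel_iff by (simp add: algebra_simps)
    also have "\<dots> = C * exp (- (astar * pi / 2 - \<epsilon>) * \<bar>Im z\<bar> + R * Re z)"
      unfolding C_def by (rule exp_add)
    finally show ?thesis .
  qed
  thus ?thesis using that[of C] by (simp add: C_def)
qed

end

section \<open>Integrals along segments of a curve and their tails\<close>

abbreviation segment :: "(real \<Rightarrow> complex) \<Rightarrow> real \<Rightarrow> real \<Rightarrow> real \<Rightarrow> complex" where
  "segment L A B \<equiv> L \<circ> linepath A B"

lemma pathstart_segment [simp]: "pathstart (segment L A B) = L A"
  and pathfinish_segment [simp]: "pathfinish (segment L A B) = L B"
  by (simp_all add: pathstart_def pathfinish_def linepath_def)

lemma path_image_segment: "path_image (segment L A B) = L ` closed_segment A B"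
  unfolding path_image_def image_comp[symmetric] linepath_image_01 ..

lemma path_image_segment_subset_range: "path_image (segment L A B) \<subseteq> range L"
  by (auto simp: path_image_segment)

lemma valid_path_segment:
  assumes "piecewise_C1_curve L"
  shows "valid_path (segment L A B)"
proof (cases "A = B")
  case True
  hence "segment L A B = (\<lambda>_. L A)" by (auto simp: linepath_def fun_eq_iff algebra_simps)
  thus ?thesis by (simp add: valid_path_def C1_differentiable_imp_piecewise)
next
  case False
  have "(\<lambda>x. linepath A B x) piecewise_C1_differentiable_on {0..1}"
    using valid_path_linepath[of A B] by (simp add: valid_path_def)
  moreover have "L piecewise_C1_differentiable_on (linepath A B ` {0..1})"
    using assms by (auto simp: piecewise_C1_curve_def linepath_image_01 closed_segment_eq_real_ivl)
  moreover have "finite ({0..1} \<inter> linepath A B -` {x})" for x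
    by (rule finite_subset[of _ "{(x - A) / (B - A)}"]) (use False in \<open>auto simp: linepath_def field_simps\<close>)
  ultimately show ?thesis unfolding valid_path_def by (rule piecewise_C1_differentiable_compose)
qed

lemma subpath_segment:
  "subpath u v (segment L A B) = segment L (linepath A B u) (linepath A B v)"
  by (auto simp: subpath_def linepath_def fun_eq_iff algebra_simps)

lemma contour_integral_segment_combine:
  assumes L: "piecewise_C1_curve L" and int: "\<And>A B. f contour_integrable_on segment L A B"
  shows "contour_integral (segment L A B) f + contour_integral (segment L B C) f
           = contour_integral (segment L A C) f"
proof -
  define M1 where "M1 = min A (min B C)"
  define M2 where "M2 = max A (max B C)"
  have *: "\<exists>u\<in>{0..1}. X = linepath M1 M2 u" if "X \<in> {A, B, C}" for X
  proof -
    have "X \<in> closed_segment M1 M2" using that by (auto simp: M1_def M2_def closed_segment_eq_real_ivl)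
    thus ?thesis by (auto simp: linepath_image_01[symmetric])
  qed
  obtain u v w where uvw: "u \<in> {0..1}" "v \<in> {0..1}" "w \<in> {0..1}"
    "A = linepath M1 M2 u" "B = linepath M1 M2 v" "C = linepath M1 M2 w"
    using *[of A] *[of B] *[of C] by blast
  show ?thesis
    using contour_integral_subpath_combine[OF int[of M1 M2] valid_path_segment[OF L] uvw(1-3)]
    unfolding subpath_segment uvw(4-6)[symmetric] .
qed

text \<open>
  The point is that the bound is independent of the length of the segment. The length is controlled by the change of
  the exponent, up to \<open>W\<close>, so that the integral of \<open>exp (Re (d s))\<close> over the segment is essentially the
  integral of the exponential function over an interval.
\<close>

lemma contour_integral_linepath_exp_bound:
  fixes d :: complex
  assumes cont: "continuous_on (closed_segment w w') f"
    and bound: "\<And>s. s \<in> closed_segment w w' \<Longrightarrow> cmod (f s) \<le> C * exp (Re (d * s))"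
    and dist: "cmod (w' - w) \<le> K * \<bar>Re (d * w') - Re (d * w)\<bar> + W"
    and nn: "C \<ge> 0" "K \<ge> 0" "W \<ge> 0"
  shows "cmod (contour_integral (linepath w w') f)
           \<le> C * (K + W) * exp (max (Re (d * w)) (Re (d * w')))"
proof -
  have main: "cmod (contour_integral (linepath w w') f) \<le> C * (K + W) * exp (Re (d * w'))"
    if le: "Re (d * w) \<le> Re (d * w')" and cont: "continuous_on (closed_segment w w') f"
      and bound: "\<And>s. s \<in> closed_segment w w' \<Longrightarrow> cmod (f s) \<le> C * exp (Re (d * s))"
      and dist: "cmod (w' - w) \<le> K * (Re (d * w') - Re (d * w)) + W" for w w'
  proof -
    define q where "q = Re (d * w)"
    define h where "h = Re (d * w') - Re (d * w)"
    have h: "h \<ge> 0" using le by (simp add: h_def)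
    define g where "g = (\<lambda>x. C * K * (h * exp (q + x * h)) + C * W * exp (q + h))"
    have "(f has_contour_integral contour_integral (linepath w w') f) (linepath w w')"
      by (intro has_contour_integral_integral contour_integrable_continuous_linepath cont)
    hence I: "((\<lambda>x. f (linepath w w' x) * (w' - w)) has_integral contour_integral (linepath w w') f) {0..1}"
      by (simp add: has_contour_integral_linepath)
    have "((\<lambda>x. h * exp (q + x * h)) has_integral exp (q + 1 * h) - exp (q + 0 * h)) {0..1}"
      by (intro fundamental_theorem_of_calculus)
         (auto intro!: derivative_eq_intros simp flip: has_real_derivative_iff_has_vector_derivative)
    hence G: "(g has_integral C * K * (exp (q + h) - exp q) + C * W * exp (q + h)) {0..1}"
      unfolding g_def
      using has_integral_const_real[of "C * W * exp (q + h)" 0 1]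
      by (intro has_integral_add has_integral_mult_right[where c = "C * K"]) auto
    have "cmod (f (linepath w w' x) * (w' - w)) \<le> g x" if x: "x \<in> {0..1}" for x
    proof -
      have "linepath w w' x \<in> closed_segment w w'" using x by (auto simp: linepath_image_01[symmetric])
      hence "cmod (f (linepath w w' x)) \<le> C * exp (Re (d * linepath w w' x))" by (rule bound)
      also have "Re (d * linepath w w' x) = q + x * h"
        by (simp add: linepath_def q_def h_def scaleR_conv_of_real algebra_simps)
      finally have "cmod (f (linepath w w' x) * (w' - w)) \<le> C * exp (q + x * h) * (K * h + W)"
        unfolding norm_mult using dist nn by (intro mult_mono) (auto simp: h_def)
      also have "\<dots> = C * K * (h * exp (q + x * h)) + C * W * exp (q + x * h)"
        by (simp add: algebra_simps)
      also have "\<dots> \<le> g x"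
      proof -
        have "x * h \<le> 1 * h" using x h by (intro mult_right_mono) auto
        thus ?thesis unfolding g_def using nn by (intro add_left_mono mult_left_mono) auto
      qed
      finally show ?thesis .
    qed
    hence "cmod (contour_integral (linepath w w') f) \<le> C * K * (exp (q + h) - exp q) + C * W * exp (q + h)"
      using integral_norm_bound_integral[of "\<lambda>x. f (linepath w w' x) * (w' - w)" "{0..1}" g] I G
      by (metis has_integral_integrable integral_unique)
    also have "\<dots> \<le> C * K * exp (q + h) + C * W * exp (q + h)"
      using nn by (intro add_right_mono mult_left_mono) auto
    also have "\<dots> = C * (K + W) * exp (Re (d * w'))" by (simp add: q_def h_def algebra_simps)
    finally show ?thesis .
  qed
  show ?thesis
  proof (cases "Re (d * w) \<le> Re (d * w')")
    case True
    thus ?thesis using main[OF True cont bound] dist by (simp add: max_absorb2)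
  next
    case False
    have "contour_integral (linepath w w') f = - contour_integral (linepath w' w) f"
      using cont by (simp add: contour_integral_reverse_linepath)
    moreover have "cmod (contour_integral (linepath w' w) f) \<le> C * (K + W) * exp (Re (d * w))"
      using False cont bound dist
      by (intro main) (auto simp: closed_segment_commute norm_minus_commute)
    ultimately show ?thesis using False by (simp add: max_absorb1)
  qed
qed

text \<open>
  Inside a convex set free of singularities the curve can be replaced by the straight segment between its ends.
  This makes the bound independent of the length of the curve, which may be infinite towards the ends of the contour.
\<close>

lemma contour_integral_segment_exp_bound:
  fixes d :: complex
  assumes L: "piecewise_C1_curve L" and U: "open U" "convex U" and f: "f holomorphic_on U"
    and LU: "L ` closed_segment A B \<subseteq> U"
    and bound: "\<And>s. s \<in> U \<Longrightarrow> cmod (f s) \<le> C * exp (Re (d * s))"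
    and dist: "\<And>s s'. s \<in> U \<Longrightarrow> s' \<in> U \<Longrightarrow> cmod (s - s') \<le> K * \<bar>Re (d * s) - Re (d * s')\<bar> + W"
    and nn: "C \<ge> 0" "K \<ge> 0" "W \<ge> 0"
  shows "cmod (contour_integral (segment L A B) f)
           \<le> C * (K + W) * exp (Re (d * L A)) + C * (K + W) * exp (Re (d * L B))"
proof -
  obtain F where F: "\<And>x. x \<in> U \<Longrightarrow> (F has_field_derivative f x) (at x within U)"
    using holomorphic_convex_primitive'[OF U(2,1) f] by blast
  have AB: "L A \<in> U" "L B \<in> U" using LU by auto
  hence seg: "closed_segment (L A) (L B) \<subseteq> U" using U by (simp add: closed_segment_subset)
  have "(f has_contour_integral (F (L B) - F (L A))) (segment L A B)"
    using contour_integral_primitive[OF F valid_path_segment[OF L], of A B] LU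
    by (simp add: path_image_segment)
  moreover have "(f has_contour_integral (F (L B) - F (L A))) (linepath (L A) (L B))"
    using contour_integral_primitive[OF F valid_path_linepath[of "L A" "L B"]] seg by simp
  ultimately have "contour_integral (segment L A B) f = contour_integral (linepath (L A) (L B)) f"
    by (metis contour_integral_unique)
  also have "cmod \<dots> \<le> C * (K + W) * exp (max (Re (d * L A)) (Re (d * L B)))"
  proof (intro contour_integral_linepath_exp_bound nn)
    show "continuous_on (closed_segment (L A) (L B)) f"
      using f seg by (meson continuous_on_subset holomorphic_on_imp_continuous_on)
  qed (use seg AB bound dist in auto)
  also have "\<dots> \<le> C * (K + W) * (exp (Re (d * L A)) + exp (Re (d * L B)))"
    using nn by (intro mult_left_mono) (auto simp: max_def)
  finally show ?thesis by (simp add: algebra_simps)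
qed

lemma Cauchy_tail_limit:
  fixes \<phi> :: "real \<Rightarrow> complex"
  assumes tail: "\<And>B B'. B \<ge> T \<Longrightarrow> B' \<ge> T \<Longrightarrow> cmod (\<phi> B' - \<phi> B) \<le> e B + e B'"
    and e: "(e \<longlongrightarrow> 0) at_top"
  obtains l where "(\<phi> \<longlongrightarrow> l) at_top" "\<And>B. B \<ge> T \<Longrightarrow> cmod (l - \<phi> B) \<le> e B"
proof -
  have e_seq: "(\<lambda>n. e (real n)) \<longlonglongrightarrow> 0"
    using filterlim_compose[OF e filterlim_real_sequentially] .
  have "Cauchy (\<lambda>n. \<phi> (real n))"
  proof (rule metric_CauchyI)
    fix \<epsilon> :: real assume \<epsilon>: "\<epsilon> > 0"
    have "\<forall>\<^sub>F n in sequentially. e (real n) < \<epsilon> / 2"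
      using order_tendstoD(2)[OF e_seq, of "\<epsilon> / 2"] \<epsilon> by simp
    then obtain N where N: "\<And>n. n \<ge> N \<Longrightarrow> e (real n) < \<epsilon> / 2" by (auto simp: eventually_sequentially)
    have "dist (\<phi> (real k)) (\<phi> (real n)) < \<epsilon>" if "k \<ge> max N (nat \<lceil>T\<rceil>)" "n \<ge> max N (nat \<lceil>T\<rceil>)" for k n
    proof -
      have "real k \<ge> T" "real n \<ge> T" using that by linarith+
      thus ?thesis using tail[of "real n" "real k"] N[of k] N[of n] that by (simp add: dist_norm)
    qed
    thus "\<exists>M. \<forall>k\<ge>M. \<forall>n\<ge>M. dist (\<phi> (real k)) (\<phi> (real n)) < \<epsilon>" by blast
  qed
  then obtain l where l: "(\<lambda>n. \<phi> (real n)) \<longlonglongrightarrow> l" by (auto simp: Cauchy_convergent_iff convergent_def)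
  have bound: "cmod (l - \<phi> B) \<le> e B" if B: "B \<ge> T" for B
  proof -
    have "(\<lambda>n. cmod (\<phi> (real n) - \<phi> B)) \<longlonglongrightarrow> cmod (l - \<phi> B)" by (intro tendsto_intros l)
    moreover have "(\<lambda>n. e B + e (real n)) \<longlonglongrightarrow> e B + 0" by (intro tendsto_intros e_seq)
    moreover have "\<forall>\<^sub>F n in sequentially. cmod (\<phi> (real n) - \<phi> B) \<le> e B + e (real n)"
      using eventually_ge_at_top[of "nat \<lceil>T\<rceil>"]
    proof eventually_elim
      case (elim n)
      hence "real n \<ge> T" by linarith
      thus ?case using tail[OF B] by blast
    qed
    ultimately show ?thesis using tendsto_le[of sequentially] by force
  qed
  have "((\<lambda>B. \<phi> B - l) \<longlongrightarrow> 0) at_top"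
  proof (rule Lim_null_comparison[OF _ e])
    show "\<forall>\<^sub>F B in at_top. cmod (\<phi> B - l) \<le> e B"
      using eventually_ge_at_top[of T] by eventually_elim (use bound in \<open>simp add: norm_minus_commute\<close>)
  qed
  hence "(\<phi> \<longlongrightarrow> l) at_top" by (simp add: LIM_zero_iff)
  thus ?thesis using bound that by blast
qed

text \<open>
  The tail estimates also bound the distance between the improper integral and the integral over a finite piece. This is
  what makes the convergence uniform in a parameter when \<open>e1\<close> and \<open>e2\<close> do not depend on it.
\<close>

lemma has_curve_integral_if_tails_bounded:
  assumes L: "piecewise_C1_curve L" and int: "\<And>A B. f contour_integrable_on segment L A B"
    and top: "\<And>B B'. B \<ge> T \<Longrightarrow> B' \<ge> T \<Longrightarrow> cmod (contour_integral (segment L B B') f) \<le> e2 B + e2 B'"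
    and bot: "\<And>A A'. A \<le> - T \<Longrightarrow> A' \<le> - T \<Longrightarrow> cmod (contour_integral (segment L A A') f) \<le> e1 A + e1 A'"
    and e2: "(e2 \<longlongrightarrow> 0) at_top" and e1: "(e1 \<longlongrightarrow> 0) at_bot"
  obtains I where "has_curve_integral f I L"
    "\<And>A B. A \<le> - T \<Longrightarrow> B \<ge> T \<Longrightarrow> cmod (I - contour_integral (segment L A B) f) \<le> e1 A + e2 B"
proof -
  define c where "c = (\<lambda>A B. contour_integral (segment L A B) f)"
  have comb: "c A B + c B C = c A C" for A B C
    unfolding c_def by (rule contour_integral_segment_combine[OF L int])
  have cd: "c 0 B' - c 0 B = c B B'" "c (- B') 0 - c (- B) 0 = c (- B') (- B)" for B B'
    using comb[of 0 B B'] comb[of "-B'" "-B" 0] by (auto simp: algebra_simps)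
  obtain I2 where I2: "(c 0 \<longlongrightarrow> I2) at_top" "\<And>B. B \<ge> T \<Longrightarrow> cmod (I2 - c 0 B) \<le> e2 B"
  proof (rule Cauchy_tail_limit[of T "c 0" e2])
    show "cmod (c 0 B' - c 0 B) \<le> e2 B + e2 B'" if "B \<ge> T" "B' \<ge> T" for B B'
      unfolding cd unfolding c_def using that by (rule top)
  qed (use e2 in auto)
  have e1': "((\<lambda>B. e1 (- B)) \<longlongrightarrow> 0) at_top" using e1 by (simp add: filterlim_at_bot_mirror)
  obtain I1 where I1: "((\<lambda>B. c (- B) 0) \<longlongrightarrow> I1) at_top"
      "\<And>B. B \<ge> T \<Longrightarrow> cmod (I1 - c (- B) 0) \<le> e1 (- B)"
  proof (rule Cauchy_tail_limit[of T "\<lambda>B. c (- B) 0" "\<lambda>B. e1 (- B)"])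
    show "cmod (c (- B') 0 - c (- B) 0) \<le> e1 (- B) + e1 (- B')" if "B \<ge> T" "B' \<ge> T" for B B'
      unfolding cd unfolding c_def using bot[of "-B'" "-B"] that by simp
  qed (use e1' in auto)
  have I1': "((\<lambda>A. c A 0) \<longlongrightarrow> I1) at_bot" using I1(1) by (simp add: filterlim_at_bot_mirror)
  have "((\<lambda>x. c (fst x) 0 + c 0 (snd x)) \<longlongrightarrow> I1 + I2) (at_bot \<times>\<^sub>F at_top)"
    by (intro tendsto_add filterlim_compose[OF I1'] filterlim_compose[OF I2(1)] filterlim_fst filterlim_snd)
  hence "((\<lambda>(A, B). c A B) \<longlongrightarrow> I1 + I2) (at_bot \<times>\<^sub>F at_top)"
    unfolding comb by (simp add: case_prod_unfold)
  hence "has_curve_integral f (I1 + I2) L"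
    using int unfolding has_curve_integral_def c_def by auto
  moreover have "cmod (I1 + I2 - c A B) \<le> e1 A + e2 B" if "A \<le> - T" "B \<ge> T" for A B
  proof -
    have "I1 + I2 - c A B = (I1 - c A 0) + (I2 - c 0 B)" using comb[of A 0 B] by (simp add: algebra_simps)
    also have "cmod \<dots> \<le> e1 A + e2 B"
      using norm_triangle_ineq[of "I1 - c A 0" "I2 - c 0 B"] I1(2)[of "-A"] I2(2)[of B] that by simp
    finally show ?thesis .
  qed
  ultimately show ?thesis using that unfolding c_def by blast
qed

lemma curve_integral_unique:
  assumes "has_curve_integral f I L"
  shows "curve_integral f L = I"
proof -
  have "(at_bot :: real filter) \<times>\<^sub>F (at_top :: real filter) \<noteq> bot" by (simp add: prod_filter_eq_bot)
  hence "J = I" if "has_curve_integral f J L" for J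
    using that assms unfolding has_curve_integral_def by (meson tendsto_unique)
  thus ?thesis unfolding curve_integral_def using assms by blast
qed

text \<open>
  Differentiation under the integral sign. The integral along a piecewise smooth path is bounded by a constant
  times the supremum of the integrand on a neighbourhood \<open>S\<close> of the path, and the remainder of the difference quotient is \<open>O(h)\<close> there by
  Taylor's formula for \<open>exp\<close>.
\<close>

lemma holomorphic_contour_integral_exp:
  assumes U: "open U" "H holomorphic_on U" and \<gamma>: "valid_path \<gamma>" "path_image \<gamma> \<subseteq> U"
  shows "(\<lambda>\<zeta>. contour_integral \<gamma> (\<lambda>s. H s * exp (- s * \<zeta>))) holomorphic_on UNIV"
proof -
  have contH: "continuous_on (path_image \<gamma>) H"
    using U \<gamma> by (meson continuous_on_subset holomorphic_on_imp_continuous_on)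
  have comp: "compact (path_image \<gamma>)" using \<gamma>(1) by (rule compact_valid_path_image)
  obtain M1 where M1: "\<And>s. s \<in> path_image \<gamma> \<Longrightarrow> cmod (H s) \<le> M1"
    using compact_imp_bounded[OF compact_continuous_image[OF contH comp]] unfolding bounded_iff by auto
  obtain M2 where M2: "\<And>s. s \<in> path_image \<gamma> \<Longrightarrow> cmod s \<le> M2"
    using compact_imp_bounded[OF comp] unfolding bounded_iff by auto
  define M where "M = max 1 (max M1 M2 + 1)"
  have M: "M \<ge> 1" by (simp add: M_def)
  define S where "S = {s \<in> U. cmod (H s) < M} \<inter> ball 0 M"
  have "open {s \<in> U. cmod (H s) < M}"
    using continuous_on_open_vimage[OF U(1), of "\<lambda>s. cmod (H s)"] holomorphic_on_imp_continuous_on[OF U(2)]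
    by (force intro: continuous_on_norm simp: vimage_def Int_def conj_commute
        dest: spec[of _ "{..<M}"])
  hence S: "open S" "path_image \<gamma> \<subseteq> S" "S \<subseteq> U"
    using \<gamma>(2) M1 M2 by (force simp: S_def M_def)+
  have HS: "H holomorphic_on S" using U(2) S(3) by (rule holomorphic_on_subset)
  obtain Len where Len: "Len > 0"
    "\<And>f B. f holomorphic_on S \<Longrightarrow> (\<And>z. z \<in> S \<Longrightarrow> cmod (f z) \<le> B) \<Longrightarrow> cmod (contour_integral \<gamma> f) \<le> Len * B"
    using contour_integral_bound_exists[OF S(1) \<gamma>(1) S(2)] by blast
  have int: "f contour_integrable_on \<gamma>" if "f holomorphic_on S" for f
    using contour_integrable_holomorphic_simple[OF that S(1) \<gamma>(1) S(2)] .
  define G where "G = (\<lambda>\<zeta>. contour_integral \<gamma> (\<lambda>s. H s * exp (- s * \<zeta>)))"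
  have "(G has_field_derivative contour_integral \<gamma> (\<lambda>s. - s * H s * exp (- s * \<zeta>))) (at \<zeta>)" for \<zeta>
  proof -
    define D where "D = contour_integral \<gamma> (\<lambda>s. - s * H s * exp (- s * \<zeta>))"
    define E where "E = M * exp (M * cmod \<zeta>) * (exp M * M\<^sup>2)"
    have bd: "cmod ((G (\<zeta> + h) - G \<zeta>) / h - D) \<le> Len * E * cmod h" if h: "h \<noteq> 0" "cmod h < 1" for h
    proof -
      define r where "r = (\<lambda>s. (H s * exp (- s * (\<zeta> + h)) - H s * exp (- s * \<zeta>)) / h - (- s * H s * exp (- s * \<zeta>)))"
      have "(G (\<zeta> + h) - G \<zeta>) / h - D = contour_integral \<gamma> r"
      proof -
        have 1: "((\<lambda>s. H s * exp (- s * x)) has_contour_integral G x) \<gamma>" for x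
          unfolding G_def by (intro has_contour_integral_integral int holomorphic_intros HS)
        have 2: "((\<lambda>s. - s * H s * exp (- s * \<zeta>)) has_contour_integral D) \<gamma>"
          unfolding D_def by (intro has_contour_integral_integral int holomorphic_intros HS)
        have "(r has_contour_integral ((G (\<zeta> + h) - G \<zeta>) / h - D)) \<gamma>"
          unfolding r_def by (intro has_contour_integral_diff has_contour_integral_div 1 2)
        thus ?thesis by (simp add: contour_integral_unique)
      qed
      moreover have "cmod (contour_integral \<gamma> r) \<le> Len * (E * cmod h)"
      proof (rule Len(2))
        show "r holomorphic_on S" unfolding r_def using h by (intro holomorphic_intros HS) auto
        fix s assume "s \<in> S"
        hence s: "cmod (H s) \<le> M" "cmod s \<le> M" by (auto simp: S_def)
        have "r s = H s * exp (- s * \<zeta>) * ((exp (- s * h) - (1 + - s * h)) / h)"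
          using h by (simp add: r_def field_simps exp_add[symmetric] exp_minus)
        also have "cmod \<dots> = cmod (H s) * cmod (exp (- s * \<zeta>)) * (cmod (exp (- s * h) - (1 + - s * h)) / cmod h)"
          by (simp only: norm_mult norm_divide)
        also have "\<dots> \<le> M * exp (M * cmod \<zeta>) * ((exp M * (M * cmod h)\<^sup>2) / cmod h)"
        proof (intro mult_mono divide_right_mono)
          have "cmod (exp (- s * \<zeta>)) \<le> exp (cmod (- s * \<zeta>))" by (rule norm_exp)
          also have "cmod (- s * \<zeta>) \<le> M * cmod \<zeta>" using s by (simp add: norm_mult mult_right_mono)
          finally show "cmod (exp (- s * \<zeta>)) \<le> exp (M * cmod \<zeta>)" by simp
          have sh: "cmod (- s * h) \<le> M * cmod h" using s by (simp add: norm_mult mult_right_mono)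
          have "\<bar>Re (- s * h)\<bar> \<le> M"
          proof -
            have "M * cmod h \<le> M * 1" using h M by (intro mult_left_mono) auto
            thus ?thesis using abs_Re_le_cmod[of "- s * h"] sh by linarith
          qed
          have "cmod (exp (- s * h) - (\<Sum>i\<le>1. (- s * h) ^ i / fact i))
              \<le> exp \<bar>Re (- s * h)\<bar> * cmod (- s * h) ^ Suc 1 / fact 1"
            by (rule Taylor_exp)
          also have "(\<Sum>i\<le>1. (- s * h) ^ i / fact i) = 1 + - s * h" by simp
          also have "exp \<bar>Re (- s * h)\<bar> * cmod (- s * h) ^ Suc 1 / fact 1 \<le> exp M * (M * cmod h)\<^sup>2"
            using sh \<open>\<bar>Re (- s * h)\<bar> \<le> M\<close>
            by (auto simp: numeral_2_eq_2 simp del: norm_minus_cancel intro!: mult_mono power_mono)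
          finally show "cmod (exp (- s * h) - (1 + - s * h)) \<le> exp M * (M * cmod h)\<^sup>2" .
        qed (use s M in auto)
        also have "\<dots> = E * cmod h" using h by (simp add: E_def power2_eq_square field_simps)
        finally show "cmod (r s) \<le> E * cmod h" .
      qed
      ultimately show ?thesis by (simp add: mult.assoc)
    qed
    have "((\<lambda>h. (G (\<zeta> + h) - G \<zeta>) / h - D) \<longlongrightarrow> 0) (at 0)"
    proof (rule Lim_null_comparison)
      show "\<forall>\<^sub>F h in at 0. cmod ((G (\<zeta> + h) - G \<zeta>) / h - D) \<le> Len * E * cmod h"
        unfolding eventually_at using bd by (intro exI[of _ 1]) auto
      show "((\<lambda>h. Len * E * cmod h) \<longlongrightarrow> 0) (at 0)" by (auto intro!: tendsto_eq_intros)
    qed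
    thus ?thesis unfolding DERIV_def D_def by (simp add: LIM_zero_iff)
  qed
  thus ?thesis unfolding G_def by (auto simp: holomorphic_on_open)
qed

section \<open>Integrals of the Fox integrand\<close>

text \<open>
  The curve ends in two convex sets \<open>U1\<close> and \<open>U2\<close>; \<open>d1\<close> and \<open>d2\<close> are the directions of exponential decay
  in them. For the loop both are \<open>1\<close>, for the vertical contour they are \<open>\<plusminus>\<i>\<kappa>\<close>.
\<close>

lemma has_curve_integral_contour_tails:
  fixes d1 d2 :: complex
  assumes L: "piecewise_C1_curve L" and int: "\<And>A B. f contour_integrable_on segment L A B"
    and f: "f holomorphic_on U1 \<union> U2"
    and U: "open U1" "convex U1" "open U2" "convex U2"
    and LU1: "\<And>t. t \<le> - T \<Longrightarrow> L t \<in> U1" and LU2: "\<And>t. t \<ge> T \<Longrightarrow> L t \<in> U2"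
    and bound1: "\<And>s. s \<in> U1 \<Longrightarrow> cmod (f s) \<le> C * exp (Re (d1 * s))"
    and bound2: "\<And>s. s \<in> U2 \<Longrightarrow> cmod (f s) \<le> C * exp (Re (d2 * s))"
    and dist1: "\<And>s s'. s \<in> U1 \<Longrightarrow> s' \<in> U1 \<Longrightarrow> cmod (s - s') \<le> K * \<bar>Re (d1 * s) - Re (d1 * s')\<bar> + W"
    and dist2: "\<And>s s'. s \<in> U2 \<Longrightarrow> s' \<in> U2 \<Longrightarrow> cmod (s - s') \<le> K * \<bar>Re (d2 * s) - Re (d2 * s')\<bar> + W"
    and nn: "C \<ge> 0" "K \<ge> 0" "W \<ge> 0"
    and lim1: "filterlim (\<lambda>t. Re (d1 * L t)) at_bot at_bot" and lim2: "filterlim (\<lambda>t. Re (d2 * L t)) at_bot at_top"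
  obtains I where "has_curve_integral f I L"
    "\<And>A B. A \<le> - T \<Longrightarrow> B \<ge> T \<Longrightarrow> cmod (I - contour_integral (segment L A B) f)
       \<le> C * (K + W) * exp (Re (d1 * L A)) + C * (K + W) * exp (Re (d2 * L B))"
proof (rule has_curve_integral_if_tails_bounded[OF L int,
      where T = T and ?e1.0 = "\<lambda>t. C * (K + W) * exp (Re (d1 * L t))" and ?e2.0 = "\<lambda>t. C * (K + W) * exp (Re (d2 * L t))"])
  fix B B' assume "B \<ge> T" "B' \<ge> T"
  hence "L ` closed_segment B B' \<subseteq> U2" using LU2 by (auto simp: closed_segment_eq_real_ivl split: if_splits)
  thus "cmod (contour_integral (segment L B B') f)
     \<le> C * (K + W) * exp (Re (d2 * L B)) + C * (K + W) * exp (Re (d2 * L B'))"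
    by (intro contour_integral_segment_exp_bound[OF L U(3,4) _ _ bound2 dist2 nn])
       (use f in \<open>auto intro: holomorphic_on_subset\<close>)
next
  fix B B' assume "B \<le> - T" "B' \<le> - T"
  hence "L ` closed_segment B B' \<subseteq> U1" using LU1 by (auto simp: closed_segment_eq_real_ivl split: if_splits)
  thus "cmod (contour_integral (segment L B B') f)
     \<le> C * (K + W) * exp (Re (d1 * L B)) + C * (K + W) * exp (Re (d1 * L B'))"
    by (intro contour_integral_segment_exp_bound[OF L U(1,2) _ _ bound1 dist1 nn])
       (use f in \<open>auto intro: holomorphic_on_subset\<close>)
next
  show "((\<lambda>t. C * (K + W) * exp (Re (d2 * L t))) \<longlongrightarrow> 0) at_top"
    by (intro tendsto_mult_right_zero filterlim_compose[OF exp_at_bot lim2])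
  show "((\<lambda>t. C * (K + W) * exp (Re (d1 * L t))) \<longlongrightarrow> 0) at_bot"
    by (intro tendsto_mult_right_zero filterlim_compose[OF exp_at_bot lim1])
qed (use that in auto)

lemma half_strips_open_convex:
  "open {s. Re s < b \<and> c < Im s \<and> Im s < d}"
  "convex {s. Re s < b \<and> c < Im s \<and> Im s < d}"
  "open {s. a < Re s \<and> Re s < b \<and> c < Im s}"
  "convex {s. a < Re s \<and> Re s < b \<and> c < Im s}"
  "open {s. a < Re s \<and> Re s < b \<and> Im s < d}"
  "convex {s. a < Re s \<and> Re s < b \<and> Im s < d}"
  by (auto simp: Collect_conj_eq intro!: open_Int convex_Int open_halfspace_Re_gt open_halfspace_Re_lt
      open_halfspace_Im_gt open_halfspace_Im_lt convex_halfspace_Re_gt convex_halfspace_Re_lt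
      convex_halfspace_Im_gt convex_halfspace_Im_lt)

lemma cmod_diff_le_Re_Im: "cmod (s - s') \<le> \<bar>Re s - Re s'\<bar> + \<bar>Im s - Im s'\<bar>"
  using cmod_le[of "s - s'"] by simp

context fox_parameters
begin

definition poles :: "complex set" where
  "poles = left_poles m b \<beta> \<union> right_poles n a \<alpha>"

lemma poles_real: "s \<in> poles \<Longrightarrow> Im s = 0"
  by (auto simp: poles_def left_poles_def right_poles_def)

lemma left_poles_eq:
  "left_poles m b \<beta> = (\<Union>j\<in>{1..m}. {s. of_real (b j) + s * of_real (\<beta> j) \<in> \<int>\<^sub>\<le>\<^sub>0})"
proof -
  have "of_real (b j) + s * of_real (\<beta> j) \<in> \<int>\<^sub>\<le>\<^sub>0 \<longleftrightarrow> (\<exists>l. s = of_real (- (b j + real l) / \<beta> j))"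
    if "j \<in> {1..m}" for j and s :: complex
  proof -
    have \<beta>: "complex_of_real (\<beta> j) \<noteq> 0" using \<beta>_pos[of j] mn that by auto
    have "of_real (b j) + s * of_real (\<beta> j) = - of_nat l \<longleftrightarrow> s = of_real (- (b j + real l) / \<beta> j)" for l
    proof -
      have "s = of_real (- (b j + real l) / \<beta> j) \<longleftrightarrow> s * of_real (\<beta> j) = - (of_real (b j) + of_nat l)"
        using \<beta> by (simp add: eq_divide_eq)
      thus ?thesis by (simp only: eq_neg_iff_add_eq_0 add_ac)
    qed
    thus ?thesis by (auto elim!: nonpos_Ints_cases' simp: minus_of_nat_in_nonpos_Ints) (metis minus_of_nat_in_nonpos_Ints)
  qed
  thus ?thesis unfolding left_poles_def by blast
qed

lemma right_poles_eq:
  "right_poles n a \<alpha> = (\<Union>i\<in>{1..n}. {s. 1 - of_real (a i) - s * of_real (\<alpha> i) \<in> \<int>\<^sub>\<le>\<^sub>0})"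
proof -
  have "1 - of_real (a i) - s * of_real (\<alpha> i) \<in> \<int>\<^sub>\<le>\<^sub>0 \<longleftrightarrow> (\<exists>k. s = of_real ((1 - a i + real k) / \<alpha> i))"
    if "i \<in> {1..n}" for i and s :: complex
  proof -
    have \<alpha>: "complex_of_real (\<alpha> i) \<noteq> 0" using \<alpha>_pos[of i] mn that by auto
    have "1 - of_real (a i) - s * of_real (\<alpha> i) = - of_nat k \<longleftrightarrow> s = of_real ((1 - a i + real k) / \<alpha> i)" for k
    proof -
      have "s = of_real ((1 - a i + real k) / \<alpha> i) \<longleftrightarrow> s * of_real (\<alpha> i) = 1 - of_real (a i) + of_nat k"
        using \<alpha> by (simp add: eq_divide_eq)
      thus ?thesis by (auto simp: eq_neg_iff_add_eq_0 algebra_simps)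
    qed
    thus ?thesis by (auto elim!: nonpos_Ints_cases' simp: minus_of_nat_in_nonpos_Ints) (metis minus_of_nat_in_nonpos_Ints)
  qed
  thus ?thesis unfolding right_poles_def by blast
qed

lemma closed_poles: "closed poles"
proof -
  have "closed {s. of_real c + s * of_real d \<in> (\<int>\<^sub>\<le>\<^sub>0 :: complex set)}"
       "closed {s. 1 - of_real c - s * of_real d \<in> (\<int>\<^sub>\<le>\<^sub>0 :: complex set)}" for c d :: real
    using closed_vimage[OF closed_nonpos_Ints, of "\<lambda>s::complex. of_real c + s * of_real d"]
      closed_vimage[OF closed_nonpos_Ints, of "\<lambda>s::complex. 1 - of_real c - s * of_real d"]
    by (simp_all add: vimage_def continuous_intros)
  thus ?thesis unfolding poles_def left_poles_eq right_poles_eq by (intro closed_Un closed_UN) auto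
qed

lemma holomorphic_kernel: "kernel holomorphic_on - poles"
proof -
  have eq: "kernel = (\<lambda>s. (\<Prod>j=1..m. Gamma (of_real (b j) + s * of_real (\<beta> j))) *
      (\<Prod>i=1..n. Gamma (1 - of_real (a i) - s * of_real (\<alpha> i))) *
      ((\<Prod>i=n+1..p. rGamma (of_real (a i) + s * of_real (\<alpha> i))) *
      (\<Prod>j=m+1..q. rGamma (1 - of_real (b j) - s * of_real (\<beta> j)))))"
    by (simp add: fun_eq_iff fox_kernel_def rGamma_inverse_Gamma divide_inverse
        prod_inversef[symmetric] o_def)
  show ?thesis unfolding eq
    by (intro holomorphic_intros) (auto simp: poles_def left_poles_eq right_poles_eq)
qed

definition integrand :: "complex \<Rightarrow> complex \<Rightarrow> complex" where
  "integrand \<zeta> s = kernel s * exp (- s * \<zeta>)"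

lemma fox_integrand_eq:
  "fox_integrand m n p q a \<alpha> b \<beta> \<theta> z = integrand (of_real (ln (cmod z)) + \<i> * of_real \<theta>)"
  by (simp add: fun_eq_iff fox_integrand_def integrand_def)

lemma holomorphic_integrand: "integrand \<zeta> holomorphic_on - poles"
  unfolding integrand_def by (intro holomorphic_intros holomorphic_kernel)

lemma range_disjoint_poles:
  assumes "separates_poles m n a \<alpha> b \<beta> L"
  shows "range L \<subseteq> - poles"
proof -
  have "s \<notin> range L" if "s \<in> left_side L \<or> s \<in> right_side L" for s
  proof -
    have "\<exists>x. connected_component (- range L) s (complex_of_real x)"
      using that
    proof
      assume "s \<in> left_side L"
      thus ?thesis unfolding left_side_def mem_Collect_eq
        by (rule eventually_happens'[OF trivial_limit_at_bot_linorder])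
    next
      assume "s \<in> right_side L"
      thus ?thesis unfolding right_side_def mem_Collect_eq
        by (rule eventually_happens'[OF trivial_limit_at_top_linorder])
    qed
    thus ?thesis using connected_component_in by blast
  qed
  thus ?thesis using assms unfolding separates_poles_def poles_def by blast
qed

lemma integrand_contour_integrable:
  assumes "piecewise_C1_curve L" "separates_poles m n a \<alpha> b \<beta> L"
  shows "integrand \<zeta> contour_integrable_on segment L A B"
  using contour_integrable_holomorphic_simple[OF holomorphic_integrand _ valid_path_segment[OF assms(1)]]
    closed_poles range_disjoint_poles[OF assms(2)] path_image_segment_subset_range[of L A B]
  by blast

text \<open>
  Since \<open>\<bar>e\<^sup>-\<^sup>s\<^sup>\<zeta>\<bar> \<le> exp (\<rho> \<bar>s\<bar>)\<close>, the decay of the kernel at rate \<open>\<rho> + 1\<close> leaves \<open>exp (Re s)\<close>, uniformly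
  for \<open>\<bar>\<zeta>\<bar> \<le> \<rho>\<close>.
\<close>

lemma integrand_bound_strip:
  assumes "Delta > 0" "\<delta> > 0"
  obtains C where "C > 0" "\<And>\<zeta> s. cmod \<zeta> \<le> \<rho> \<Longrightarrow> Re s \<le> 0 \<Longrightarrow> \<delta> \<le> \<bar>Im s\<bar> \<Longrightarrow> \<bar>Im s\<bar> \<le> Y \<Longrightarrow>
    cmod (integrand \<zeta> s) \<le> C * exp (Re s)"
proof -
  obtain C where C: "C > 0" "\<And>s. Re s \<le> 0 \<Longrightarrow> \<bar>Im s\<bar> \<ge> \<delta> \<Longrightarrow>
      cmod (kernel s) \<le> C * exp (- (astar * pi / 2 - 1) * \<bar>Im s\<bar> + (\<rho> + 1) * Re s)"
    using fox_kernel_decay[OF assms zero_less_one, of 0 "\<rho> + 1"] by blast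
  define C' where "C' = C * exp (\<bar>astar * pi / 2 - 1\<bar> * Y + \<rho> * Y)"
  have "cmod (integrand \<zeta> s) \<le> C' * exp (Re s)"
    if s: "cmod \<zeta> \<le> \<rho>" "Re s \<le> 0" "\<delta> \<le> \<bar>Im s\<bar>" "\<bar>Im s\<bar> \<le> Y" for \<zeta> s
  proof -
    have \<rho>: "\<rho> \<ge> 0" using s(1) norm_ge_zero[of \<zeta>] by linarith
    have "cmod (exp (- s * \<zeta>)) \<le> exp (cmod (- s * \<zeta>))" by (rule norm_exp)
    also have "cmod (- s * \<zeta>) \<le> (Y - Re s) * \<rho>"
      unfolding norm_mult using s cmod_le[of s] by (intro mult_mono) auto
    finally have 1: "cmod (exp (- s * \<zeta>)) \<le> exp ((Y - Re s) * \<rho>)" by simp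
    have "- (astar * pi / 2 - 1) * \<bar>Im s\<bar> \<le> \<bar>astar * pi / 2 - 1\<bar> * Y"
      using s by (intro mult_mono) auto
    hence "exp (- (astar * pi / 2 - 1) * \<bar>Im s\<bar> + (\<rho> + 1) * Re s)
        \<le> exp (\<bar>astar * pi / 2 - 1\<bar> * Y + (\<rho> + 1) * Re s)" by simp
    hence 2: "cmod (kernel s) \<le> C * exp (\<bar>astar * pi / 2 - 1\<bar> * Y + (\<rho> + 1) * Re s)"
      using C(2)[OF s(2,3)] C(1) by (meson mult_left_mono less_imp_le order_trans)
    have "cmod (integrand \<zeta> s) \<le> C * exp (\<bar>astar * pi / 2 - 1\<bar> * Y + (\<rho> + 1) * Re s) * exp ((Y - Re s) * \<rho>)"
      unfolding integrand_def norm_mult using 1 2 C(1) by (intro mult_mono) auto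
    also have "\<dots> = C' * exp (Re s)"
      unfolding C'_def by (simp add: exp_add[symmetric] algebra_simps)
    finally show ?thesis .
  qed
  thus ?thesis using that[of C'] C(1) by (simp add: C'_def)
qed

text \<open>
  The condition on \<open>Im \<zeta> = \<theta>\<close> leaves the positive gap \<open>2 \<kappa>\<close> between the decay rate \<open>a\<^sup>*\<pi>/2\<close> of the kernel in
  \<open>\<bar>Im s\<bar>\<close> and the growth rate \<open>\<bar>\<theta>\<bar>\<close> of \<open>e\<^sup>-\<^sup>s\<^sup>\<zeta>\<close>.
\<close>

lemma integrand_bound_sector:
  assumes "Delta > 0" "\<delta> > 0" "\<bar>Im \<zeta>\<bar> < astar * pi / 2"
  obtains C \<kappa> where "C > 0" "\<kappa> > 0" "\<And>s. Re s \<le> c \<Longrightarrow> \<delta> \<le> \<bar>Im s\<bar> \<Longrightarrow>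
    cmod (integrand \<zeta> s) \<le> C * exp (Re s - \<kappa> * \<bar>Im s\<bar>)"
proof -
  define \<kappa> where "\<kappa> = (astar * pi / 2 - \<bar>Im \<zeta>\<bar>) / 2"
  have \<kappa>: "\<kappa> > 0" "astar * pi / 2 = 2 * \<kappa> + \<bar>Im \<zeta>\<bar>" using assms(3) by (simp_all add: \<kappa>_def field_simps)
  obtain C where C: "C > 0" "\<And>s. Re s \<le> c \<Longrightarrow> \<bar>Im s\<bar> \<ge> \<delta> \<Longrightarrow>
      cmod (kernel s) \<le> C * exp (- (astar * pi / 2 - \<kappa>) * \<bar>Im s\<bar> + (Re \<zeta> + 1) * Re s)"
    using fox_kernel_decay[OF assms(1,2) \<kappa>(1), of c "Re \<zeta> + 1"] by blast
  have "cmod (integrand \<zeta> s) \<le> C * exp (Re s - \<kappa> * \<bar>Im s\<bar>)" if s: "Re s \<le> c" "\<delta> \<le> \<bar>Im s\<bar>" for s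
  proof -
    have "Im s * Im \<zeta> \<le> \<bar>Im s\<bar> * \<bar>Im \<zeta>\<bar>" by (simp flip: abs_mult)
    hence 1: "cmod (exp (- s * \<zeta>)) \<le> exp (\<bar>Im s\<bar> * \<bar>Im \<zeta>\<bar> - Re s * Re \<zeta>)" by simp
    have "cmod (integrand \<zeta> s) \<le> C * exp (- (astar * pi / 2 - \<kappa>) * \<bar>Im s\<bar> + (Re \<zeta> + 1) * Re s)
        * exp (\<bar>Im s\<bar> * \<bar>Im \<zeta>\<bar> - Re s * Re \<zeta>)"
      unfolding integrand_def norm_mult using 1 C(2)[OF s] C(1) by (intro mult_mono) auto
    also have "\<dots> = C * exp (Re s - \<kappa> * \<bar>Im s\<bar>)"
      unfolding mult.assoc exp_add[symmetric] \<kappa>(2) by (simp add: algebra_simps)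
    finally show ?thesis .
  qed
  thus ?thesis using that C(1) \<kappa>(1) by blast
qed

lemma loop_integral_uniform:
  assumes \<Delta>: "Delta > 0" and loop: "left_loop \<phi>1 \<phi>2 L" and sep: "separates_poles m n a \<alpha> b \<beta> L"
  obtains C T where
    "\<And>\<zeta>. cmod \<zeta> \<le> \<rho> \<Longrightarrow> has_curve_integral (integrand \<zeta>) (curve_integral (integrand \<zeta>) L) L"
    "\<And>\<zeta> A B. cmod \<zeta> \<le> \<rho> \<Longrightarrow> A \<le> - T \<Longrightarrow> B \<ge> T \<Longrightarrow>
       cmod (curve_integral (integrand \<zeta>) L - contour_integral (segment L A B) (integrand \<zeta>))
         \<le> C * exp (Re (L A)) + C * exp (Re (L B))"
proof -
  have \<phi>: "\<phi>1 < 0" "0 < \<phi>2" and L: "piecewise_C1_curve L"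
    and lim: "filterlim (\<lambda>t. Re (L t)) at_bot at_bot" "((\<lambda>t. Im (L t)) \<longlongrightarrow> \<phi>1) at_bot"
      "filterlim (\<lambda>t. Re (L t)) at_bot at_top" "((\<lambda>t. Im (L t)) \<longlongrightarrow> \<phi>2) at_top"
    using loop by (auto simp: left_loop_def)
  define \<delta> where "\<delta> = min (- \<phi>1) \<phi>2 / 2"
  define Y where "Y = 2 * max (- \<phi>1) \<phi>2"
  have \<delta>: "\<delta> > 0" using \<phi> by (simp add: \<delta>_def)
  have Y: "Y \<ge> 0" using \<phi> by (simp add: Y_def)
  obtain C where C: "C > 0" "\<And>\<zeta> s. cmod \<zeta> \<le> \<rho> \<Longrightarrow> Re s \<le> 0 \<Longrightarrow> \<delta> \<le> \<bar>Im s\<bar> \<Longrightarrow> \<bar>Im s\<bar> \<le> Y \<Longrightarrow>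
    cmod (integrand \<zeta> s) \<le> C * exp (Re s)"
    using integrand_bound_strip[OF \<Delta> \<delta>, of \<rho> Y] by blast
  define U1 where "U1 = {s. Re s < 0 \<and> 2 * \<phi>1 < Im s \<and> Im s < \<phi>1 / 2}"
  define U2 where "U2 = {s. Re s < 0 \<and> \<phi>2 / 2 < Im s \<and> Im s < 2 * \<phi>2}"
  have "\<forall>\<^sub>F t in at_bot. Re (L t) < 0" "\<forall>\<^sub>F t in at_top. Re (L t) < 0"
    using lim(1,3) unfolding filterlim_at_bot_dense by blast+
  moreover have "\<forall>\<^sub>F t in at_bot. Im (L t) > 2 * \<phi>1" "\<forall>\<^sub>F t in at_bot. Im (L t) < \<phi>1 / 2"
    using order_tendstoD(1)[OF lim(2), of "2 * \<phi>1"] order_tendstoD(2)[OF lim(2), of "\<phi>1 / 2"] \<phi> by simp_all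
  moreover have "\<forall>\<^sub>F t in at_top. Im (L t) > \<phi>2 / 2" "\<forall>\<^sub>F t in at_top. Im (L t) < 2 * \<phi>2"
    using order_tendstoD(1)[OF lim(4), of "\<phi>2 / 2"] order_tendstoD(2)[OF lim(4), of "2 * \<phi>2"] \<phi> by simp_all
  ultimately have "\<forall>\<^sub>F t in at_bot. L t \<in> U1" "\<forall>\<^sub>F t in at_top. L t \<in> U2"
    unfolding U1_def U2_def mem_Collect_eq by (auto intro: eventually_conj)
  then obtain T1 T2 where T12: "\<And>t. t \<le> T1 \<Longrightarrow> L t \<in> U1" "\<And>t. t \<ge> T2 \<Longrightarrow> L t \<in> U2"
    unfolding eventually_at_bot_linorder eventually_at_top_linorder by blast
  define T where "T = max (- T1) T2"
  have U: "open U1" "convex U1" "open U2" "convex U2"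
    unfolding U1_def U2_def by (rule half_strips_open_convex)+
  have U12: "U1 \<union> U2 \<subseteq> {s. Re s \<le> 0 \<and> \<delta> \<le> \<bar>Im s\<bar> \<and> \<bar>Im s\<bar> \<le> Y}"
    using \<phi> by (auto simp: U1_def U2_def \<delta>_def Y_def)
  have "U1 \<union> U2 \<subseteq> - poles" using poles_real \<phi> by (force simp: U1_def U2_def)
  hence hol: "integrand \<zeta> holomorphic_on U1 \<union> U2" for \<zeta> by (rule holomorphic_on_subset[OF holomorphic_integrand])
  have "\<exists>I. has_curve_integral (integrand \<zeta>) I L \<and>
      (\<forall>A B. A \<le> - T \<longrightarrow> B \<ge> T \<longrightarrow> cmod (I - contour_integral (segment L A B) (integrand \<zeta>))
         \<le> C * (1 + 2 * Y) * exp (Re (L A)) + C * (1 + 2 * Y) * exp (Re (L B)))" if \<zeta>: "cmod \<zeta> \<le> \<rho>" for \<zeta>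
  proof (rule has_curve_integral_contour_tails[OF L integrand_contour_integrable[OF L sep] hol U,
        where ?d1.0 = 1 and ?d2.0 = 1 and K = 1 and W = "2 * Y" and C = C and T = T])
    show "L t \<in> U1" if "t \<le> - T" for t using T12 that by (auto simp: T_def)
    show "L t \<in> U2" if "t \<ge> T" for t using T12 that by (auto simp: T_def)
    show "cmod (integrand \<zeta> s) \<le> C * exp (Re (1 * s))" if "s \<in> U1" for s
      using C(2)[OF \<zeta>, of s] U12 that by auto
    show "cmod (integrand \<zeta> s) \<le> C * exp (Re (1 * s))" if "s \<in> U2" for s
      using C(2)[OF \<zeta>, of s] U12 that by auto
    have dist: "cmod (s - s') \<le> 1 * \<bar>Re (1 * s) - Re (1 * s')\<bar> + 2 * Y"
      if "s \<in> U1 \<union> U2" "s' \<in> U1 \<union> U2" for s s'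
    proof -
      have "\<bar>Im s\<bar> \<le> Y" "\<bar>Im s'\<bar> \<le> Y" using U12 that by auto
      thus ?thesis using cmod_diff_le_Re_Im[of s s'] by simp
    qed
    show "cmod (s - s') \<le> 1 * \<bar>Re (1 * s) - Re (1 * s')\<bar> + 2 * Y" if "s \<in> U1" "s' \<in> U1" for s s'
      using dist that by blast
    show "cmod (s - s') \<le> 1 * \<bar>Re (1 * s) - Re (1 * s')\<bar> + 2 * Y" if "s \<in> U2" "s' \<in> U2" for s s'
      using dist that by blast
    fix I assume "has_curve_integral (integrand \<zeta>) I L"
      "\<And>A B. A \<le> - T \<Longrightarrow> B \<ge> T \<Longrightarrow> cmod (I - contour_integral (segment L A B) (integrand \<zeta>))
         \<le> C * (1 + 2 * Y) * exp (Re (1 * L A)) + C * (1 + 2 * Y) * exp (Re (1 * L B))"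
    thus ?thesis by auto
  qed (use C Y lim in auto)
  hence "has_curve_integral (integrand \<zeta>) (curve_integral (integrand \<zeta>) L) L \<and>
      (\<forall>A B. A \<le> - T \<longrightarrow> B \<ge> T \<longrightarrow>
        cmod (curve_integral (integrand \<zeta>) L - contour_integral (segment L A B) (integrand \<zeta>))
         \<le> C * (1 + 2 * Y) * exp (Re (L A)) + C * (1 + 2 * Y) * exp (Re (L B)))" if "cmod \<zeta> \<le> \<rho>" for \<zeta>
    using that curve_integral_unique by metis
  note * = this
  show ?thesis
  proof (rule that[of T "C * (1 + 2 * Y)"])
    show "has_curve_integral (integrand \<zeta>) (curve_integral (integrand \<zeta>) L) L" if "cmod \<zeta> \<le> \<rho>" for \<zeta>
      using *[OF that] by (rule conjunct1)
  qed (use * in auto)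
qed

text \<open>
  The integrals over the finite pieces \<open>[-k, k]\<close> of the curve are entire in \<open>\<zeta>\<close> and converge locally uniformly.
\<close>

theorem loop_integral:
  assumes \<Delta>: "Delta > 0" and loop: "left_loop \<phi>1 \<phi>2 L" and sep: "separates_poles m n a \<alpha> b \<beta> L"
  shows "has_curve_integral (integrand \<zeta>) (curve_integral (integrand \<zeta>) L) L"
    and "(\<lambda>\<zeta>. curve_integral (integrand \<zeta>) L) holomorphic_on UNIV"
proof -
  show "has_curve_integral (integrand \<zeta>) (curve_integral (integrand \<zeta>) L) L"
    using loop_integral_uniform[OF assms, of "cmod \<zeta>"] by blast
  have L: "piecewise_C1_curve L"
    and lim: "filterlim (\<lambda>t. Re (L t)) at_bot at_bot" "filterlim (\<lambda>t. Re (L t)) at_bot at_top"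
    using loop by (auto simp: left_loop_def)
  define g where "g = (\<lambda>\<zeta>. curve_integral (integrand \<zeta>) L)"
  define f where "f = (\<lambda>k \<zeta>. contour_integral (segment L (- real k) (real k)) (integrand \<zeta>))"
  have "g holomorphic_on UNIV"
  proof (rule holomorphic_uniform_sequence[where f = f])
    show "f k holomorphic_on UNIV" for k
      unfolding f_def integrand_def
      using holomorphic_contour_integral_exp[OF _ holomorphic_kernel valid_path_segment[OF L]]
        closed_poles range_disjoint_poles[OF sep] path_image_segment_subset_range[of L]
      by blast
  next
    fix \<zeta>0 :: complex
    obtain C T where CT: "\<And>\<zeta> A B. cmod \<zeta> \<le> cmod \<zeta>0 + 1 \<Longrightarrow> A \<le> - T \<Longrightarrow> B \<ge> T \<Longrightarrow>
       cmod (g \<zeta> - contour_integral (segment L A B) (integrand \<zeta>))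
         \<le> C * exp (Re (L A)) + C * exp (Re (L B))"
      unfolding g_def
    proof (rule loop_integral_uniform[OF assms, of "cmod \<zeta>0 + 1"])
      fix C T
      assume "\<And>\<zeta> A B. cmod \<zeta> \<le> cmod \<zeta>0 + 1 \<Longrightarrow> A \<le> - T \<Longrightarrow> B \<ge> T \<Longrightarrow>
        cmod (curve_integral (integrand \<zeta>) L - contour_integral (segment L A B) (integrand \<zeta>))
          \<le> C * exp (Re (L A)) + C * exp (Re (L B))"
      thus thesis by (rule that[unfolded g_def])
    qed
    have neg: "filterlim (\<lambda>k. - real k) at_bot sequentially"
      by (simp add: filterlim_uminus_at_bot filterlim_real_sequentially)
    have "(\<lambda>k. C * exp (Re (L (- real k))) + C * exp (Re (L (real k)))) \<longlonglongrightarrow> C * 0 + C * 0"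
      by (intro tendsto_intros filterlim_compose[OF exp_at_bot] filterlim_compose[OF lim(1)]
          filterlim_compose[OF lim(2)] filterlim_real_sequentially neg)
    hence e: "(\<lambda>k. C * exp (Re (L (- real k))) + C * exp (Re (L (real k)))) \<longlonglongrightarrow> 0" by simp
    have "uniform_limit (cball \<zeta>0 1) f g sequentially"
    proof (rule uniform_limitI)
      fix \<epsilon> :: real assume "\<epsilon> > 0"
      hence "\<forall>\<^sub>F k in sequentially. C * exp (Re (L (- real k))) + C * exp (Re (L (real k))) < \<epsilon>"
        using order_tendstoD(2)[OF e] by blast
      thus "\<forall>\<^sub>F k in sequentially. \<forall>\<zeta>\<in>cball \<zeta>0 1. dist (f k \<zeta>) (g \<zeta>) < \<epsilon>"
        using eventually_ge_at_top[of "nat \<lceil>T\<rceil>"]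
      proof eventually_elim
        case (elim k)
        have k: "- real k \<le> - T" "real k \<ge> T" using elim(2) by linarith+
        show ?case
        proof
          fix \<zeta> assume "\<zeta> \<in> cball \<zeta>0 1"
          hence "cmod \<zeta> \<le> cmod \<zeta>0 + 1" using norm_triangle_ineq2[of \<zeta> \<zeta>0] by (simp add: dist_norm norm_minus_commute)
          from CT[OF this k] elim(1) show "dist (f k \<zeta>) (g \<zeta>) < \<epsilon>"
            by (simp add: f_def dist_norm norm_minus_commute)
        qed
      qed
    qed
    thus "\<exists>d. 0 < d \<and> cball \<zeta>0 d \<subseteq> UNIV \<and> uniform_limit (cball \<zeta>0 d) f g sequentially"
      by (intro exI[of _ 1]) auto
  qed auto
  thus "(\<lambda>\<zeta>. curve_integral (integrand \<zeta>) L) holomorphic_on UNIV" by (simp add: g_def)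
qed

theorem vertical_integral:
  assumes \<Delta>: "Delta > 0" and vert: "vertical_contour \<gamma> L" and sep: "separates_poles m n a \<alpha> b \<beta> L"
    and \<zeta>: "\<bar>Im \<zeta>\<bar> < astar * pi / 2"
  shows "has_curve_integral (integrand \<zeta>) (curve_integral (integrand \<zeta>) L) L"
proof -
  have L: "piecewise_C1_curve L"
    and lim: "((\<lambda>t. Re (L t)) \<longlongrightarrow> \<gamma>) at_bot" "filterlim (\<lambda>t. Im (L t)) at_bot at_bot"
      "((\<lambda>t. Re (L t)) \<longlongrightarrow> \<gamma>) at_top" "filterlim (\<lambda>t. Im (L t)) at_top at_top"
    using vert by (auto simp: vertical_contour_def)
  obtain C \<kappa> where C: "C > 0" "\<kappa> > 0" "\<And>s. Re s \<le> \<gamma> + 1 \<Longrightarrow> 1 \<le> \<bar>Im s\<bar> \<Longrightarrow>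
    cmod (integrand \<zeta> s) \<le> C * exp (Re s - \<kappa> * \<bar>Im s\<bar>)"
    using integrand_bound_sector[OF \<Delta> zero_less_one \<zeta>, of "\<gamma> + 1"] by blast
  define U1 where "U1 = {s. \<gamma> - 1 < Re s \<and> Re s < \<gamma> + 1 \<and> Im s < - 1}"
  define U2 where "U2 = {s. \<gamma> - 1 < Re s \<and> Re s < \<gamma> + 1 \<and> 1 < Im s}"
  have "\<forall>\<^sub>F t in at_bot. Im (L t) < - 1" "\<forall>\<^sub>F t in at_top. Im (L t) > 1"
    using lim(2,4) unfolding filterlim_at_bot_dense filterlim_at_top_dense by blast+
  moreover have "\<forall>\<^sub>F t in at_bot. Re (L t) > \<gamma> - 1" "\<forall>\<^sub>F t in at_bot. Re (L t) < \<gamma> + 1"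
    by (auto intro!: order_tendstoD[OF lim(1)])
  moreover have "\<forall>\<^sub>F t in at_top. Re (L t) > \<gamma> - 1" "\<forall>\<^sub>F t in at_top. Re (L t) < \<gamma> + 1"
    by (auto intro!: order_tendstoD[OF lim(3)])
  ultimately have "\<forall>\<^sub>F t in at_bot. L t \<in> U1" "\<forall>\<^sub>F t in at_top. L t \<in> U2"
    unfolding U1_def U2_def mem_Collect_eq by (auto intro: eventually_conj)
  then obtain T1 T2 where T12: "\<And>t. t \<le> T1 \<Longrightarrow> L t \<in> U1" "\<And>t. t \<ge> T2 \<Longrightarrow> L t \<in> U2"
    unfolding eventually_at_bot_linorder eventually_at_top_linorder by blast
  define T where "T = max (- T1) T2"
  have U: "open U1" "convex U1" "open U2" "convex U2"
    unfolding U1_def U2_def by (rule half_strips_open_convex)+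
  have "U1 \<union> U2 \<subseteq> - poles" using poles_real by (force simp: U1_def U2_def)
  hence hol: "integrand \<zeta> holomorphic_on U1 \<union> U2" by (rule holomorphic_on_subset[OF holomorphic_integrand])
  have bound: "cmod (integrand \<zeta> s) \<le> C * exp (\<gamma> + 1) * exp (- \<kappa> * \<bar>Im s\<bar>)" if "s \<in> U1 \<union> U2" for s
  proof -
    have "Re s \<le> \<gamma> + 1" "1 \<le> \<bar>Im s\<bar>" using that by (auto simp: U1_def U2_def)
    hence "cmod (integrand \<zeta> s) \<le> C * exp (Re s - \<kappa> * \<bar>Im s\<bar>)" by (rule C(3))
    also have "\<dots> \<le> C * exp (\<gamma> + 1 - \<kappa> * \<bar>Im s\<bar>)" using C(1) \<open>Re s \<le> \<gamma> + 1\<close> by simp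
    also have "\<dots> = C * exp (\<gamma> + 1) * exp (- \<kappa> * \<bar>Im s\<bar>)" by (simp add: exp_diff exp_minus field_simps exp_add)
    finally show ?thesis .
  qed
  have dist: "cmod (s - s') \<le> 1 / \<kappa> * \<bar>\<kappa> * Im s - \<kappa> * Im s'\<bar> + 2" if "s \<in> U1 \<union> U2" "s' \<in> U1 \<union> U2" for s s'
  proof -
    have "\<kappa> * Im s - \<kappa> * Im s' = \<kappa> * (Im s - Im s')" by (simp add: algebra_simps)
    hence "1 / \<kappa> * \<bar>\<kappa> * Im s - \<kappa> * Im s'\<bar> = \<bar>Im s - Im s'\<bar>" using C(2) by (simp add: abs_mult)
    moreover have "\<bar>Re s - Re s'\<bar> \<le> 2" using that by (auto simp: U1_def U2_def)
    ultimately show ?thesis using cmod_diff_le_Re_Im[of s s'] by linarith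
  qed
  have "\<exists>I. has_curve_integral (integrand \<zeta>) I L"
  proof (rule has_curve_integral_contour_tails[OF L integrand_contour_integrable[OF L sep] hol U,
        where ?d1.0 = "- \<i> * of_real \<kappa>" and ?d2.0 = "\<i> * of_real \<kappa>" and K = "1 / \<kappa>" and W = 2
          and C = "C * exp (\<gamma> + 1)" and T = T])
    show "L t \<in> U1" if "t \<le> - T" for t using T12 that by (auto simp: T_def)
    show "L t \<in> U2" if "t \<ge> T" for t using T12 that by (auto simp: T_def)
    show "cmod (integrand \<zeta> s) \<le> C * exp (\<gamma> + 1) * exp (Re (- \<i> * of_real \<kappa> * s))" if "s \<in> U1" for s
      using bound[of s] that by (auto simp: U1_def)
    show "cmod (integrand \<zeta> s) \<le> C * exp (\<gamma> + 1) * exp (Re (\<i> * of_real \<kappa> * s))" if "s \<in> U2" for s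
      using bound[of s] that by (auto simp: U2_def)
    show "cmod (s - s') \<le> 1 / \<kappa> * \<bar>Re (- \<i> * of_real \<kappa> * s) - Re (- \<i> * of_real \<kappa> * s')\<bar> + 2"
      if "s \<in> U1" "s' \<in> U1" for s s'
      using dist[of s s'] that by simp
    show "cmod (s - s') \<le> 1 / \<kappa> * \<bar>Re (\<i> * of_real \<kappa> * s) - Re (\<i> * of_real \<kappa> * s')\<bar> + 2"
      if "s \<in> U2" "s' \<in> U2" for s s'
      using dist[of s s'] that by (simp add: abs_minus_commute)
    have "filterlim (\<lambda>t. \<kappa> * Im (L t)) at_bot at_bot"
      using C(2) lim(2) by (simp add: filterlim_tendsto_pos_mult_at_bot[OF tendsto_const])
    thus "filterlim (\<lambda>t. Re (- \<i> * of_real \<kappa> * L t)) at_bot at_bot" by simp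
    have "filterlim (\<lambda>t. \<kappa> * Im (L t)) at_top at_top"
      using C(2) lim(4) by (simp add: filterlim_tendsto_pos_mult_at_top[OF tendsto_const])
    thus "filterlim (\<lambda>t. Re (\<i> * of_real \<kappa> * L t)) at_bot at_top" by (simp add: filterlim_uminus_at_bot)
  qed (use C in auto)
  thus ?thesis using curve_integral_unique by metis
qed

end

section \<open>Poles and the outside of closed curves\<close>

text \<open>
  A real-linear functional \<open>s \<mapsto> Re (d s)\<close> is bounded below on a segment by its values at the ends. The choice
  of \<open>d\<close> selects the half-plane in which a segment stays.
\<close>

lemma closed_segment_Re_mult_ge:
  assumes "s \<in> closed_segment u v" "c \<le> Re (d * u)" "c \<le> Re (d * v)"
  shows "c \<le> Re (d * s)"
proof -
  obtain t where t: "0 \<le> t" "t \<le> 1" "s = (1 - t) *\<^sub>R u + t *\<^sub>R v"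
    using assms(1) by (auto simp: closed_segment_def)
  have "c = (1 - t) * c + t * c" by (simp add: algebra_simps)
  also have "\<dots> \<le> (1 - t) * Re (d * u) + t * Re (d * v)"
    using assms t by (intro add_mono mult_left_mono) auto
  also have "\<dots> = Re (d * s)" unfolding t(3) by (simp add: scaleR_conv_of_real algebra_simps)
  finally show ?thesis .
qed

lemma closed_segment_disjoint_ball:
  assumes "cmod d \<le> 2" "2 * M \<le> Re (d * u)" "2 * M \<le> Re (d * v)"
  shows "closed_segment u v \<inter> ball 0 M = {}"
proof -
  have "M \<le> cmod s" if "s \<in> closed_segment u v" for s
  proof -
    have "2 * M \<le> Re (d * s)" using that assms(2,3) by (rule closed_segment_Re_mult_ge)
    also have "\<dots> \<le> cmod d * cmod s" using complex_Re_le_cmod[of "d * s"] by (simp add: norm_mult)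
    also have "\<dots> \<le> 2 * cmod s" using assms(1) by (intro mult_right_mono) auto
    finally show ?thesis by simp
  qed
  thus ?thesis by force
qed

lemma continuous_bounded_on_Icc:
  fixes h :: "real \<Rightarrow> real"
  assumes "continuous_on UNIV h"
  shows "\<exists>R. \<forall>t\<in>{a..b}. \<bar>h t\<bar> \<le> R"
proof -
  have "bounded (h ` {a..b})"
    using assms by (intro compact_imp_bounded compact_continuous_image) (auto intro: continuous_on_subset)
  thus ?thesis by (simp add: bounded_iff)
qed

text \<open>
  Parameters \<open>t k\<close> at which \<open>h\<close> has reached the level \<open>-k\<close>. They tend to infinity by themselves,
  because \<open>h\<close> is bounded on bounded intervals.
\<close>

lemma exit_parameters:
  fixes h :: "real \<Rightarrow> real"
  assumes cont: "continuous_on UNIV h" and lim: "filterlim h at_bot at_top"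
  obtains t :: "nat \<Rightarrow> real" where "filterlim t at_top sequentially" "\<forall>\<^sub>F k in sequentially. h (t k) = - real k"
proof -
  have ex: "\<exists>t\<ge>0. h t = - real k" if k: "real k \<ge> - h 0" for k
  proof -
    have "\<forall>\<^sub>F t in at_top. h t < - real k" using lim unfolding filterlim_at_bot_dense by blast
    hence "\<forall>\<^sub>F t in at_top. h t < - real k \<and> t \<ge> 0" using eventually_ge_at_top by (rule eventually_conj)
    from eventually_happens'[OF trivial_limit_at_top_linorder this]
    obtain T where T: "h T < - real k" "T \<ge> 0" by blast
    have "\<exists>t. 0 \<le> t \<and> t \<le> T \<and> h t = - real k"
      using k T cont by (intro IVT2') (auto intro: continuous_on_subset)
    thus ?thesis by blast
  qed
  define t where "t = (\<lambda>k. SOME t. t \<ge> 0 \<and> h t = - real k)"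
  have t: "t k \<ge> 0 \<and> h (t k) = - real k" if "real k \<ge> - h 0" for k
    unfolding t_def using someI_ex[of "\<lambda>t. t \<ge> 0 \<and> h t = - real k"] ex[OF that] by blast
  have ev: "\<forall>\<^sub>F k in sequentially. real k \<ge> x" for x
    using filterlim_real_sequentially unfolding filterlim_at_top by blast
  have "filterlim t at_top sequentially" unfolding filterlim_at_top
  proof
    fix N :: real
    obtain c where c: "\<And>x. x \<in> {0..N} \<Longrightarrow> \<bar>h x\<bar> \<le> c"
      using continuous_bounded_on_Icc[OF cont] by blast
    show "\<forall>\<^sub>F k in sequentially. N \<le> t k"
      using ev[of "- h 0"] ev[of "c + 1"]
    proof eventually_elim
      case (elim k)
      show "N \<le> t k"
      proof (rule ccontr)
        assume "\<not> N \<le> t k"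
        hence "\<bar>h (t k)\<bar> \<le> c" using t[OF elim(1)] by (intro c) auto
        thus False using t[OF elim(1)] elim(2) by simp
      qed
    qed
  qed
  moreover have "\<forall>\<^sub>F k in sequentially. h (t k) = - real k"
    using ev[of "- h 0"] by eventually_elim (use t in blast)
  ultimately show ?thesis by (rule that)
qed

lemma piecewise_C1_curve_imp_continuous: "piecewise_C1_curve L \<Longrightarrow> continuous_on UNIV L"
proof -
  assume L: "piecewise_C1_curve L"
  have "isCont L x" for x
  proof -
    have "continuous_on {x-1..x+1} L"
      using L by (auto simp: piecewise_C1_curve_def piecewise_C1_differentiable_on_def)
    thus ?thesis by (rule continuous_on_interior) simp
  qed
  thus ?thesis by (simp add: continuous_at_imp_continuous_on)
qed

lemma closed_range_if_norm_at_top: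
  fixes L :: "real \<Rightarrow> complex"
  assumes cont: "continuous_on UNIV L"
    and lim: "filterlim (\<lambda>t. cmod (L t)) at_top at_bot" "filterlim (\<lambda>t. cmod (L t)) at_top at_top"
  shows "closed (range L)"
  unfolding closed_sequential_limits
proof (intro allI impI, elim conjE)
  fix X l assume X: "\<forall>n. X n \<in> range L" and l: "X \<longlonglongrightarrow> l"
  obtain M where M: "\<And>n. cmod (X n) \<le> M"
    using convergent_imp_bounded[OF l] unfolding bounded_iff by auto
  have "\<forall>\<^sub>F t in at_bot. cmod (L t) > M" "\<forall>\<^sub>F t in at_top. cmod (L t) > M"
    using lim unfolding filterlim_at_top_dense by blast+
  then obtain T1 T2 where T: "\<And>t. t \<le> T1 \<Longrightarrow> cmod (L t) > M" "\<And>t. t \<ge> T2 \<Longrightarrow> cmod (L t) > M"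
    unfolding eventually_at_bot_linorder eventually_at_top_linorder by blast
  have "X n \<in> L ` {T1..T2}" for n
  proof -
    obtain t where t: "X n = L t" using X by blast
    hence "\<not> t \<le> T1" "\<not> t \<ge> T2" using T[of t] M[of n] by force+
    thus ?thesis using t by auto
  qed
  moreover have "closed (L ` {T1..T2})"
    using cont by (intro compact_imp_closed compact_continuous_image) (auto intro: continuous_on_subset)
  ultimately have "l \<in> L ` {T1..T2}" using l closed_sequentially by blast
  thus "l \<in> range L" by blast
qed

lemma bounded_if_eventually_bounded:
  fixes h :: "real \<Rightarrow> real"
  assumes cont: "continuous_on UNIV h" and ev: "\<forall>\<^sub>F t in at_bot. P t" "\<forall>\<^sub>F t in at_top. P t"
  obtains R where "\<And>t. P t \<or> \<bar>h t\<bar> \<le> R"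
proof -
  obtain T1 T2 where T: "\<And>t. t \<le> T1 \<Longrightarrow> P t" "\<And>t. t \<ge> T2 \<Longrightarrow> P t"
    using ev unfolding eventually_at_bot_linorder eventually_at_top_linorder by blast
  obtain R where R: "\<And>t. t \<in> {T1..T2} \<Longrightarrow> \<bar>h t\<bar> \<le> R"
    using continuous_bounded_on_Icc[OF cont] by blast
  have "P t \<or> \<bar>h t\<bar> \<le> R" for t using R[of t] T[of t] by (cases "t \<le> T1"; cases "t \<ge> T2") auto
  thus ?thesis by (rule that)
qed

text \<open>
  \<open>p\<close> lies in \<open>S\<close> or can be joined to it without meeting \<open>X\<close>. The set
  \<open>X\<close> below contains the complement of a ball, which no pole outside of the ball can avoid; the first
  alternative serves these poles, all but finitely many of which lie in \<open>S\<close>.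
\<close>

definition linked :: "complex set \<Rightarrow> complex set \<Rightarrow> complex \<Rightarrow> bool" where
  "linked X S p \<longleftrightarrow> p \<in> S \<or> (\<exists>K. connected K \<and> p \<in> K \<and> K \<inter> S \<noteq> {} \<and> K \<inter> X = {})"

lemma winding_number_zero_if_linked:
  assumes g: "path g" "pathfinish g = pathstart g"
    and S: "connected S" "\<not> bounded S" "S \<inter> path_image g = {}" and p: "linked (path_image g) S p"
  shows "winding_number g p = 0"
proof -
  obtain K where K: "connected K" "p \<in> K" "K \<inter> S \<noteq> {}" "K \<inter> path_image g = {}"
  proof (cases "p \<in> S")
    case True thus ?thesis using that[of "{p}"] S by auto
  next
    case False thus ?thesis using p that unfolding linked_def by blast
  qed
  have "connected (K \<union> S)" using K S by (intro connected_Un) auto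
  hence "K \<union> S \<subseteq> connected_component_set (- path_image g) p"
    using K S by (intro connected_component_maximal) auto
  hence "\<not> bounded (connected_component_set (- path_image g) p)"
    using S(2) bounded_subset by blast
  moreover have "p \<notin> path_image g" using K by blast
  ultimately have "p \<in> outside (path_image g)" by (simp add: outside_def)
  thus ?thesis by (rule winding_number_zero_in_outside[OF g])
qed

text \<open>
  The connecting path is compact, hence lies in some ball: closing a curve outside a large enough ball does
  not interfere with it.
\<close>

lemma eventually_linked:
  assumes op: "open (- range L)" and x: "x \<in> S" and conn: "connected_component (- range L) p x"
  shows "\<forall>\<^sub>F M in at_top. linked (range L \<union> - ball 0 M) S p"
proof -
  have "path_component (- range L) p x" using op conn by (simp add: open_path_connected_component)
  then obtain g where g: "path g" "path_image g \<subseteq> - range L" "pathstart g = p" "pathfinish g = x"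
    by (auto simp: path_component_def)
  obtain M0 where M0: "\<And>s. s \<in> path_image g \<Longrightarrow> cmod s \<le> M0"
    using bounded_path_image[OF g(1)] unfolding bounded_iff by blast
  show ?thesis using eventually_gt_at_top[of M0]
  proof eventually_elim
    case (elim M)
    have "path_image g \<subseteq> ball 0 M" using M0 elim by force
    thus ?case unfolding linked_def
      using connected_path_image[OF g(1)] pathstart_in_path_image[of g] pathfinish_in_path_image[of g] g x
      by (intro disjI2 exI[of _ "path_image g"]) auto
  qed
qed

context fox_parameters
begin

lemma finite_left_poles: "finite {s \<in> left_poles m b \<beta>. Re s \<ge> - R}"
proof (rule finite_subset)
  show "{s \<in> left_poles m b \<beta>. Re s \<ge> - R}
    \<subseteq> (\<Union>j\<in>{1..m}. (\<lambda>l. of_real (- (b j + real l) / \<beta> j)) ` {l. real l \<le> R * \<beta> j - b j})"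
  proof
    fix s assume s: "s \<in> {s \<in> left_poles m b \<beta>. Re s \<ge> - R}"
    then obtain j l where jl: "j \<in> {1..m}" "s = of_real (- (b j + real l) / \<beta> j)"
      by (auto simp: left_poles_def)
    have "\<beta> j > 0" using jl \<beta>_pos mn by auto
    hence "real l \<le> R * \<beta> j - b j" using s jl(2) by (simp add: field_simps)
    thus "s \<in> (\<Union>j\<in>{1..m}. (\<lambda>l. of_real (- (b j + real l) / \<beta> j)) ` {l. real l \<le> R * \<beta> j - b j})"
      using jl by blast
  qed
  have "{l. real l \<le> x} \<subseteq> {..nat \<lceil>x\<rceil>}" for x by (auto simp: le_nat_iff) linarith
  hence "finite {l. real l \<le> x}" for x using finite_subset by blast
  thus "finite (\<Union>j\<in>{1..m}. (\<lambda>l. complex_of_real (- (b j + real l) / \<beta> j)) ` {l. real l \<le> R * \<beta> j - b j})"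
    by blast
qed

lemma finite_right_poles: "finite {s \<in> right_poles n a \<alpha>. Re s \<le> R}"
proof (rule finite_subset)
  show "{s \<in> right_poles n a \<alpha>. Re s \<le> R}
    \<subseteq> (\<Union>i\<in>{1..n}. (\<lambda>k. of_real ((1 - a i + real k) / \<alpha> i)) ` {k. real k \<le> R * \<alpha> i + a i - 1})"
  proof
    fix s assume s: "s \<in> {s \<in> right_poles n a \<alpha>. Re s \<le> R}"
    then obtain i k where ik: "i \<in> {1..n}" "s = of_real ((1 - a i + real k) / \<alpha> i)"
      by (auto simp: right_poles_def)
    have "\<alpha> i > 0" using ik \<alpha>_pos mn by auto
    hence "real k \<le> R * \<alpha> i + a i - 1" using s ik(2) by (simp add: field_simps)
    thus "s \<in> (\<Union>i\<in>{1..n}. (\<lambda>k. of_real ((1 - a i + real k) / \<alpha> i)) ` {k. real k \<le> R * \<alpha> i + a i - 1})"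
      using ik by blast
  qed
  have "{l. real l \<le> x} \<subseteq> {..nat \<lceil>x\<rceil>}" for x by (auto simp: le_nat_iff) linarith
  hence "finite {l. real l \<le> x}" for x using finite_subset by blast
  thus "finite (\<Union>i\<in>{1..n}. (\<lambda>k. complex_of_real ((1 - a i + real k) / \<alpha> i)) ` {k. real k \<le> R * \<alpha> i + a i - 1})"
    by blast
qed

text \<open>
  One ball serves all poles at once, since only finitely many of them are not already in \<open>S\<close>.
\<close>

lemma eventually_left_poles_linked:
  assumes sep: "separates_poles m n a \<alpha> b \<beta> L" and op: "open (- range L)"
    and S: "\<And>x. x < - R \<Longrightarrow> of_real x \<in> S"
  shows "\<forall>\<^sub>F M in at_top. \<forall>p\<in>left_poles m b \<beta>. linked (range L \<union> - ball 0 M) S p"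
proof -
  have 1: "\<forall>\<^sub>F M in at_top. linked (range L \<union> - ball 0 M) S p" if "p \<in> left_poles m b \<beta>" for p
  proof -
    have "\<forall>\<^sub>F x in at_bot. connected_component (- range L) p (complex_of_real x)"
      using sep that by (auto simp: separates_poles_def left_side_def)
    hence "\<forall>\<^sub>F x in at_bot. connected_component (- range L) p (complex_of_real x) \<and> x < - R"
      using eventually_gt_at_bot by (rule eventually_conj)
    note ev = this
    obtain x where "connected_component (- range L) p (complex_of_real x)" "x < - R"
      using eventually_happens'[OF trivial_limit_at_bot_linorder ev] by blast
    thus ?thesis using eventually_linked[OF op] S by blast
  qed
  have "\<forall>\<^sub>F M in at_top. \<forall>p\<in>{s \<in> left_poles m b \<beta>. Re s \<ge> - R}. linked (range L \<union> - ball 0 M) S p"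
    using 1 by (intro eventually_ball_finite finite_left_poles) auto
  thus ?thesis
  proof eventually_elim
    case (elim M)
    show ?case
    proof
      fix p assume p: "p \<in> left_poles m b \<beta>"
      show "linked (range L \<union> - ball 0 M) S p"
      proof (cases "Re p \<ge> - R")
        case False
        have "p = of_real (Re p)" using poles_real[of p] p by (simp add: poles_def complex_eq_iff)
        hence "p \<in> S" using S[of "Re p"] False by simp
        thus ?thesis by (simp add: linked_def)
      qed (use elim p in auto)
    qed
  qed
qed

lemma eventually_right_poles_linked:
  assumes sep: "separates_poles m n a \<alpha> b \<beta> L" and op: "open (- range L)"
    and S: "\<And>x. x > R \<Longrightarrow> of_real x \<in> S"
  shows "\<forall>\<^sub>F M in at_top. \<forall>p\<in>right_poles n a \<alpha>. linked (range L \<union> - ball 0 M) S p"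
proof -
  have 1: "\<forall>\<^sub>F M in at_top. linked (range L \<union> - ball 0 M) S p" if "p \<in> right_poles n a \<alpha>" for p
  proof -
    have "\<forall>\<^sub>F x in at_top. connected_component (- range L) p (complex_of_real x)"
      using sep that by (auto simp: separates_poles_def right_side_def)
    hence "\<forall>\<^sub>F x in at_top. connected_component (- range L) p (complex_of_real x) \<and> x > R"
      using eventually_gt_at_top by (rule eventually_conj)
    note ev = this
    obtain x where "connected_component (- range L) p (complex_of_real x)" "x > R"
      using eventually_happens'[OF trivial_limit_at_top_linorder ev] by blast
    thus ?thesis using eventually_linked[OF op] S by blast
  qed
  have "\<forall>\<^sub>F M in at_top. \<forall>p\<in>{s \<in> right_poles n a \<alpha>. Re s \<le> R}. linked (range L \<union> - ball 0 M) S p"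
    using 1 by (intro eventually_ball_finite finite_right_poles) auto
  thus ?thesis
  proof eventually_elim
    case (elim M)
    show ?case
    proof
      fix p assume p: "p \<in> right_poles n a \<alpha>"
      show "linked (range L \<union> - ball 0 M) S p"
      proof (cases "Re p \<le> R")
        case False
        have "p = of_real (Re p)" using poles_real[of p] p by (simp add: poles_def complex_eq_iff)
        hence "p \<in> S" using S[of "Re p"] False by simp
        thus ?thesis by (simp add: linked_def)
      qed (use elim p in auto)
    qed
  qed
qed

end

lemma not_in_path_image_if_linked:
  assumes "linked X S p" "S \<inter> X = {}"
  shows "p \<notin> X"
  using assms unfolding linked_def by blast

lemma linked_antimono: "linked X S p \<Longrightarrow> Y \<subseteq> X \<Longrightarrow> linked Y S p"
  unfolding linked_def by blast

lemma unbounded_if_contains_ray: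
  assumes "\<And>x. x < - R \<Longrightarrow> of_real x \<in> S"
  shows "\<not> bounded (S :: complex set)"
proof
  assume "bounded S"
  then obtain M where M: "\<And>s. s \<in> S \<Longrightarrow> cmod s \<le> M" unfolding bounded_iff by blast
  have "cmod (of_real (- \<bar>R\<bar> - \<bar>M\<bar> - 1)) \<le> M" by (intro M assms) linarith
  thus False unfolding norm_of_real by linarith
qed

lemma unbounded_if_contains_ray':
  assumes "\<And>x. x > R \<Longrightarrow> of_real x \<in> S"
  shows "\<not> bounded (S :: complex set)"
proof
  assume "bounded S"
  then obtain M where M: "\<And>s. s \<in> S \<Longrightarrow> cmod s \<le> M" unfolding bounded_iff by blast
  have "cmod (of_real (\<bar>R\<bar> + \<bar>M\<bar> + 1)) \<le> M" by (intro M assms) linarith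
  thus False unfolding norm_of_real by linarith
qed

lemma winding_number_reverse_linepath:
  "p \<notin> closed_segment u v \<Longrightarrow> winding_number (linepath v u) p = - winding_number (linepath u v) p"
  using winding_number_reversepath[of "linepath u v" p] by simp

section \<open>Joining a loop and a vertical contour\<close>

text \<open>
  Unbounded connected regions; each closed curve whose winding number is determined below avoids one of them. The ends
  of a loop run through every left half-plane, but they keep a positive distance from the real axis, so for a loop the
  half-plane is replaced by a strip.
\<close>

definition far_strip :: "real \<Rightarrow> real \<Rightarrow> complex set" where
  "far_strip R \<delta> = {s. Re s < - R \<and> - \<delta> < Im s \<and> Im s < \<delta>}"

definition far_left :: "real \<Rightarrow> complex set" where "far_left R = {s. Re s < - R}"

definition far_right :: "real \<Rightarrow> complex set" where "far_right R = {s. Re s > R}"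

lemma far_regions:
  assumes "\<delta> > 0"
  shows "connected (far_strip R \<delta>)" "connected (far_left R)" "connected (far_right R)"
    "\<not> bounded (far_strip R \<delta>)" "\<not> bounded (far_left R)" "\<not> bounded (far_right R)"
proof -
  show "connected (far_strip R \<delta>)" "connected (far_left R)" "connected (far_right R)"
    unfolding far_strip_def far_left_def far_right_def
    by (auto intro!: convex_connected convex_halfspace_Re_lt convex_halfspace_Re_gt half_strips_open_convex)
  show "\<not> bounded (far_strip R \<delta>)" "\<not> bounded (far_left R)"
    by (rule unbounded_if_contains_ray[of R], use assms in \<open>simp add: far_strip_def far_left_def\<close>)+
  show "\<not> bounded (far_right R)"
    by (rule unbounded_if_contains_ray'[of R]) (simp add: far_right_def)
qed

text \<open>
  \<open>L\<close> and \<open>V\<close> are the loop and the vertical contour, cut off at \<open>Re s = -k\<close> and at \<open>Im s = \<plusminus>k\<close>. The ball of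
  radius \<open>M\<close> contains the sets that connect poles to far regions, and the inequalities for \<open>k\<close> place the cuts
  outside of it.
\<close>

locale joined_contours =
  fixes L V :: "real \<Rightarrow> complex" and A B A' B' k \<delta> R M :: real
  assumes L: "piecewise_C1_curve L" and V: "piecewise_C1_curve V"
    and \<delta>: "\<delta> > 0"
    and L_ends: "Re (L A) = - k" "Re (L B) = - k" "Im (L A) \<le> - \<delta>" "\<delta> \<le> Im (L B)"
    and V_ends: "Im (V A') = - k" "Im (V B') = k" "\<bar>Re (V A')\<bar> \<le> R" "\<bar>Re (V B')\<bar> \<le> R"
    and k: "2 * M + R \<le> k" "\<delta> \<le> k" "R \<le> k" "2 * M \<le> k"
    and L_range: "\<And>t. \<not> (Re (L t) < - R \<and> \<bar>Im (L t)\<bar> < \<delta>)" "\<And>t. Re (L t) \<le> R"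
    and V_range: "\<And>t. \<bar>Re (V t)\<bar> \<le> R"
begin

abbreviation upper_link where "upper_link \<equiv> linepath (L B) (V B')"
abbreviation lower_link where "lower_link \<equiv> linepath (V A') (L A)"
abbreviation right_link where "right_link \<equiv> linepath (V B') (of_real k) +++ linepath (of_real k) (V A')"
abbreviation left_link where "left_link \<equiv> linepath (L B) (L A)"

definition joined :: "real \<Rightarrow> complex" where
  "joined = segment L A B +++ (upper_link +++ (reversepath (segment V A' B') +++ lower_link))"

lemma R_nonneg: "0 \<le> R" using V_ends by linarith

lemma upper_link_bounds:
  assumes "s \<in> closed_segment (L B) (V B')"
  shows "\<delta> \<le> Im s" "Re s \<le> R"
  using closed_segment_Re_mult_ge[OF assms, of \<delta> "-\<i>"] closed_segment_Re_mult_ge[OF assms, of "-R" "-1"]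
    L_ends V_ends k R_nonneg by auto

lemma lower_link_bounds:
  assumes "s \<in> closed_segment (V A') (L A)"
  shows "Im s \<le> - \<delta>" "Re s \<le> R"
  using closed_segment_Re_mult_ge[OF assms, of \<delta> "\<i>"] closed_segment_Re_mult_ge[OF assms, of "-R" "-1"]
    L_ends V_ends k R_nonneg by auto

lemma right_link_bounds:
  assumes "s \<in> closed_segment (V B') (of_real k) \<union> closed_segment (of_real k) (V A')"
  shows "- R \<le> Re s"
  using closed_segment_Re_mult_ge[of s "V B'" "of_real k" "- R" 1]
    closed_segment_Re_mult_ge[of s "of_real k" "V A'" "- R" 1] assms V_ends k R_nonneg by auto

lemma left_link_bounds:
  assumes "s \<in> closed_segment (L B) (L A)"
  shows "Re s \<le> - k"
  using closed_segment_Re_mult_ge[OF assms, of k "-1"] L_ends by simp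

lemma pieces_avoid:
  "path_image (segment L A B) \<subseteq> - far_strip R \<delta> \<inter> - far_right R"
  "path_image (segment V A' B') \<subseteq> - far_left R \<inter> - far_right R"
  "closed_segment (L B) (V B') \<subseteq> - far_strip R \<delta> \<inter> - far_right R"
  "closed_segment (V A') (L A) \<subseteq> - far_strip R \<delta> \<inter> - far_right R"
  "closed_segment (V B') (of_real k) \<subseteq> - far_strip R \<delta> \<inter> - far_left R"
  "closed_segment (of_real k) (V A') \<subseteq> - far_strip R \<delta> \<inter> - far_left R"
  "closed_segment (L B) (L A) \<subseteq> - far_right R"
proof -
  have "\<not> (Re (L t) < - R \<and> - \<delta> < Im (L t) \<and> Im (L t) < \<delta>)" "\<not> Re (L t) > R" for t
    using L_range(1)[of t] L_range(2)[of t] by auto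
  thus "path_image (segment L A B) \<subseteq> - far_strip R \<delta> \<inter> - far_right R"
    by (auto simp: path_image_segment far_strip_def far_right_def)
  have "\<not> Re (V t) < - R" "\<not> Re (V t) > R" for t using V_range[of t] by auto
  thus "path_image (segment V A' B') \<subseteq> - far_left R \<inter> - far_right R"
    by (auto simp: path_image_segment far_left_def far_right_def)
  show "closed_segment (L B) (V B') \<subseteq> - far_strip R \<delta> \<inter> - far_right R"
    using upper_link_bounds by (fastforce simp: far_strip_def far_right_def)
  show "closed_segment (V A') (L A) \<subseteq> - far_strip R \<delta> \<inter> - far_right R"
    using lower_link_bounds by (fastforce simp: far_strip_def far_right_def)
  show "closed_segment (V B') (of_real k) \<subseteq> - far_strip R \<delta> \<inter> - far_left R"
    "closed_segment (of_real k) (V A') \<subseteq> - far_strip R \<delta> \<inter> - far_left R"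
    using right_link_bounds by (fastforce simp: far_strip_def far_left_def)+
  show "closed_segment (L B) (L A) \<subseteq> - far_right R"
    using left_link_bounds k R_nonneg by (fastforce simp: far_right_def)
qed

lemma cmod_diagonal_directions: "cmod (-1 - \<i>) \<le> 2" "cmod (-1 + \<i>) \<le> 2" "cmod (1 - \<i>) \<le> 2" "cmod (1 + \<i>) \<le> 2"
  using cmod_le[of "-1 - \<i>"] cmod_le[of "-1 + \<i>"] cmod_le[of "1 - \<i>"] cmod_le[of "1 + \<i>"] by auto

text \<open>
  On each link one of the functionals \<open>- Re s\<close> and \<open>\<plusminus>Re s \<plusminus> Im s\<close> is at least \<open>2 M\<close>, because it is so at
  the two ends.
\<close>

lemma links_avoid_ball:
  "closed_segment (L B) (V B') \<inter> ball 0 M = {}"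
  "closed_segment (V A') (L A) \<inter> ball 0 M = {}"
  "closed_segment (V B') (of_real k) \<inter> ball 0 M = {}"
  "closed_segment (of_real k) (V A') \<inter> ball 0 M = {}"
  "closed_segment (L B) (L A) \<inter> ball 0 M = {}"
  using L_ends V_ends k \<delta>
  by (intro closed_segment_disjoint_ball[OF cmod_diagonal_directions(1)] closed_segment_disjoint_ball[OF cmod_diagonal_directions(2)]
      closed_segment_disjoint_ball[OF cmod_diagonal_directions(3)] closed_segment_disjoint_ball[OF cmod_diagonal_directions(4)]
      closed_segment_disjoint_ball[of "-1"]; simp)+

lemma valid_segments [simp]: "valid_path (segment L A B)" "valid_path (segment V A' B')"
  using L V by (auto intro: valid_path_segment)

lemma path_segments [simp]: "path (segment L A B)" "path (segment V A' B')"
  using valid_segments by (auto intro: valid_path_imp_path)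

text \<open>
  The joined curve is the difference of two closed curves, obtained by inserting \<open>right_link\<close> in both directions. The
  loop closed on the right does not surround the far part of the negative axis; the vertical contour closed on the right
  does not surround the far left half-plane. A left pole can be joined to these regions by a set that
  avoids the respective contour, though possibly not both contours at once, which is why the curve is split.
\<close>

lemma winding_number_joined_left:
  assumes p1: "linked (range L \<union> - ball 0 M) (far_strip R \<delta>) p"
    and p2: "linked (range V \<union> - ball 0 M) (far_left R) p"
  shows "winding_number joined p = 0"
proof -
  define g1 where "g1 = segment L A B +++ (upper_link +++ (right_link +++ lower_link))"
  define g2 where "g2 = segment V A' B' +++ right_link"
  have im1: "path_image g1 = path_image (segment L A B) \<union> (closed_segment (L B) (V B') \<union>
      ((closed_segment (V B') (of_real k) \<union> closed_segment (of_real k) (V A')) \<union> closed_segment (V A') (L A)))"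
    by (simp add: g1_def path_image_join)
  have im2: "path_image g2 = path_image (segment V A' B') \<union>
      (closed_segment (V B') (of_real k) \<union> closed_segment (of_real k) (V A'))"
    by (simp add: g2_def path_image_join)
  have "path_image g1 \<subseteq> range L \<union> - ball 0 M" "path_image g2 \<subseteq> range V \<union> - ball 0 M"
    unfolding im1 im2
    using links_avoid_ball path_image_segment_subset_range[of L A B] path_image_segment_subset_range[of V A' B'] by blast+
  hence l: "linked (path_image g1) (far_strip R \<delta>) p" "linked (path_image g2) (far_left R) p"
    using p1 p2 by (auto intro: linked_antimono)
  have d1: "(far_strip R \<delta>) \<inter> path_image g1 = {}"
    unfolding im1 using pieces_avoid by blast
  have d2: "(far_left R) \<inter> path_image g2 = {}"
    unfolding im2 using pieces_avoid by blast
  note c = far_regions(1,2)[OF \<delta>] and u = far_regions(4,5)[OF \<delta>]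
  have p_g: "p \<notin> path_image g1" "p \<notin> path_image g2"
    using l d1 d2 not_in_path_image_if_linked by blast+
  have "winding_number g1 p = 0"
    by (intro winding_number_zero_if_linked[OF _ _ c(1) u(1) d1 l(1)]) (auto simp: g1_def)
  hence 1: "winding_number (segment L A B) p + (winding_number upper_link p +
      (winding_number right_link p + winding_number lower_link p)) = 0"
    using p_g(1) unfolding g1_def im1[unfolded g1_def]
    by (simp add: winding_number_join path_image_join)
  have "winding_number g2 p = 0"
    by (intro winding_number_zero_if_linked[OF _ _ c(2) u(2) d2 l(2)]) (auto simp: g2_def)
  hence 2: "winding_number (segment V A' B') p + winding_number right_link p = 0"
    using p_g(2) unfolding g2_def im2[unfolded g2_def]
    by (simp add: winding_number_join path_image_join)
  have "winding_number joined p = winding_number (segment L A B) p + (winding_number upper_link p +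
      (- winding_number (segment V A' B') p + winding_number lower_link p))"
    using p_g unfolding joined_def im1 im2
    by (simp add: winding_number_join path_image_join winding_number_reversepath)
  also have "\<dots> = (winding_number (segment L A B) p + (winding_number upper_link p +
      (winding_number right_link p + winding_number lower_link p)))
      - (winding_number (segment V A' B') p + winding_number right_link p)" by simp
  finally show ?thesis unfolding 1 2 by simp
qed

text \<open>
  The mirror image: here both contours are closed on the left, through \<open>left_link\<close>, and leave the far right
  half-plane in their outside.
\<close>

lemma winding_number_joined_right:
  assumes p1: "linked (range L \<union> - ball 0 M) (far_right R) p"
    and p2: "linked (range V \<union> - ball 0 M) (far_right R) p"
  shows "winding_number joined p = 0"
proof -
  define g1 where "g1 = segment L A B +++ left_link"
  define g2 where "g2 = segment V A' B' +++ (reversepath upper_link +++ (left_link +++ reversepath lower_link))"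
  have im1: "path_image g1 = path_image (segment L A B) \<union> closed_segment (L B) (L A)"
    by (simp add: g1_def path_image_join)
  have im2: "path_image g2 = path_image (segment V A' B') \<union>
      (closed_segment (L B) (V B') \<union> (closed_segment (L B) (L A) \<union> closed_segment (V A') (L A)))"
    by (simp add: g2_def path_image_join closed_segment_commute)
  have "path_image g1 \<subseteq> range L \<union> - ball 0 M" "path_image g2 \<subseteq> range V \<union> - ball 0 M"
    unfolding im1 im2
    using links_avoid_ball path_image_segment_subset_range[of L A B] path_image_segment_subset_range[of V A' B'] by blast+
  hence l: "linked (path_image g1) (far_right R) p" "linked (path_image g2) (far_right R) p"
    using p1 p2 by (auto intro: linked_antimono)
  have d1: "(far_right R) \<inter> path_image g1 = {}"
    unfolding im1 using pieces_avoid by blast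
  have d2: "(far_right R) \<inter> path_image g2 = {}"
    unfolding im2 using pieces_avoid by blast
  note c = far_regions(3)[OF \<delta>] and u = far_regions(6)[OF \<delta>]
  have p_g: "p \<notin> path_image g1" "p \<notin> path_image g2"
    using l d1 d2 not_in_path_image_if_linked by blast+
  have "winding_number g1 p = 0"
    by (intro winding_number_zero_if_linked[OF _ _ c u d1 l(1)]) (auto simp: g1_def)
  hence 1: "winding_number (segment L A B) p + winding_number left_link p = 0"
    using p_g(1) unfolding g1_def im1[unfolded g1_def]
    by (simp add: winding_number_join path_image_join)
  have "winding_number g2 p = 0"
    by (intro winding_number_zero_if_linked[OF _ _ c u d2 l(2)]) (auto simp: g2_def)
  hence 2: "winding_number (segment V A' B') p + (- winding_number upper_link p +
      (winding_number left_link p - winding_number lower_link p)) = 0"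
    using p_g(2) unfolding g2_def im2[unfolded g2_def]
    by (simp add: winding_number_join path_image_join closed_segment_commute
        winding_number_reverse_linepath[of _ "L B" "V B'"] winding_number_reverse_linepath[of _ "V A'" "L A"])
  have "winding_number joined p = winding_number (segment L A B) p + (winding_number upper_link p +
      (- winding_number (segment V A' B') p + winding_number lower_link p))"
    using p_g unfolding joined_def im1 im2
    by (simp add: winding_number_join path_image_join winding_number_reversepath)
  also have "\<dots> = (winding_number (segment L A B) p + winding_number left_link p)
      - (winding_number (segment V A' B') p + (- winding_number upper_link p +
          (winding_number left_link p - winding_number lower_link p)))" by simp
  finally show ?thesis unfolding 1 2 by simp
qed

lemma contour_integral_joined:
  assumes f: "f holomorphic_on S" "open S" and LV: "range L \<subseteq> S" "range V \<subseteq> S"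
    and im: "\<And>s. Im s \<noteq> 0 \<Longrightarrow> s \<in> S" and wn: "\<And>p. p \<notin> S \<Longrightarrow> winding_number joined p = 0"
  shows "contour_integral (segment L A B) f + contour_integral upper_link f
           + contour_integral lower_link f = contour_integral (segment V A' B') f"
proof -
  have up: "closed_segment (L B) (V B') \<subseteq> S" using upper_link_bounds \<delta> im by force
  have lo: "closed_segment (V A') (L A) \<subseteq> S" using lower_link_bounds \<delta> im by force
  have segs: "path_image (segment L A B) \<subseteq> S" "path_image (segment V A' B') \<subseteq> S"
    using LV path_image_segment_subset_range by blast+
  have int: "f contour_integrable_on g" if "valid_path g" "path_image g \<subseteq> S" for g
    using contour_integrable_holomorphic_simple[OF f that] .
  have 1: "(f has_contour_integral contour_integral (segment L A B) f) (segment L A B)"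
    using segs by (intro has_contour_integral_integral int) auto
  have 2: "(f has_contour_integral contour_integral upper_link f) upper_link"
    using up by (intro has_contour_integral_integral int) auto
  have 3: "(f has_contour_integral - contour_integral (segment V A' B') f) (reversepath (segment V A' B'))"
    using segs by (intro has_contour_integral_reversepath has_contour_integral_integral int) auto
  have 4: "(f has_contour_integral contour_integral lower_link f) lower_link"
    using lo by (intro has_contour_integral_integral int) auto
  have "(f has_contour_integral (contour_integral (segment L A B) f + (contour_integral upper_link f
      + (- contour_integral (segment V A' B') f + contour_integral lower_link f)))) joined"
    unfolding joined_def
    by (intro has_contour_integral_join 1 2 3 4) auto
  moreover have "(f has_contour_integral 0) joined"
  proof (rule Cauchy_theorem_global[OF f(2,1)])
    show "path_image joined \<subseteq> S"
      using segs up lo by (simp add: joined_def path_image_join)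
  qed (use wn in \<open>auto simp: joined_def\<close>)
  ultimately have "contour_integral (segment L A B) f + (contour_integral upper_link f
      + (- contour_integral (segment V A' B') f + contour_integral lower_link f)) = 0"
    by (rule has_contour_integral_unique)
  thus ?thesis by (simp add: algebra_simps add_eq_0_iff)
qed

end

lemma contour_integral_linepath_sup_bound:
  assumes "continuous_on (closed_segment u v) f" "0 \<le> B" "\<And>s. s \<in> closed_segment u v \<Longrightarrow> cmod (f s) \<le> B"
  shows "cmod (contour_integral (linepath u v) f) \<le> B * cmod (v - u)"
  using has_contour_integral_bound_linepath[OF has_contour_integral_integral[OF
      contour_integrable_continuous_linepath[OF assms(1)]] assms(2,3)] .

text \<open>
  On the segment from an end \<open>w\<close> of the loop to an end \<open>v\<close> of the vertical contour, the exponent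
  \<open>Re s - \<kappa> \<bar>Im s\<bar>\<close> is linear, so it is largest at one of the ends: it is at most \<open>-k\<close> at \<open>w\<close> and at most
  \<open>R - \<kappa> k\<close> at \<open>v\<close>. The sign \<open>\<sigma>\<close> distinguishes the upper from the lower half-plane.
\<close>

lemma connecting_segment_bound:
  fixes \<sigma> :: real
  assumes f: "\<And>s. Re s \<le> R \<Longrightarrow> \<delta> \<le> \<bar>Im s\<bar> \<Longrightarrow> cmod (f s) \<le> C * exp (Re s - \<kappa> * \<bar>Im s\<bar>)"
    and cont: "continuous_on (closed_segment w v) f"
    and \<sigma>: "\<sigma> = 1 \<or> \<sigma> = -1" and C: "C \<ge> 0" and \<kappa>: "\<kappa> > 0" "\<mu> \<le> \<kappa>" "\<mu> \<le> 1" and \<delta>: "\<delta> > 0" "\<delta> \<le> k" and R: "R \<ge> 0"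
    and w: "Re w = - k" "\<delta> \<le> \<sigma> * Im w" "\<bar>Im w\<bar> \<le> Y"
    and v: "Im v = \<sigma> * k" "\<bar>Re v\<bar> \<le> R"
  shows "cmod (contour_integral (linepath w v) f) \<le> C * exp (R - \<mu> * k) * (2 * k + R + Y)"
proof -
  define d where "d = Complex (-1) (- \<sigma> * \<kappa>)"
  have d: "Re (d * s) = - Re s + \<kappa> * (\<sigma> * Im s)" for s by (simp add: d_def)
  have \<sigma>2: "\<sigma> * \<sigma> = 1" using \<sigma> by auto
  have "\<mu> * k \<le> \<kappa> * k" "\<mu> * k \<le> 1 * k" using \<kappa> \<delta> by (intro mult_right_mono; simp)+
  moreover have "0 \<le> \<kappa> * (\<sigma> * Im w)" using w \<delta> \<kappa> by simp
  moreover have "\<sigma> * Im v = k" using v(1) \<sigma>2 by (simp add: mult.assoc[symmetric])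
  ultimately have ends: "\<mu> * k - R \<le> Re (d * w)" "\<mu> * k - R \<le> Re (d * v)"
    unfolding d using w(1) v(2) R by (simp_all add: abs_le_iff)
  have "cmod (f s) \<le> C * exp (R - \<mu> * k)" if s: "s \<in> closed_segment w v" for s
  proof -
    have "\<mu> * k - R \<le> - Re s + \<kappa> * (\<sigma> * Im s)"
      using closed_segment_Re_mult_ge[OF s ends] unfolding d .
    moreover have "\<delta> \<le> \<sigma> * Im s"
    proof -
      have e: "Re (- \<i> * of_real \<sigma> * x) = \<sigma> * Im x" for x by simp
      have "\<delta> \<le> \<sigma> * Im v" using v(1) \<sigma>2 \<delta> by (simp add: mult.assoc[symmetric])
      thus ?thesis using closed_segment_Re_mult_ge[OF s, of \<delta> "- \<i> * of_real \<sigma>"] w(2) unfolding e by blast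
    qed
    moreover have "\<bar>Im s\<bar> = \<sigma> * Im s" using \<sigma> \<open>\<delta> \<le> \<sigma> * Im s\<close> \<delta> by auto
    moreover have "Re s \<le> R"
      using closed_segment_Re_mult_ge[OF s, of "- R" "-1"] w v \<delta> R by auto
    ultimately have "cmod (f s) \<le> C * exp (Re s - \<kappa> * \<bar>Im s\<bar>)" "Re s - \<kappa> * \<bar>Im s\<bar> \<le> R - \<mu> * k"
      using f[of s] by auto
    thus ?thesis using C by (meson exp_le_cancel_iff mult_left_mono order_trans)
  qed
  hence "cmod (contour_integral (linepath w v) f) \<le> C * exp (R - \<mu> * k) * cmod (v - w)"
    using C by (intro contour_integral_linepath_sup_bound cont) auto
  also have "cmod (v - w) \<le> 2 * k + R + Y"
  proof -
    have "\<bar>Im v\<bar> = k" using v(1) \<sigma> \<delta> by auto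
    thus ?thesis using cmod_diff_le_Re_Im[of v w] w v by linarith
  qed
  finally show ?thesis using C by (simp add: mult_left_mono)
qed

context fox_parameters
begin

text \<open>
  With the cuts at level \<open>k\<close>, the integrals over the finite pieces differ by the integrals over the two connecting
  segments, which vanish as \<open>k \<rightarrow> \<infinity>\<close>.
\<close>

theorem loop_integral_eq_vertical_integral:
  assumes \<Delta>: "Delta > 0" and loop: "left_loop \<phi>1 \<phi>2 L" and sepL: "separates_poles m n a \<alpha> b \<beta> L"
    and vert: "vertical_contour \<gamma> V" and sepV: "separates_poles m n a \<alpha> b \<beta> V"
    and \<zeta>: "\<bar>Im \<zeta>\<bar> < astar * pi / 2"
  shows "curve_integral (integrand \<zeta>) L = curve_integral (integrand \<zeta>) V"
proof -
  have \<phi>: "\<phi>1 < 0" "0 < \<phi>2" and L: "piecewise_C1_curve L"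
    and limL: "filterlim (\<lambda>t. Re (L t)) at_bot at_bot" "((\<lambda>t. Im (L t)) \<longlongrightarrow> \<phi>1) at_bot"
      "filterlim (\<lambda>t. Re (L t)) at_bot at_top" "((\<lambda>t. Im (L t)) \<longlongrightarrow> \<phi>2) at_top"
    using loop by (auto simp: left_loop_def)
  have V: "piecewise_C1_curve V"
    and limV: "((\<lambda>t. Re (V t)) \<longlongrightarrow> \<gamma>) at_bot" "filterlim (\<lambda>t. Im (V t)) at_bot at_bot"
      "((\<lambda>t. Re (V t)) \<longlongrightarrow> \<gamma>) at_top" "filterlim (\<lambda>t. Im (V t)) at_top at_top"
    using vert by (auto simp: vertical_contour_def)
  note contL = piecewise_C1_curve_imp_continuous[OF L] and contV = piecewise_C1_curve_imp_continuous[OF V]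
  define \<delta> where "\<delta> = min (- \<phi>1) \<phi>2 / 2"
  have \<delta>: "\<delta> > 0" "\<phi>1 < - \<delta>" "\<delta> < \<phi>2" using \<phi> by (auto simp: \<delta>_def min_def)
  define Y where "Y = \<bar>\<phi>1\<bar> + \<bar>\<phi>2\<bar> + 1"
  have L_bot: "\<forall>\<^sub>F t in at_bot. Im (L t) \<le> - \<delta> \<and> \<bar>Im (L t)\<bar> \<le> Y"
    using order_tendstoD(2)[OF limL(2) \<delta>(2)] order_tendstoD(1)[OF limL(2), of "\<phi>1 - 1"]
    by (rule eventually_elim2[OF _ _ conjI]) (use \<phi> \<delta> in \<open>auto simp: Y_def\<close>)
  have L_top: "\<forall>\<^sub>F t in at_top. \<delta> \<le> Im (L t) \<and> \<bar>Im (L t)\<bar> \<le> Y"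
    using order_tendstoD(1)[OF limL(4) \<delta>(3)] order_tendstoD(2)[OF limL(4), of "\<phi>2 + 1"]
    by (rule eventually_elim2[OF _ _ conjI]) (use \<phi> \<delta> in \<open>auto simp: Y_def\<close>)

  obtain R1 where R1: "\<And>t. Re (L t) < 0 \<or> \<bar>Re (L t)\<bar> \<le> R1"
    using bounded_if_eventually_bounded[of "\<lambda>t. Re (L t)" "\<lambda>t. Re (L t) < 0"] contL limL(1,3)
    unfolding filterlim_at_bot_dense by (auto intro: continuous_intros)
  have "\<forall>\<^sub>F t in at_bot. \<delta> \<le> \<bar>Im (L t)\<bar>" "\<forall>\<^sub>F t in at_top. \<delta> \<le> \<bar>Im (L t)\<bar>"
    using L_bot L_top by (auto elim!: eventually_mono)
  then obtain R2 where R2: "\<And>t. \<delta> \<le> \<bar>Im (L t)\<bar> \<or> \<bar>Re (L t)\<bar> \<le> R2"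
    using bounded_if_eventually_bounded[of "\<lambda>t. Re (L t)" "\<lambda>t. \<delta> \<le> \<bar>Im (L t)\<bar>"] contL
    by (auto intro: continuous_intros)
  have "\<forall>\<^sub>F t in F. \<bar>Re (V t)\<bar> \<le> \<bar>\<gamma>\<bar> + 1" if "((\<lambda>t. Re (V t)) \<longlongrightarrow> \<gamma>) F" for F
    using tendstoD[OF that zero_less_one] by eventually_elim (auto simp: dist_real_def)
  from this[OF limV(1)] this[OF limV(3)]
  obtain R3 where R3: "\<And>t. \<bar>Re (V t)\<bar> \<le> \<bar>\<gamma>\<bar> + 1 \<or> \<bar>Re (V t)\<bar> \<le> R3"
    using bounded_if_eventually_bounded[of "\<lambda>t. Re (V t)" "\<lambda>t. \<bar>Re (V t)\<bar> \<le> \<bar>\<gamma>\<bar> + 1"] contV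
    by (auto intro: continuous_intros)
  \<comment> \<open>every bound on real parts at once: \<open>L\<close> stays left of \<open>R\<close> and off the far strip, \<open>V\<close> stays between \<open>-R\<close> and \<open>R\<close>\<close>
  define R where "R = \<bar>R1\<bar> + \<bar>R2\<bar> + \<bar>R3\<bar> + \<bar>\<gamma>\<bar> + 1"
  have L_range: "\<not> (Re (L t) < - R \<and> \<bar>Im (L t)\<bar> < \<delta>)" "Re (L t) \<le> R" for t
    using R1[of t] R2[of t] unfolding R_def by linarith+
  have V_range: "\<bar>Re (V t)\<bar> \<le> R" for t using R3[of t] unfolding R_def by linarith
  have R0: "R \<ge> 0" by (simp add: R_def)

  have "filterlim (\<lambda>t. cmod (L t)) at_top F" if "filterlim (\<lambda>t. Re (L t)) at_bot F" for F
  proof (rule filterlim_at_top_mono)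
    show "filterlim (\<lambda>t. - Re (L t)) at_top F" using that by (simp add: filterlim_uminus_at_top)
    show "\<forall>\<^sub>F t in F. - Re (L t) \<le> cmod (L t)"
      using abs_Re_le_cmod by (intro always_eventually allI) (metis abs_le_iff)
  qed
  hence opL: "open (- range L)"
    using closed_range_if_norm_at_top[OF contL] limL by (simp add: open_closed)
  have "filterlim (\<lambda>t. cmod (V t)) at_top at_bot"
  proof (rule filterlim_at_top_mono)
    show "filterlim (\<lambda>t. - Im (V t)) at_top at_bot" using limV by (simp add: filterlim_uminus_at_top)
    show "\<forall>\<^sub>F t in at_bot. - Im (V t) \<le> cmod (V t)"
      using abs_Im_le_cmod by (intro always_eventually allI) (metis abs_le_iff)
  qed
  moreover have "filterlim (\<lambda>t. cmod (V t)) at_top at_top"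
  proof (rule filterlim_at_top_mono[OF limV(4)])
    show "\<forall>\<^sub>F t in at_top. Im (V t) \<le> cmod (V t)"
      using abs_Im_le_cmod by (intro always_eventually allI) (metis abs_le_iff)
  qed
  ultimately have opV: "open (- range V)"
    using closed_range_if_norm_at_top[OF contV] by (simp add: open_closed)

  have "\<forall>\<^sub>F M in at_top. (\<forall>p\<in>left_poles m b \<beta>. linked (range L \<union> - ball 0 M) (far_strip R \<delta>) p) \<and>
      (\<forall>p\<in>left_poles m b \<beta>. linked (range V \<union> - ball 0 M) (far_left R) p) \<and>
      (\<forall>p\<in>right_poles n a \<alpha>. linked (range L \<union> - ball 0 M) (far_right R) p) \<and>
      (\<forall>p\<in>right_poles n a \<alpha>. linked (range V \<union> - ball 0 M) (far_right R) p)"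
    using \<delta> by (intro eventually_conj eventually_left_poles_linked[OF sepL opL, of R]
        eventually_left_poles_linked[OF sepV opV, of R]
        eventually_right_poles_linked[OF sepL opL, of R] eventually_right_poles_linked[OF sepV opV, of R])
      (auto simp: far_strip_def far_left_def far_right_def)
  from eventually_happens'[OF trivial_limit_at_top_linorder this] obtain M where
    M: "\<And>p. p \<in> left_poles m b \<beta> \<Longrightarrow> linked (range L \<union> - ball 0 M) (far_strip R \<delta>) p"
       "\<And>p. p \<in> left_poles m b \<beta> \<Longrightarrow> linked (range V \<union> - ball 0 M) (far_left R) p"
       "\<And>p. p \<in> right_poles n a \<alpha> \<Longrightarrow> linked (range L \<union> - ball 0 M) (far_right R) p"
       "\<And>p. p \<in> right_poles n a \<alpha> \<Longrightarrow> linked (range V \<union> - ball 0 M) (far_right R) p"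
    by blast

  obtain B where B: "filterlim B at_top sequentially" "\<forall>\<^sub>F k in sequentially. Re (L (B k)) = - real k"
    using exit_parameters[OF continuous_on_Re[OF contL] limL(3)] .
  have "continuous_on UNIV (\<lambda>t. L (- t))" "continuous_on UNIV (\<lambda>t. V (- t))"
    by (intro continuous_on_compose2[OF contL] continuous_on_compose2[OF contV] continuous_intros; simp)+
  note cont' = this
  have "filterlim (\<lambda>t. Re (L (- t))) at_bot at_top" using limL(1) by (simp add: filterlim_at_bot_mirror)
  then obtain A where A: "filterlim A at_top sequentially" "\<forall>\<^sub>F k in sequentially. Re (L (- A k)) = - real k"
    using exit_parameters[OF continuous_on_Re[OF cont'(1)]] by blast
  have "filterlim (\<lambda>t. - Im (V t)) at_bot at_top" using limV(4) by (simp add: filterlim_uminus_at_bot)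
  then obtain B' where B': "filterlim B' at_top sequentially" "\<forall>\<^sub>F k in sequentially. - Im (V (B' k)) = - real k"
    using exit_parameters[OF continuous_on_minus[OF continuous_on_Im[OF contV]]] by blast
  have "filterlim (\<lambda>t. Im (V (- t))) at_bot at_top" using limV(2) by (simp add: filterlim_at_bot_mirror)
  then obtain A' where A': "filterlim A' at_top sequentially" "\<forall>\<^sub>F k in sequentially. Im (V (- A' k)) = - real k"
    using exit_parameters[OF continuous_on_Im[OF cont'(2)]] by blast
  have A_bot: "filterlim (\<lambda>k. - A k) at_bot sequentially" "filterlim (\<lambda>k. - A' k) at_bot sequentially"
    using A(1) A'(1) by (simp_all add: filterlim_uminus_at_bot)

  let ?f = "integrand \<zeta>"
  obtain C \<kappa> where C: "C > 0" "\<kappa> > 0" "\<And>s. Re s \<le> R \<Longrightarrow> \<delta> \<le> \<bar>Im s\<bar> \<Longrightarrow>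
    cmod (?f s) \<le> C * exp (Re s - \<kappa> * \<bar>Im s\<bar>)"
    using integrand_bound_sector[OF \<Delta> \<delta>(1) \<zeta>] by blast
  define \<mu> where "\<mu> = min \<kappa> 1"
  have \<mu>: "\<mu> > 0" "\<mu> \<le> \<kappa>" "\<mu> \<le> 1" using C by (auto simp: \<mu>_def)
  \<comment> \<open>the bound of \<open>connecting_segment_bound\<close> for both connecting segments\<close>
  define E where "E = (\<lambda>k. C * exp (R - \<mu> * real k) * (2 * real k + R + Y))"
  have E: "E \<longlonglongrightarrow> 0" unfolding E_def using \<mu>(1) by real_asymp
  define U where "U = (\<lambda>k. contour_integral (linepath (L (B k)) (V (B' k))) ?f)"
  define W where "W = (\<lambda>k. contour_integral (linepath (V (- A' k)) (L (- A k))) ?f)"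
  have large: "\<forall>\<^sub>F k in sequentially. real k \<ge> x" for x
    using filterlim_real_sequentially unfolding filterlim_at_top by blast
  have contf: "continuous_on (closed_segment u v) ?f" if "closed_segment u v \<subseteq> - poles" for u v
    using holomorphic_on_imp_continuous_on[OF holomorphic_integrand] that by (rule continuous_on_subset)
  have ev: "\<forall>\<^sub>F k in sequentially.
      contour_integral (segment L (- A k) (B k)) ?f + U k + W k = contour_integral (segment V (- A' k) (B' k)) ?f
      \<and> cmod (U k) \<le> E k \<and> cmod (W k) \<le> E k"
    using A(2) B(2) A'(2) B'(2) large[of "2 * \<bar>M\<bar> + R + \<delta>"]
      eventually_compose_filterlim[OF L_bot A_bot(1)] eventually_compose_filterlim[OF L_top B(1)]
  proof eventually_elim
    case (elim k)
    interpret joined_contours L V "- A k" "B k" "- A' k" "B' k" "real k" \<delta> R M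
      using L V \<delta> elim L_range V_range R0 by unfold_locales auto
    have no_poles: "closed_segment (L (B k)) (V (B' k)) \<subseteq> - poles" "closed_segment (V (- A' k)) (L (- A k)) \<subseteq> - poles"
      using upper_link_bounds(1) lower_link_bounds(1) poles_real \<delta> by fastforce+
    have "contour_integral (segment L (- A k) (B k)) ?f + U k + W k = contour_integral (segment V (- A' k) (B' k)) ?f"
      unfolding U_def W_def
    proof (rule contour_integral_joined[OF holomorphic_integrand])
      fix p assume "p \<notin> - poles"
      thus "winding_number joined p = 0"
        unfolding poles_def using M winding_number_joined_left winding_number_joined_right by auto
    qed (use closed_poles range_disjoint_poles[OF sepL] range_disjoint_poles[OF sepV] poles_real in auto)
    moreover have "cmod (U k) \<le> E k" unfolding U_def E_def
      by (rule connecting_segment_bound[where \<sigma> = 1 and \<kappa> = \<kappa> and \<delta> = \<delta>])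
         (use C \<mu> \<delta> R0 no_poles contf elim V_range in auto)
    moreover have "cmod (contour_integral (linepath (L (- A k)) (V (- A' k))) ?f) \<le> E k" unfolding E_def
      by (rule connecting_segment_bound[where \<sigma> = "-1" and \<kappa> = \<kappa> and \<delta> = \<delta>])
         (use C \<mu> \<delta> R0 no_poles contf elim V_range in \<open>auto simp: closed_segment_commute\<close>)
    hence "cmod (W k) \<le> E k" unfolding W_def
      using contour_integral_reverse_linepath[OF contf[OF no_poles(2)]] by simp
    ultimately show ?case by blast
  qed
  have U0: "U \<longlonglongrightarrow> 0" "W \<longlonglongrightarrow> 0"
    using ev by (auto intro!: Lim_null_comparison[OF _ E] elim!: eventually_mono)
  have IL: "(\<lambda>k. contour_integral (segment L (- A k) (B k)) ?f) \<longlonglongrightarrow> curve_integral ?f L"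
    using filterlim_compose[OF conjunct2[OF loop_integral(1)[OF \<Delta> loop sepL, unfolded has_curve_integral_def]]
        filterlim_Pair[OF A_bot(1) B(1)]] by simp
  have IV: "(\<lambda>k. contour_integral (segment V (- A' k) (B' k)) ?f) \<longlonglongrightarrow> curve_integral ?f V"
    using filterlim_compose[OF conjunct2[OF vertical_integral[OF \<Delta> vert sepV \<zeta>, unfolded has_curve_integral_def]]
        filterlim_Pair[OF A_bot(2) B'(1)]] by simp
  have "(\<lambda>k. contour_integral (segment L (- A k) (B k)) ?f + U k + W k) \<longlonglongrightarrow> curve_integral ?f L + 0 + 0"
    by (intro tendsto_add IL U0)
  moreover have "\<forall>\<^sub>F k in sequentially. contour_integral (segment L (- A k) (B k)) ?f + U k + W k
      = contour_integral (segment V (- A' k) (B' k)) ?f"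
    using ev by (auto elim!: eventually_mono)
  ultimately have "(\<lambda>k. contour_integral (segment V (- A' k) (B' k)) ?f) \<longlonglongrightarrow> curve_integral ?f L"
    by (simp add: Lim_transform_eventually)
  thus ?thesis using IV by (rule LIMSEQ_unique)
qed

end

section \<open>Analytic continuation along a path\<close>

lemma Ln_eq_ln_cmod_Arg: "z \<noteq> 0 \<Longrightarrow> Ln z = of_real (ln (cmod z)) + \<i> * of_real (Arg z)"
  by (simp add: complex_eq_iff Arg_eq_Im_Ln)

lemma path_logarithm:
  assumes g: "path g" "path_image g \<subseteq> - {0}"
  obtains \<Lambda> where "continuous_on {0..1} \<Lambda>" "\<Lambda> 0 = Ln (g 0)" "\<And>t. t \<in> {0..1} \<Longrightarrow> exp (\<Lambda> t) = g t"
proof -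
  have nz: "g t \<noteq> 0" if "t \<in> {0..1}" for t using g(2) that by (auto simp: path_image_def)
  have "contractible {0..1::real}" by (intro convex_imp_contractible) auto
  moreover have "continuous_on {0..1} g" using g(1) by (simp add: path_def)
  ultimately obtain h where h: "continuous_on {0..1} h" "\<And>t. t \<in> {0..1} \<Longrightarrow> g t = exp (h t)"
    using continuous_logarithm_on_contractible[of "{0..1}" g] nz by metis
  show ?thesis
  proof (rule that[of "\<lambda>t. h t + (Ln (g 0) - h 0)"])
    show "continuous_on {0..1} (\<lambda>t. h t + (Ln (g 0) - h 0))" by (intro continuous_intros h)
    show "exp (h t + (Ln (g 0) - h 0)) = g t" if "t \<in> {0..1}" for t
      using h(2)[OF that] h(2)[of 0] nz[of 0] by (simp add: exp_add exp_diff)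
  qed simp
qed

lemma eventually_Ln_quotient_small:
  assumes "w \<noteq> 0" "e > 0"
  shows "\<forall>\<^sub>F z in nhds w. z \<noteq> 0 \<and> cmod (Ln (z / w)) < e"
proof -
  have "isCont (\<lambda>z. Ln (z / w)) w" using assms by (auto intro!: continuous_intros)
  hence "((\<lambda>z. Ln (z / w)) \<longlongrightarrow> Ln (w / w)) (nhds w)"
    unfolding isCont_def using tendsto_at_iff_tendsto_nhds[of "\<lambda>z. Ln (z / w)" w] by simp
  hence "\<forall>\<^sub>F z in nhds w. dist (Ln (z / w)) (Ln (w / w)) < e"
    using assms(2) by (rule tendstoD)
  moreover have "\<forall>\<^sub>F z in nhds w. z \<noteq> 0" using assms(1) by (rule t1_space_nhds)
  ultimately show ?thesis using assms(1) by (simp add: eventually_conj_iff dist_norm)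
qed

lemma Ln_eq_if_exp:
  assumes "exp w = z" "\<bar>Im w\<bar> < pi"
  shows "Ln z = w"
  using assms Ln_exp[of w] by (auto simp: abs_less_iff)

text \<open>
  The germ at \<open>g t\<close> is \<open>G\<close> composed with the branch of the logarithm on the disc around \<open>g t\<close> through \<open>0\<close> that has the value
  \<open>\<Lambda> t\<close> at the centre. For \<open>u\<close> close to \<open>t\<close> the branches at \<open>g u\<close> and \<open>g t\<close> differ by a multiple of
  \<open>2\<pi>\<i>\<close> near \<open>g u\<close>, and by continuity of \<open>\<Lambda>\<close> this multiple is \<open>0\<close>.
\<close>

theorem analytic_continuation_along_logarithm:
  assumes G: "G holomorphic_on UNIV"
    and \<Lambda>: "continuous_on {0..1} \<Lambda>" "\<And>t. t \<in> {0..1} \<Longrightarrow> exp (\<Lambda> t) = g t"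
  shows "analytic_continuation_along g (\<lambda>t z. G (\<Lambda> t + Ln (z / g t)))"
  unfolding analytic_continuation_along_def
proof
  fix t :: real assume t: "t \<in> {0..1}"
  have nz: "g u \<noteq> 0" if "u \<in> {0..1}" for u using \<Lambda>(2)[OF that] by (metis exp_not_eq_zero)
  show "\<exists>r>0. (\<lambda>z. G (\<Lambda> t + Ln (z / g t))) holomorphic_on ball (g t) r \<and>
      (\<forall>\<^sub>F u in at t within {0..1}. g u \<in> ball (g t) r \<and>
        (\<forall>\<^sub>F z in nhds (g u). G (\<Lambda> u + Ln (z / g u)) = G (\<Lambda> t + Ln (z / g t))))"
  proof (intro exI[of _ "cmod (g t)"] conjI)
    show "cmod (g t) > 0" using nz[OF t] by simp
    have "z / g t \<notin> \<real>\<^sub>\<le>\<^sub>0" if z: "z \<in> ball (g t) (cmod (g t))" for z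
    proof -
      have "cmod (1 - z / g t) = cmod (g t - z) / cmod (g t)"
        using nz[OF t] by (simp add: norm_divide[symmetric] diff_divide_distrib)
      also have "\<dots> < 1" using z nz[OF t] by (simp add: dist_norm)
      finally have "Re (1 - z / g t) < 1" using complex_Re_le_cmod[of "1 - z / g t"] by linarith
      thus ?thesis by (auto simp: complex_nonpos_Reals_iff)
    qed
    hence "(\<lambda>z. \<Lambda> t + Ln (z / g t)) holomorphic_on ball (g t) (cmod (g t))"
      using nz[OF t] by (intro holomorphic_intros) auto
    from holomorphic_on_compose[OF this holomorphic_on_subset[OF G]]
    show "(\<lambda>z. G (\<Lambda> t + Ln (z / g t))) holomorphic_on ball (g t) (cmod (g t))" by (simp add: o_def)
    have lim: "(\<Lambda> \<longlongrightarrow> \<Lambda> t) (at t within {0..1})" using \<Lambda>(1) t by (simp add: continuous_on)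
    have "((\<lambda>u. exp (\<Lambda> u)) \<longlongrightarrow> exp (\<Lambda> t)) (at t within {0..1})" by (intro tendsto_intros lim)
    hence "\<forall>\<^sub>F u in at t within {0..1}. dist (exp (\<Lambda> u)) (exp (\<Lambda> t)) < cmod (g t)"
      using nz[OF t] by (intro tendstoD) auto
    moreover have "\<forall>\<^sub>F u in at t within {0..1}. dist (\<Lambda> u) (\<Lambda> t) < 1" using lim by (rule tendstoD) simp
    moreover have "\<forall>\<^sub>F u in at t within {0..1}. u \<in> {0..1}" by (simp add: eventually_at_filter)
    ultimately show "\<forall>\<^sub>F u in at t within {0..1}. g u \<in> ball (g t) (cmod (g t)) \<and>
        (\<forall>\<^sub>F z in nhds (g u). G (\<Lambda> u + Ln (z / g u)) = G (\<Lambda> t + Ln (z / g t)))"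
    proof eventually_elim
      case (elim u)
      have "\<forall>\<^sub>F z in nhds (g u). z \<noteq> 0 \<and> cmod (Ln (z / g u)) < 1"
        using nz[OF elim(3)] by (intro eventually_Ln_quotient_small) auto
      hence "\<forall>\<^sub>F z in nhds (g u). G (\<Lambda> u + Ln (z / g u)) = G (\<Lambda> t + Ln (z / g t))"
      proof eventually_elim
        case (elim z)
        have "Ln (z / g t) = Ln (z / g u) + (\<Lambda> u - \<Lambda> t)"
        proof (rule Ln_eq_if_exp)
          show "exp (Ln (z / g u) + (\<Lambda> u - \<Lambda> t)) = z / g t"
            using elim nz[OF t] nz[OF \<open>u \<in> {0..1}\<close>] \<Lambda>(2)[OF t] \<Lambda>(2)[OF \<open>u \<in> {0..1}\<close>]
            by (simp add: exp_add exp_diff)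
          have "cmod (Ln (z / g u) + (\<Lambda> u - \<Lambda> t)) < 2"
            using norm_triangle_ineq[of "Ln (z / g u)" "\<Lambda> u - \<Lambda> t"] elim \<open>dist (\<Lambda> u) (\<Lambda> t) < 1\<close>
            by (simp add: dist_norm)
          thus "\<bar>Im (Ln (z / g u) + (\<Lambda> u - \<Lambda> t))\<bar> < pi"
            using abs_Im_le_cmod[of "Ln (z / g u) + (\<Lambda> u - \<Lambda> t)"] pi_ge_two by linarith
        qed
        thus ?case by (simp add: add.commute)
      qed
      thus ?case using elim \<Lambda>(2)[OF t] \<Lambda>(2)[OF elim(3)] by (simp add: dist_commute)
    qed
  qed
qed

text \<open>
  Off the cut \<open>\<bar>Im (Ln w)\<bar>\<close> is strictly less than \<open>\<pi>\<close>, which leaves room for the small summand \<open>Ln (z / w)\<close>.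
\<close>

lemma eventually_Ln_eq_add:
  assumes "w \<notin> \<real>\<^sub>\<le>\<^sub>0"
  shows "\<forall>\<^sub>F z in nhds w. z \<noteq> 0 \<and> Ln w + Ln (z / w) = Ln z"
proof -
  have w: "w \<noteq> 0" using assms by auto
  have "\<bar>Im (Ln w)\<bar> < pi"
    using assms w mpi_less_Im_Ln[OF w] Im_Ln_le_pi[OF w] Im_Ln_eq_pi[OF w]
    by (auto simp: abs_less_iff complex_nonpos_Reals_iff less_le)
  hence "\<forall>\<^sub>F z in nhds w. z \<noteq> 0 \<and> cmod (Ln (z / w)) < pi - \<bar>Im (Ln w)\<bar>"
    using w by (intro eventually_Ln_quotient_small) auto
  thus ?thesis
  proof eventually_elim
    case (elim z)
    have "Ln z = Ln w + Ln (z / w)"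
    proof (rule Ln_eq_if_exp)
      show "exp (Ln w + Ln (z / w)) = z" using w elim by (simp add: exp_add)
      show "\<bar>Im (Ln w + Ln (z / w))\<bar> < pi" using conjunct2[OF elim] abs_Im_le_cmod[of "Ln (z / w)"]
        unfolding plus_complex.sel by linarith
    qed
    thus ?case using elim by simp
  qed
qed

theorem theorem2:
  fixes m n p q :: nat
    and a \<alpha> b \<beta> :: "nat \<Rightarrow> real"
    and \<phi>1 \<phi>2 \<gamma> :: real
    and L_loop L_vert :: "real \<Rightarrow> complex"
  assumes "m \<le> q" and "n \<le> p"
    and "\<And>i. i \<in> {1..p} \<Longrightarrow> \<alpha> i > 0"
    and "\<And>j. j \<in> {1..q} \<Longrightarrow> \<beta> j > 0"
    and "\<And>i j k l. i \<in> {1..n} \<Longrightarrow> j \<in> {1..m} \<Longrightarrow>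
           \<alpha> i * (b j + real l) \<noteq> \<beta> j * (a i - real k - 1)"
    and "fox_Delta m n p q \<alpha> \<beta> > 0"
    and "fox_astar m n p q \<alpha> \<beta> > 0"
    and "left_loop \<phi>1 \<phi>2 L_loop" and "separates_poles m n a \<alpha> b \<beta> L_loop"
    and "vertical_contour \<gamma> L_vert" and "separates_poles m n a \<alpha> b \<beta> L_vert"
  shows
    "(\<forall>z. z \<noteq> 0 \<longrightarrow> curve_integrable (fox_integrand m n p q a \<alpha> b \<beta> (Arg z) z) L_loop) \<and>
     (\<forall>z. z \<noteq> 0 \<and> \<bar>Arg z\<bar> < fox_astar m n p q \<alpha> \<beta> * pi / 2 \<longrightarrow>
        curve_integrable (fox_integrand m n p q a \<alpha> b \<beta> (Arg z) z) L_vert \<and>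
        foxH m n p q a \<alpha> b \<beta> L_loop z = foxH m n p q a \<alpha> b \<beta> L_vert z) \<and>
     foxH m n p q a \<alpha> b \<beta> L_loop holomorphic_on (- \<real>\<^sub>\<le>\<^sub>0) \<and>
     (\<forall>g. path g \<and> path_image g \<subseteq> - {0} \<and> pathstart g \<notin> \<real>\<^sub>\<le>\<^sub>0 \<longrightarrow>
        (\<exists>\<theta> F. continuous_on {0..1} \<theta> \<and> \<theta> 0 = Arg (g 0) \<and>
           (\<forall>t\<in>{0..1}. g t = of_real (cmod (g t)) * cis (\<theta> t)) \<and>
           analytic_continuation_along g F \<and>
           (\<forall>\<^sub>F z in nhds (g 0). F 0 z = foxH m n p q a \<alpha> b \<beta> L_loop z) \<and>
           (\<forall>t\<in>{0..1}.
              curve_integrable (fox_integrand m n p q a \<alpha> b \<beta> (\<theta> t) (g t)) L_loop \<and>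
              F t (g t) = foxH_branch m n p q a \<alpha> b \<beta> L_loop (\<theta> t) (g t))))"
proof -
  interpret fox_parameters m n p q a \<alpha> b \<beta> using assms(1-4) by unfold_locales auto
  note loop = assms(6,8,9) and vert = assms(6,10,11)
  define G where "G = (\<lambda>\<zeta>. 1 / (2 * of_real pi * \<i>) * curve_integral (integrand \<zeta>) L_loop)"
  have G: "G holomorphic_on UNIV"
    unfolding G_def by (intro holomorphic_intros loop_integral(2)[OF loop])
  have branch: "foxH_branch m n p q a \<alpha> b \<beta> L_loop \<theta> z = G (of_real (ln (cmod z)) + \<i> * of_real \<theta>)" for \<theta> z
    by (simp add: foxH_branch_def fox_integrand_eq G_def)
  have foxH: "foxH m n p q a \<alpha> b \<beta> L_loop z = G (Ln z)" if "z \<noteq> 0" for z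
    using that by (simp add: foxH_def branch Ln_eq_ln_cmod_Arg)
  have int: "curve_integrable (fox_integrand m n p q a \<alpha> b \<beta> \<theta> z) L_loop" for \<theta> z
    unfolding curve_integrable_def fox_integrand_eq using loop_integral(1)[OF loop] by blast
  have 1: "curve_integrable (fox_integrand m n p q a \<alpha> b \<beta> (Arg z) z) L_vert \<and>
      foxH m n p q a \<alpha> b \<beta> L_loop z = foxH m n p q a \<alpha> b \<beta> L_vert z"
    if "\<bar>Arg z\<bar> < fox_astar m n p q \<alpha> \<beta> * pi / 2" for z
  proof -
    have Im: "\<bar>Im (of_real (ln (cmod z)) + \<i> * of_real (Arg z))\<bar> < astar * pi / 2" using that by simp
    show ?thesis
      using vertical_integral[OF vert Im] loop_integral_eq_vertical_integral[OF loop vert(2,3) Im]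
      unfolding curve_integrable_def foxH_def foxH_branch_def fox_integrand_eq by auto
  qed
  have "(\<lambda>z. G (Ln z)) holomorphic_on - \<real>\<^sub>\<le>\<^sub>0"
  proof -
    have "Ln holomorphic_on - \<real>\<^sub>\<le>\<^sub>0" by (intro holomorphic_intros) auto
    from holomorphic_on_compose[OF this holomorphic_on_subset[OF G]] show ?thesis by (simp add: o_def)
  qed
  moreover have "foxH m n p q a \<alpha> b \<beta> L_loop holomorphic_on - \<real>\<^sub>\<le>\<^sub>0
      \<longleftrightarrow> (\<lambda>z. G (Ln z)) holomorphic_on - \<real>\<^sub>\<le>\<^sub>0"
    by (intro holomorphic_cong refl foxH) auto
  ultimately have 2: "foxH m n p q a \<alpha> b \<beta> L_loop holomorphic_on - \<real>\<^sub>\<le>\<^sub>0"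
    by (rule iffD2[rotated])
  have 3: "\<exists>\<theta> F. continuous_on {0..1} \<theta> \<and> \<theta> 0 = Arg (g 0) \<and>
           (\<forall>t\<in>{0..1}. g t = of_real (cmod (g t)) * cis (\<theta> t)) \<and>
           analytic_continuation_along g F \<and>
           (\<forall>\<^sub>F z in nhds (g 0). F 0 z = foxH m n p q a \<alpha> b \<beta> L_loop z) \<and>
           (\<forall>t\<in>{0..1}.
              curve_integrable (fox_integrand m n p q a \<alpha> b \<beta> (\<theta> t) (g t)) L_loop \<and>
              F t (g t) = foxH_branch m n p q a \<alpha> b \<beta> L_loop (\<theta> t) (g t))"
    if g: "path g" "path_image g \<subseteq> - {0}" "pathstart g \<notin> \<real>\<^sub>\<le>\<^sub>0" for g
  proof -
    obtain \<Lambda> where \<Lambda>: "continuous_on {0..1} \<Lambda>" "\<Lambda> 0 = Ln (g 0)" "\<And>t. t \<in> {0..1} \<Longrightarrow> exp (\<Lambda> t) = g t"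
      using path_logarithm[OF g(1,2)] by blast
    have nz: "g t \<noteq> 0" if "t \<in> {0..1}" for t using \<Lambda>(3)[OF that] by (metis exp_not_eq_zero)
    have cmod: "cmod (g t) = exp (Re (\<Lambda> t))" if "t \<in> {0..1}" for t
      using \<Lambda>(3)[OF that] by (metis norm_exp_eq_Re)
    have polar: "g t = of_real (cmod (g t)) * cis (Im (\<Lambda> t))" if "t \<in> {0..1}" for t
      using \<Lambda>(3)[OF that] unfolding cmod[OF that] by (metis exp_eq_polar exp_of_real)
    have log: "of_real (ln (cmod (g t))) + \<i> * of_real (Im (\<Lambda> t)) = \<Lambda> t" if "t \<in> {0..1}" for t
      unfolding cmod[OF that] by (simp add: complex_eq_iff)
    define F where "F = (\<lambda>t z. G (\<Lambda> t + Ln (z / g t)))"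
    have "\<forall>\<^sub>F z in nhds (g 0). z \<noteq> 0 \<and> Ln (g 0) + Ln (z / g 0) = Ln z"
      using g(3) by (intro eventually_Ln_eq_add) (simp add: pathstart_def)
    hence "\<forall>\<^sub>F z in nhds (g 0). F 0 z = foxH m n p q a \<alpha> b \<beta> L_loop z"
      by eventually_elim (simp add: F_def \<Lambda>(2) foxH)
    moreover have "analytic_continuation_along g F"
      unfolding F_def by (rule analytic_continuation_along_logarithm[OF G \<Lambda>(1,3)])
    moreover have "F t (g t) = foxH_branch m n p q a \<alpha> b \<beta> L_loop (Im (\<Lambda> t)) (g t)" if "t \<in> {0..1}" for t
      using nz[OF that] log[OF that] by (simp add: F_def branch)
    moreover have "Im (\<Lambda> 0) = Arg (g 0)" using nz[of 0] by (simp add: \<Lambda>(2) Arg_eq_Im_Ln)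
    moreover have "continuous_on {0..1} (\<lambda>t. Im (\<Lambda> t))" by (intro continuous_intros \<Lambda>)
    ultimately show ?thesis using polar int
      by (intro exI[of _ "\<lambda>t. Im (\<Lambda> t)"] exI[of _ F]) blast
  qed
  show ?thesis using int 1 2 3 by blast
qed

end
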